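(* Let $V$ be a compact operator on $\ell^2(\mathbb{Z})$ with $V\in\mathcal{A}(A_0)$, and let $H_V=H_0+V$. Then the possible limit points of $\sigma_{\mathrm{disc}}(H_V)$ belong to $\{0,4\}$.
   Context: $H_0$ is the bounded selfadjoint operator on $\ell^2(\mathbb{Z})$ given by $(H_0x)(n)=2x(n)-x(n+1)-x(n-1)$; its spectrum is $[0,4]$. For bounded $V$, $H_V:=H_0+V$. $\mathbb{T}=\mathbb{R}/2\pi\mathbb{Z}$; the unitary discrete Fourier transform $\mathcal{F}:\ell^2(\mathbb{Z})\to L^2(\mathbb{T})$ is $(\mathcal{F}x)(\alpha)=(2\pi)^{-1/2}\sum_{n}e^{-in\alpha}x(n)$. $\widehat{A}_0$ is the unique selfadjoint extension in $L^2(\mathbb{T})$ of the symmetric operator $\sin\alpha\,(-i\partial_\alpha)+(-i\partial_\alpha)\sin\alpha$ defined on $C^\infty(\mathbb{T})$, and $A_0:=\mathcal{F}^{-1}\widehat{A}_0\mathcal{F}$. For a selfadjoint operator $A$ on a Hilbert space $\mathscr{H}$ and $R>0$, a bounded operator $B$ belongs to $\mathcal{A}_R(A)$ if the map $\theta\mapsto e^{i\theta A}Be^{-i\theta A}$, defined for real $\theta$, extends holomorphically to $D_R(0)=\{\theta\in\mathbb{C}:|\theta|<R\}$ with values in $\mathcal{B}(\mathscr{H})$ (bounded operators, operator norm). $\mathcal{A}(A):=\bigcup_{R>0}\mathcal{A}_R(A)$. $\sigma_{\mathrm{disc}}(L)$ denotes the set of isolated points $z$ of $\sigma(L)$ with finite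 algebraic multiplicity, i.e. whose Riesz projection $\frac{1}{2i\pi}\int_\gamma(L-\zeta)^{-1}d\zeta$ has finite rank ($\gamma$ a small positively oriented circle separating $z$ from the rest of $\sigma(L)$). *)

theory Defs
  imports "HOL-Complex_Analysis.Complex_Analysis"
begin

section \<open>Complex Hilbert spaces\<close>

text \<open>The complex inner product is conjugate-linear in its first argument.\<close>

class complex_hilbert = real_inner + banach +
  fixes scaleC :: "complex \<Rightarrow> 'a \<Rightarrow> 'a" (infixr "*\<^sub>C" 75)
    and cinner :: "'a \<Rightarrow> 'a \<Rightarrow> complex"
  assumes scaleC_add_right: "c *\<^sub>C (x + y) = c *\<^sub>C x + c *\<^sub>C y"
    and scaleC_add_left: "(c + d) *\<^sub>C x = c *\<^sub>C x + d *\<^sub>C x"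
    and scaleC_scaleC: "c *\<^sub>C (d *\<^sub>C x) = (c * d) *\<^sub>C x"
    and scaleR_scaleC: "r *\<^sub>R x = complex_of_real r *\<^sub>C x"
    and cinner_commute: "cinner x y = cnj (cinner y x)"
    and cinner_add_left: "cinner (x + y) z = cinner x z + cinner y z"
    and cinner_scaleC_left: "cinner (c *\<^sub>C x) y = cnj c * cinner x y"
    and inner_eq_Re_cinner: "inner x y = Re (cinner x y)"

lemma scaleC_one: "1 *\<^sub>C x = (x :: 'a :: complex_hilbert)"
  using scaleR_scaleC[of 1 x, symmetric] by simp

lemma cinner_scaleC_right:
  fixes x :: "'a :: complex_hilbert"
  shows "cinner x (c *\<^sub>C y) = c * cinner x y"
  by (metis cinner_commute cinner_scaleC_left complex_cnj_cnj complex_cnj_mult)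

lemma norm_scaleC:
  fixes x :: "'a :: complex_hilbert"
  shows "norm (c *\<^sub>C x) = cmod c * norm x"
proof -
  have "cinner (c *\<^sub>C x) (c *\<^sub>C x) = complex_of_real ((cmod c)\<^sup>2) * cinner x x"
    unfolding cinner_scaleC_left cinner_scaleC_right complex_norm_square
    by (simp only: mult_ac)
  then have "inner (c *\<^sub>C x) (c *\<^sub>C x) = (cmod c)\<^sup>2 * inner x x"
    by (simp add: inner_eq_Re_cinner)
  then show ?thesis
    by (simp add: norm_eq_sqrt_inner real_sqrt_mult)
qed

lemma vector_space_scaleC:
  "vector_space (scaleC :: complex \<Rightarrow> 'a \<Rightarrow> 'a :: complex_hilbert)"
  by unfold_locales
     (rule scaleC_add_right scaleC_add_left scaleC_scaleC scaleC_one)+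


section \<open>Bounded operators and their spectra\<close>

text \<open>The library type of bounded linear operators only knows real-linear maps; its norm is
  the operator norm. The algebra of bounded operators on a complex Hilbert space is the subset
  of its complex-linear elements.\<close>

definition bounded_ops :: "('a::complex_hilbert \<Rightarrow>\<^sub>L 'a) set" where
  "bounded_ops = {B. \<forall>c x. blinfun_apply B (c *\<^sub>C x) = c *\<^sub>C blinfun_apply B x}"

lift_definition scalar_op :: "complex \<Rightarrow> 'a::complex_hilbert \<Rightarrow>\<^sub>L 'a" is "\<lambda>c x. c *\<^sub>C x"
proof -
  fix c :: complex
  show "bounded_linear (\<lambda>x::'a. c *\<^sub>C x)"
  proof (rule bounded_linear_intro[where K = "cmod c"])
    fix r :: real and x y :: 'a
    show "c *\<^sub>C (x + y) = c *\<^sub>C x + c *\<^sub>C y" by (rule scaleC_add_right)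
    show "c *\<^sub>C (r *\<^sub>R x) = r *\<^sub>R (c *\<^sub>C x)"
      by (simp only: scaleR_scaleC scaleC_scaleC mult.commute)
    show "norm (c *\<^sub>C x) \<le> norm x * cmod c" by (simp add: norm_scaleC mult.commute)
  qed
qed

definition is_op_inverse :: "('a::complex_hilbert \<Rightarrow>\<^sub>L 'a) \<Rightarrow> ('a \<Rightarrow>\<^sub>L 'a) \<Rightarrow> bool" where
  "is_op_inverse L R \<longleftrightarrow> R \<in> bounded_ops \<and> R o\<^sub>L L = id_blinfun \<and> L o\<^sub>L R = id_blinfun"

definition spectrum :: "('a::complex_hilbert \<Rightarrow>\<^sub>L 'a) \<Rightarrow> complex set" where
  "spectrum L = {z. \<not> (\<exists>R. is_op_inverse (L - scalar_op z) R)}"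

definition resolvent :: "('a::complex_hilbert \<Rightarrow>\<^sub>L 'a) \<Rightarrow> complex \<Rightarrow> 'a \<Rightarrow>\<^sub>L 'a" where
  "resolvent L z = (THE R. is_op_inverse (L - scalar_op z) R)"

definition op_contour_integral ::
    "(real \<Rightarrow> complex) \<Rightarrow> (complex \<Rightarrow> 'a::complex_hilbert \<Rightarrow>\<^sub>L 'a) \<Rightarrow> 'a \<Rightarrow>\<^sub>L 'a" where
  "op_contour_integral g f =
     integral {0..1} (\<lambda>t. scalar_op (vector_derivative g (at t within {0..1})) o\<^sub>L f (g t))"

text \<open>With the resolvent written as \<open>(L - \<zeta>)\<^sup>-\<^sup>1\<close> and the circle positively oriented this is minus
  the usual projection, which does not affect its rank.\<close>

definition riesz_projection ::
    "('a::complex_hilbert \<Rightarrow>\<^sub>L 'a) \<Rightarrow> complex \<Rightarrow> real \<Rightarrow> 'a \<Rightarrow>\<^sub>L 'a" where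
  "riesz_projection L z r =
     scalar_op (1 / (2 * \<i> * pi)) o\<^sub>L op_contour_integral (circlepath z r) (resolvent L)"

definition finite_rank :: "('a::complex_hilbert \<Rightarrow>\<^sub>L 'a) \<Rightarrow> bool" where
  "finite_rank B \<longleftrightarrow> (\<exists>S. finite S \<and> range (blinfun_apply B) \<subseteq> module.span scaleC S)"

definition discrete_spectrum :: "('a::complex_hilbert \<Rightarrow>\<^sub>L 'a) \<Rightarrow> complex set" where
  "discrete_spectrum L =
     {z. z isolated_in spectrum L \<and>
         (\<exists>r>0. spectrum L \<inter> cball z r = {z} \<and> finite_rank (riesz_projection L z r))}"

definition compact_op :: "('a::complex_hilbert \<Rightarrow>\<^sub>L 'a) \<Rightarrow> bool" where
  "compact_op B \<longleftrightarrow> B \<in> bounded_ops \<and> compact (closure (blinfun_apply B ` cball 0 1))"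


section \<open>Unbounded selfadjoint operators and the classes of analytic bounded operators\<close>

text \<open>Unbounded operators are represented by their graphs, so that extension of operators
  is inclusion.\<close>

definition linear_operator :: "('a::complex_hilbert \<times> 'a) set \<Rightarrow> bool" where
  "linear_operator A \<longleftrightarrow>
     single_valued A \<and> (0, 0) \<in> A \<and>
     (\<forall>x y x' y'. (x, y) \<in> A \<longrightarrow> (x', y') \<in> A \<longrightarrow> (x + x', y + y') \<in> A) \<and>
     (\<forall>c x y. (x, y) \<in> A \<longrightarrow> (c *\<^sub>C x, c *\<^sub>C y) \<in> A)"

definition adjoint_graph :: "('a::complex_hilbert \<times> 'a) set \<Rightarrow> ('a \<times> 'a) set" where
  "adjoint_graph A = {(y, z). \<forall>(x, w) \<in> A. cinner y w = cinner z x}"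

definition selfadjoint :: "('a::complex_hilbert \<times> 'a) set \<Rightarrow> bool" where
  "selfadjoint A \<longleftrightarrow>
     linear_operator A \<and> closure (Domain A) = UNIV \<and> adjoint_graph A = A"

definition unitary_group :: "(real \<Rightarrow> 'a::complex_hilbert \<Rightarrow>\<^sub>L 'a) \<Rightarrow> bool" where
  "unitary_group U \<longleftrightarrow>
     (\<forall>t. U t \<in> bounded_ops \<and> surj (blinfun_apply (U t)) \<and>
          (\<forall>x y. cinner (U t x) (U t y) = cinner x y)) \<and>
     U 0 = id_blinfun \<and> (\<forall>s t. U (s + t) = U s o\<^sub>L U t) \<and>
     (\<forall>x. continuous_on UNIV (\<lambda>t. U t x))"

text \<open>The graph of the operator \<open>A\<close> with \<open>i A x = d/dt U(t) x\<close> at \<open>t = 0\<close>, on the domain of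
  all \<open>x\<close> for which the derivative exists.\<close>

definition generator :: "(real \<Rightarrow> 'a::complex_hilbert \<Rightarrow>\<^sub>L 'a) \<Rightarrow> ('a \<times> 'a) set" where
  "generator U = {(x, y). ((\<lambda>t. U t x) has_vector_derivative (\<i> *\<^sub>C y)) (at 0)}"

text \<open>\<open>exp_i A t\<close> is \<open>exp(i t A)\<close> for selfadjoint \<open>A\<close>: by Stone's theorem there is exactly one
  strongly continuous unitary group with generator \<open>A\<close>.\<close>

definition exp_i :: "('a::complex_hilbert \<times> 'a) set \<Rightarrow> real \<Rightarrow> 'a \<Rightarrow>\<^sub>L 'a" where
  "exp_i A = (THE U. unitary_group U \<and> generator U = A)"

definition op_holomorphic_on ::
    "(complex \<Rightarrow> 'a::complex_hilbert \<Rightarrow>\<^sub>L 'a) \<Rightarrow> complex set \<Rightarrow> bool" where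
  "op_holomorphic_on F S \<longleftrightarrow>
     (\<forall>z\<in>S. F z \<in> bounded_ops) \<and>
     (\<forall>z\<in>S. \<exists>D\<in>bounded_ops. (F has_derivative (\<lambda>h. scalar_op h o\<^sub>L D)) (at z within S))"

definition analytic_class_R ::
    "real \<Rightarrow> ('a::complex_hilbert \<times> 'a) set \<Rightarrow> ('a \<Rightarrow>\<^sub>L 'a) set" where
  "analytic_class_R R A =
     {B \<in> bounded_ops. \<exists>F. op_holomorphic_on F (ball 0 R) \<and>
        (\<forall>t::real. \<bar>t\<bar> < R \<longrightarrow>
           F (complex_of_real t) = exp_i A t o\<^sub>L B o\<^sub>L exp_i A (- t))}"

definition analytic_class :: "('a::complex_hilbert \<times> 'a) set \<Rightarrow> ('a \<Rightarrow>\<^sub>L 'a) set" where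
  "analytic_class A = (\<Union>R\<in>{0<..}. analytic_class_R R A)"


section \<open>Square-integrable functions\<close>

definition sq_integrable :: "'a measure \<Rightarrow> ('a \<Rightarrow> complex) \<Rightarrow> bool" where
  "sq_integrable M f \<longleftrightarrow> f \<in> borel_measurable M \<and> integrable M (\<lambda>x. (cmod (f x))\<^sup>2)"

lemma sq_integrable_cmult:
  assumes "sq_integrable M f"
  shows "sq_integrable M (\<lambda>x. c * f x)"
  using assms unfolding sq_integrable_def
  by (auto simp: norm_mult power_mult_distrib)

lemma sq_integrable_add:
  assumes "sq_integrable M f" "sq_integrable M g"
  shows "sq_integrable M (\<lambda>x. f x + g x)"
proof -
  have [measurable]: "f \<in> borel_measurable M" "g \<in> borel_measurable M"
    using assms by (auto simp: sq_integrable_def)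
  have "integrable M (\<lambda>x. 2 * (cmod (f x))\<^sup>2 + 2 * (cmod (g x))\<^sup>2)"
    using assms by (auto simp: sq_integrable_def)
  then have "integrable M (\<lambda>x. (cmod (f x + g x))\<^sup>2)"
  proof (rule Bochner_Integration.integrable_bound)
    have "(cmod (f x + g x))\<^sup>2 \<le> 2 * (cmod (f x))\<^sup>2 + 2 * (cmod (g x))\<^sup>2" for x
    proof -
      have "(cmod (f x + g x))\<^sup>2 \<le> (cmod (f x) + cmod (g x))\<^sup>2"
        by (simp add: norm_triangle_ineq power_mono)
      also have "\<dots> \<le> 2 * (cmod (f x))\<^sup>2 + 2 * (cmod (g x))\<^sup>2"
        using sum_squares_bound[of "cmod (f x)" "cmod (g x)"] by (simp add: power2_sum)
      finally show ?thesis .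
    qed
    then show "AE x in M. norm ((cmod (f x + g x))\<^sup>2) \<le>
        norm (2 * (cmod (f x))\<^sup>2 + 2 * (cmod (g x))\<^sup>2)"
      by simp
  qed auto
  then show ?thesis by (simp add: sq_integrable_def)
qed

lemma sq_integrable_diff:
  assumes "sq_integrable M f" "sq_integrable M g"
  shows "sq_integrable M (\<lambda>x. f x - g x)"
  using sq_integrable_add[OF assms(1) sq_integrable_cmult[OF assms(2), of "-1"]] by simp

lemma borel_measurable_cnj [measurable]: "cnj \<in> borel_measurable borel"
  by (intro borel_measurable_continuous_onI continuous_intros)

lemma integrable_cnj_mult:
  assumes "sq_integrable M f" "sq_integrable M g"
  shows "integrable M (\<lambda>x. cnj (f x) * g x)"
proof -
  have [measurable]: "f \<in> borel_measurable M" "g \<in> borel_measurable M"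
    using assms by (auto simp: sq_integrable_def)
  have "integrable M (\<lambda>x. (cmod (f x))\<^sup>2 + (cmod (g x))\<^sup>2)"
    using assms by (auto simp: sq_integrable_def)
  then show ?thesis
  proof (rule Bochner_Integration.integrable_bound)
    have "cmod (f x) * cmod (g x) \<le> (cmod (f x))\<^sup>2 + (cmod (g x))\<^sup>2" for x
      proof -
      have "0 \<le> cmod (f x) * cmod (g x)" by simp
      then show ?thesis
        using sum_squares_bound[of "cmod (f x)" "cmod (g x)"] by (simp only: mult.assoc)
    qed
    then show "AE x in M. norm (cnj (f x) * g x) \<le> norm ((cmod (f x))\<^sup>2 + (cmod (g x))\<^sup>2)"
      by (simp add: norm_mult)
  qed measurable
qed

lemma integral_cnj_mult_commute:
  "(LINT x|M. cnj (f x) * g x) = cnj (LINT x|M. cnj (g x) * f x)"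
proof -
  have "cnj (LINT x|M. cnj (g x) * f x) = (LINT x|M. cnj (cnj (g x) * f x))"
    by (rule Bochner_Integration.integral_cnj[symmetric])
  also have "\<dots> = (LINT x|M. cnj (f x) * g x)"
    by (simp only: complex_cnj_mult complex_cnj_cnj mult.commute)
  finally show ?thesis by (rule sym)
qed

lemma integral_cnj_mult_add:
  assumes "sq_integrable M f" "sq_integrable M g" "sq_integrable M h"
  shows "(LINT x|M. cnj (f x + g x) * h x) =
    (LINT x|M. cnj (f x) * h x) + (LINT x|M. cnj (g x) * h x)"
  using Bochner_Integration.integral_add[OF integrable_cnj_mult[OF assms(1,3)]
      integrable_cnj_mult[OF assms(2,3)]]
  by (simp only: complex_cnj_add distrib_right)

lemma integral_cnj_mult_scale:
  "(LINT x|M. cnj (c * f x) * g x) = cnj c * (LINT x|M. cnj (f x) * g x)"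
  by (simp only: complex_cnj_mult mult.assoc integral_mult_right_zero)

lemma Re_complex_of_real_mult: "Re (complex_of_real r * z) = r * Re z"
  by simp

lemma Re_integral_cnj_mult_self:
  "Re (LINT x|M. cnj (f x) * f x) = (LINT x|M. (cmod (f x))\<^sup>2)"
proof -
  have "(LINT x|M. cnj (f x) * f x) = (LINT x|M. complex_of_real ((cmod (f x))\<^sup>2))"
    by (intro Bochner_Integration.integral_cong refl) (simp only: complex_norm_square mult.commute)
  then show ?thesis
    by (simp only: integral_complex_of_real Re_complex_of_real)
qed

lemma sq_integrable_complete:
  fixes f :: "nat \<Rightarrow> 'a \<Rightarrow> complex"
  assumes f: "\<And>n. sq_integrable M (f n)"
    and cauchy: "\<And>e. e > 0 \<Longrightarrow>
      \<exists>N. \<forall>m\<ge>N. \<forall>n\<ge>N. (LINT x|M. (cmod (f m x - f n x))\<^sup>2) < e"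
  shows "\<exists>g. sq_integrable M g \<and> (\<lambda>n. LINT x|M. (cmod (f n x - g x))\<^sup>2) \<longlonglongrightarrow> 0"
proof -
  have [measurable]: "f n \<in> borel_measurable M" for n
    using f by (auto simp: sq_integrable_def)
  have int: "integrable M (\<lambda>x. (cmod (f m x - f n x))\<^sup>2)" for m n
    using sq_integrable_diff[OF f f] by (auto simp: sq_integrable_def)
  have nn: "(\<integral>\<^sup>+x. ennreal ((cmod (f m x - f n x))\<^sup>2) \<partial>M) =
      ennreal (LINT x|M. (cmod (f m x - f n x))\<^sup>2)" for m n
    by (rule nn_integral_eq_integral[OF int]) simp
  have "\<exists>N. \<forall>k. \<forall>m\<ge>N k. \<forall>n\<ge>N k. (LINT x|M. (cmod (f m x - f n x))\<^sup>2) < (1/8)^k"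
    by (rule choice) (use cauchy in auto)
  then obtain N where
    N: "\<And>k m n. m \<ge> N k \<Longrightarrow> n \<ge> N k \<Longrightarrow> (LINT x|M. (cmod (f m x - f n x))\<^sup>2) < (1/8)^k"
    by blast
  define s where "s k = k + (\<Sum>j\<le>k. N j)" for k
  have sN: "s k \<ge> N k" for k
    unfolding s_def by (rule trans_le_add2, rule member_le_sum) auto
  have s_suc: "s k \<le> s (Suc k)" for k by (simp add: s_def)
  have sN': "s (Suc k) \<ge> N k" for k using sN[of k] s_suc[of k] by linarith
  have s_ge: "s k \<ge> k" for k by (simp add: s_def)
  define h where "h x = (\<Sum>k. ennreal (4^k * (cmod (f (s (Suc k)) x - f (s k) x))\<^sup>2))" for x
  have [measurable]: "h \<in> borel_measurable M" unfolding h_def by measurable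
  have "(\<integral>\<^sup>+x. h x \<partial>M) =
      (\<Sum>k. \<integral>\<^sup>+x. ennreal (4^k * (cmod (f (s (Suc k)) x - f (s k) x))\<^sup>2) \<partial>M)"
    unfolding h_def by (rule nn_integral_suminf) measurable
  also have "\<dots> \<le> (\<Sum>k. ennreal ((1/2)^k))"
  proof (rule suminf_le)
    fix k
    have "(\<integral>\<^sup>+x. ennreal (4^k * (cmod (f (s (Suc k)) x - f (s k) x))\<^sup>2) \<partial>M) =
        ennreal (4^k) * (\<integral>\<^sup>+x. ennreal ((cmod (f (s (Suc k)) x - f (s k) x))\<^sup>2) \<partial>M)"
      by (subst nn_integral_cmult[symmetric]) (auto simp: ennreal_mult)
    also have "\<dots> = ennreal (4^k * (LINT x|M. (cmod (f (s (Suc k)) x - f (s k) x))\<^sup>2))"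
      unfolding nn by (subst ennreal_mult) auto
    also have "\<dots> \<le> ennreal (4^k * (1/8)^k)"
      using N[OF sN' sN, of k] by (intro ennreal_leI mult_left_mono) auto
    also have "(4::real)^k * (1/8)^k = (1/2)^k"
      by (simp add: power_mult_distrib[symmetric])
    finally show "(\<integral>\<^sup>+x. ennreal (4^k * (cmod (f (s (Suc k)) x - f (s k) x))\<^sup>2) \<partial>M)
      \<le> ennreal ((1/2)^k)" .
  qed auto
  also have "\<dots> = ennreal (\<Sum>k. (1/2)^k)"
    by (rule suminf_ennreal2) (auto intro: summable_geometric)
  also have "\<dots> < \<infinity>" by simp
  finally have "(\<integral>\<^sup>+x. h x \<partial>M) \<noteq> \<infinity>" by simp
  then have "AE x in M. h x \<noteq> \<infinity>" by (intro nn_integral_noteq_infinite) auto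
  then have conv: "AE x in M. convergent (\<lambda>k. f (s k) x)"
  proof eventually_elim
    fix x assume hx: "h x \<noteq> \<infinity>"
    define c where "c = enn2real (h x)"
    have hc: "h x = ennreal c" using hx by (simp add: c_def less_top)
    have bound: "cmod (f (s (Suc k)) x - f (s k) x) \<le> sqrt c * (1/2)^k" for k
    proof -
      have four: "((2::real)^k)\<^sup>2 = 4^k"
        by (simp add: power2_eq_square power_mult_distrib[symmetric])
      let ?u = "\<lambda>k. ennreal (4^k * (cmod (f (s (Suc k)) x - f (s k) x))\<^sup>2)"
      have "sum ?u {k} \<le> suminf ?u" by (rule sum_le_suminf) auto
      then have "?u k \<le> ennreal c" unfolding h_def[symmetric] hc by simp
      moreover have "0 \<le> c" by (simp add: c_def)
      ultimately have "4^k * (cmod (f (s (Suc k)) x - f (s k) x))\<^sup>2 \<le> c"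
        by (simp only: ennreal_le_iff)
      then have "(2^k * cmod (f (s (Suc k)) x - f (s k) x))\<^sup>2 \<le> c"
        unfolding power_mult_distrib four .
      then have "2^k * cmod (f (s (Suc k)) x - f (s k) x) \<le> sqrt c"
        by (rule real_le_rsqrt)
      then have "cmod (f (s (Suc k)) x - f (s k) x) \<le> sqrt c / 2^k"
        by (simp only: pos_le_divide_eq[OF zero_less_power[OF zero_less_numeral]] mult.commute)
      then show ?thesis by (simp only: power_one_over times_divide_eq_right mult_1_right)
    qed
    have geom: "summable (\<lambda>k. sqrt c * (1/2)^k)"
      by (rule summable_mult, rule summable_geometric) simp
    have "summable (\<lambda>k. f (s (Suc k)) x - f (s k) x)"
      by (rule summable_comparison_test'[OF geom, of 0]) (rule bound)
    then have "convergent (\<lambda>n. \<Sum>k<n. f (s (Suc k)) x - f (s k) x)"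
      unfolding summable_iff_convergent .
    then have "convergent (\<lambda>n. f (s n) x - f (s 0) x)"
      unfolding sum_lessThan_telescope[of "\<lambda>k. f (s k) x"] .
    then have "convergent (\<lambda>n. (f (s n) x - f (s 0) x) + f (s 0) x)"
      by (intro convergent_add convergent_const)
    then show "convergent (\<lambda>n. f (s n) x)" by simp
  qed
  define g where "g x = lim (\<lambda>k. f (s k) x)" for x
  have [measurable]: "g \<in> borel_measurable M"
    unfolding g_def by measurable
  have lim: "AE x in M. (\<lambda>k. f (s k) x) \<longlonglongrightarrow> g x"
    using conv by eventually_elim (simp add: g_def convergent_LIMSEQ_iff)
  have fatou: "(\<integral>\<^sup>+x. ennreal ((cmod (f n x - g x))\<^sup>2) \<partial>M) \<le> ennreal e"
    if e: "\<And>m. m \<ge> K \<Longrightarrow> (LINT x|M. (cmod (f n x - f m x))\<^sup>2) \<le> e" for n K e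
  proof -
    have "(\<integral>\<^sup>+x. ennreal ((cmod (f n x - g x))\<^sup>2) \<partial>M) =
        (\<integral>\<^sup>+x. liminf (\<lambda>k. ennreal ((cmod (f n x - f (s k) x))\<^sup>2)) \<partial>M)"
    proof (rule nn_integral_cong_AE)
      show "AE x in M. ennreal ((cmod (f n x - g x))\<^sup>2) =
          liminf (\<lambda>k. ennreal ((cmod (f n x - f (s k) x))\<^sup>2))"
        using lim
      proof eventually_elim
        fix x assume "(\<lambda>k. f (s k) x) \<longlonglongrightarrow> g x"
        then have "(\<lambda>k. ennreal ((cmod (f n x - f (s k) x))\<^sup>2)) \<longlonglongrightarrow>
            ennreal ((cmod (f n x - g x))\<^sup>2)"
          by (intro tendsto_intros)
        then show "ennreal ((cmod (f n x - g x))\<^sup>2) =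
            liminf (\<lambda>k. ennreal ((cmod (f n x - f (s k) x))\<^sup>2))"
          by (intro lim_imp_Liminf[symmetric] trivial_limit_sequentially)
      qed
    qed
    also have "\<dots> \<le> liminf (\<lambda>k. \<integral>\<^sup>+x. ennreal ((cmod (f n x - f (s k) x))\<^sup>2) \<partial>M)"
      by (rule nn_integral_liminf) measurable
    also have "\<dots> \<le> liminf (\<lambda>k. ennreal e)"
    proof (rule Liminf_mono)
      show "\<forall>\<^sub>F k in sequentially.
          (\<integral>\<^sup>+x. ennreal ((cmod (f n x - f (s k) x))\<^sup>2) \<partial>M) \<le> ennreal e"
        using eventually_ge_at_top[of K]
      proof eventually_elim
        fix k assume "K \<le> k"
        then have "K \<le> s k" using s_ge[of k] by linarith
        then show "(\<integral>\<^sup>+x. ennreal ((cmod (f n x - f (s k) x))\<^sup>2) \<partial>M) \<le> ennreal e"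
          unfolding nn using e by (intro ennreal_leI) auto
      qed
    qed
    also have "\<dots> = ennreal e" by (simp add: Liminf_const)
    finally show ?thesis .
  qed
  have small: "\<exists>K. \<forall>n\<ge>K. (\<integral>\<^sup>+x. ennreal ((cmod (f n x - g x))\<^sup>2) \<partial>M) \<le> ennreal e"
    if e: "e > 0" for e
  proof -
    obtain K where K: "\<And>m n. m \<ge> K \<Longrightarrow> n \<ge> K \<Longrightarrow>
        (LINT x|M. (cmod (f m x - f n x))\<^sup>2) < e"
      using cauchy[OF e] by blast
    show ?thesis
    proof (intro exI[of _ K] allI impI)
      fix n assume "n \<ge> K"
      then show "(\<integral>\<^sup>+x. ennreal ((cmod (f n x - g x))\<^sup>2) \<partial>M) \<le> ennreal e"
        by (intro fatou[of K] less_imp_le[OF K])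
    qed
  qed
  obtain K where K: "(\<integral>\<^sup>+x. ennreal ((cmod (f K x - g x))\<^sup>2) \<partial>M) \<le> ennreal 1"
    using small[of 1] by auto
  have "integrable M (\<lambda>x. (cmod (f K x - g x))\<^sup>2)"
  proof (rule integrableI_bounded)
    show "(\<integral>\<^sup>+x. ennreal (norm ((cmod (f K x - g x))\<^sup>2)) \<partial>M) < \<infinity>"
      using K by (simp add: le_less_trans)
  qed measurable
  then have "sq_integrable M (\<lambda>x. f K x - g x)" by (simp add: sq_integrable_def)
  from sq_integrable_diff[OF f[of K] this] have g: "sq_integrable M g" by simp
  have "(\<lambda>n. LINT x|M. (cmod (f n x - g x))\<^sup>2) \<longlonglongrightarrow> 0"
  proof (rule LIMSEQ_I)
    fix r :: real assume "r > 0"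
    then obtain K where
      K: "\<forall>n\<ge>K. (\<integral>\<^sup>+x. ennreal ((cmod (f n x - g x))\<^sup>2) \<partial>M) \<le> ennreal (r/2)"
      using small[of "r/2"] by auto
    have "norm ((LINT x|M. (cmod (f n x - g x))\<^sup>2) - 0) < r" if "n \<ge> K" for n
    proof -
      have "integrable M (\<lambda>x. (cmod (f n x - g x))\<^sup>2)"
        using sq_integrable_diff[OF f g] by (simp add: sq_integrable_def)
      then have "(\<integral>\<^sup>+x. ennreal ((cmod (f n x - g x))\<^sup>2) \<partial>M) =
          ennreal (LINT x|M. (cmod (f n x - g x))\<^sup>2)"
        by (rule nn_integral_eq_integral) simp
      moreover have "(\<integral>\<^sup>+x. ennreal ((cmod (f n x - g x))\<^sup>2) \<partial>M) \<le> ennreal (r/2)"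
        using K that by blast
      ultimately have "ennreal (LINT x|M. (cmod (f n x - g x))\<^sup>2) \<le> ennreal (r/2)"
        by (simp only:)
      then have "(LINT x|M. (cmod (f n x - g x))\<^sup>2) \<le> r/2"
        using \<open>r > 0\<close> by simp
      then show ?thesis using \<open>r > 0\<close> by simp
    qed
    then show "\<exists>no. \<forall>n\<ge>no. norm ((LINT x|M. (cmod (f n x - g x))\<^sup>2) - 0) < r" by blast
  qed
  with g show ?thesis by blast
qed


lemma square_less_if_less_sqrt:
  assumes "x < sqrt e" "0 \<le> x"
  shows "x\<^sup>2 < e"
proof (rule ccontr)
  assume "\<not> x\<^sup>2 < e"
  then have "sqrt e \<le> sqrt (x\<^sup>2)" by (intro real_sqrt_le_mono) simp
  then show False using assms by simp
qed


section \<open>The space of square-summable functions\<close>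

typedef 'a ell2 = "{x :: 'a \<Rightarrow> complex. (\<lambda>i. (cmod (x i))\<^sup>2) summable_on UNIV}"
  morphisms ell2_apply Abs_ell2
  by (rule exI[of _ "\<lambda>_. 0"]) simp

setup_lifting type_definition_ell2

lemma sq_summable_iff:
  "(\<lambda>i. (cmod (x i))\<^sup>2) summable_on UNIV \<longleftrightarrow> sq_integrable (count_space UNIV) x"
proof -
  have "(\<lambda>i. (cmod (x i))\<^sup>2) summable_on UNIV \<longleftrightarrow>
      Infinite_Set_Sum.abs_summable_on (\<lambda>i. (cmod (x i))\<^sup>2) UNIV"
    by (subst summable_on_iff_abs_summable_on_real) (rule abs_summable_equivalent)
  then show ?thesis
    unfolding sq_integrable_def Infinite_Set_Sum.abs_summable_on_def by simp
qed

lemma infsum_eq_integral: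
  assumes "integrable (count_space UNIV) (f :: 'a \<Rightarrow> 'b::{banach,second_countable_topology})"
  shows "infsum f UNIV = integral\<^sup>L (count_space UNIV) f"
  using infsetsum_infsum[of f UNIV] assms
  unfolding Infinite_Set_Sum.abs_summable_on_def infsetsum_def by simp

instantiation ell2 :: (type) real_vector
begin

lift_definition zero_ell2 :: "'a ell2" is "\<lambda>_. 0" by simp

lift_definition plus_ell2 :: "'a ell2 \<Rightarrow> 'a ell2 \<Rightarrow> 'a ell2" is "\<lambda>x y i. x i + y i"
  unfolding sq_summable_iff by (rule sq_integrable_add)

lift_definition minus_ell2 :: "'a ell2 \<Rightarrow> 'a ell2 \<Rightarrow> 'a ell2" is "\<lambda>x y i. x i - y i"
  unfolding sq_summable_iff by (rule sq_integrable_diff)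

lift_definition uminus_ell2 :: "'a ell2 \<Rightarrow> 'a ell2" is "\<lambda>x i. - x i" by simp

lift_definition scaleR_ell2 :: "real \<Rightarrow> 'a ell2 \<Rightarrow> 'a ell2" is "\<lambda>r x i. complex_of_real r * x i"
  unfolding sq_summable_iff by (rule sq_integrable_cmult)

instance
  by standard (transfer; simp add: algebra_simps)+

end

lemma ell2_sq_integrable: "sq_integrable (count_space UNIV) (ell2_apply x)"
  using ell2_apply[of x] by (simp add: sq_summable_iff)

lemma ell2_infsum_integral:
  "(\<Sum>\<^sub>\<infinity>i. cnj (ell2_apply x i) * ell2_apply y i) =
    (LINT i|count_space UNIV. cnj (ell2_apply x i) * ell2_apply y i)"
  by (rule infsum_eq_integral, rule integrable_cnj_mult) (rule ell2_sq_integrable)+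

instantiation ell2 :: (type) real_inner
begin

definition inner_ell2 :: "'a ell2 \<Rightarrow> 'a ell2 \<Rightarrow> real" where
  "inner_ell2 x y = Re (\<Sum>\<^sub>\<infinity>i. cnj (ell2_apply x i) * ell2_apply y i)"

definition norm_ell2 :: "'a ell2 \<Rightarrow> real" where
  "norm_ell2 x = sqrt (inner x x)"

definition dist_ell2 :: "'a ell2 \<Rightarrow> 'a ell2 \<Rightarrow> real" where
  "dist_ell2 x y = norm (x - y)"

definition sgn_ell2 :: "'a ell2 \<Rightarrow> 'a ell2" where
  "sgn_ell2 x = scaleR (inverse (norm x)) x"

definition uniformity_ell2 :: "('a ell2 \<times> 'a ell2) filter" where
  "uniformity_ell2 = (INF e\<in>{0<..}. principal {(x, y). dist x y < e})"

definition open_ell2 :: "'a ell2 set \<Rightarrow> bool" where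
  "open_ell2 S \<longleftrightarrow> (\<forall>x\<in>S. \<forall>\<^sub>F (x', y) in uniformity. x' = x \<longrightarrow> y \<in> S)"

lemma inner_ell2_self:
  "inner x x = (LINT i|count_space UNIV. (cmod (ell2_apply x i))\<^sup>2)" for x :: "'a ell2"
  unfolding inner_ell2_def ell2_infsum_integral by (rule Re_integral_cnj_mult_self)

instance
proof
  fix x y z :: "'a ell2" and a :: real
  show "inner x y = inner y x"
    unfolding inner_ell2_def ell2_infsum_integral
    by (subst integral_cnj_mult_commute) (rule cnj.sel(1))
  show "inner (x + y) z = inner x z + inner y z"
    unfolding inner_ell2_def ell2_infsum_integral unfolding plus_ell2.rep_eq
    by (subst integral_cnj_mult_add) (rule ell2_sq_integrable plus_complex.sel(1))+
  show "inner (a *\<^sub>R x) y = a * inner x y"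
    unfolding inner_ell2_def ell2_infsum_integral unfolding scaleR_ell2.rep_eq
    by (simp only: integral_cnj_mult_scale complex_cnj_complex_of_real Re_complex_of_real_mult)
  show "0 \<le> inner x x" unfolding inner_ell2_self by simp
  show "inner x x = 0 \<longleftrightarrow> x = 0"
  proof
    assume "inner x x = 0"
    moreover have "integrable (count_space UNIV) (\<lambda>i. (cmod (ell2_apply x i))\<^sup>2)"
      using ell2_sq_integrable[of x] unfolding sq_integrable_def by blast
    ultimately have "AE i in count_space UNIV. (cmod (ell2_apply x i))\<^sup>2 = 0"
      unfolding inner_ell2_self by (subst (asm) integral_nonneg_eq_0_iff_AE) simp_all
    then have "ell2_apply x i = 0" for i
      unfolding AE_count_space by simp
    then have "ell2_apply x = ell2_apply 0"
      unfolding zero_ell2.rep_eq by (intro ext)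
    then show "x = 0" by (simp only: ell2_apply_inject)
  next
    assume "x = 0"
    then show "inner x x = 0" unfolding inner_ell2_self by (simp add: zero_ell2.rep_eq)
  qed
  show "norm x = sqrt (inner x x)" by (rule norm_ell2_def)
  show "dist x y = norm (x - y)" by (rule dist_ell2_def)
  show "sgn x = x /\<^sub>R norm x" by (rule sgn_ell2_def)
  show "uniformity = (INF e\<in>{0<..}. principal {(x, y :: 'a ell2). dist x y < e})"
    by (rule uniformity_ell2_def)
  show "open S \<longleftrightarrow> (\<forall>x\<in>S. \<forall>\<^sub>F (x', y) in uniformity. x' = x \<longrightarrow> y \<in> S)"
    for S :: "'a ell2 set" by (rule open_ell2_def)
qed

end

instance ell2 :: (type) banach
proof
  fix X :: "nat \<Rightarrow> 'a ell2"
  assume "Cauchy X"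
  have dist: "(dist u v)\<^sup>2 =
      (LINT i|count_space UNIV. (cmod (ell2_apply u i - ell2_apply v i))\<^sup>2)" for u v :: "'a ell2"
    unfolding dist_norm power2_norm_eq_inner inner_ell2_self by (simp only: minus_ell2.rep_eq)
  have "\<exists>g. sq_integrable (count_space UNIV) g \<and>
      (\<lambda>n. LINT i|count_space UNIV. (cmod (ell2_apply (X n) i - g i))\<^sup>2) \<longlonglongrightarrow> 0"
  proof (rule sq_integrable_complete[OF ell2_sq_integrable])
    fix e :: real assume "e > 0"
    then obtain N where N: "\<forall>m\<ge>N. \<forall>n\<ge>N. dist (X m) (X n) < sqrt e"
      using \<open>Cauchy X\<close> unfolding Cauchy_def by (meson real_sqrt_gt_zero)
    show "\<exists>N. \<forall>m\<ge>N. \<forall>n\<ge>N.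
        (LINT i|count_space UNIV. (cmod (ell2_apply (X m) i - ell2_apply (X n) i))\<^sup>2) < e"
    proof (intro exI[of _ N] allI impI)
      fix m n assume "m \<ge> N" "n \<ge> N"
      then have "dist (X m) (X n) < sqrt e" using N by blast
      from square_less_if_less_sqrt[OF this zero_le_dist]
      show "(LINT i|count_space UNIV. (cmod (ell2_apply (X m) i - ell2_apply (X n) i))\<^sup>2) < e"
        unfolding dist .
    qed
  qed
  then obtain g where g: "sq_integrable (count_space UNIV) g"
    "(\<lambda>n. LINT i|count_space UNIV. (cmod (ell2_apply (X n) i - g i))\<^sup>2) \<longlonglongrightarrow> 0" by blast
  have ap: "ell2_apply (Abs_ell2 g) = g"
    by (rule Abs_ell2_inverse) (use g(1) in \<open>simp only: mem_Collect_eq sq_summable_iff\<close>)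
  have "(\<lambda>n. (dist (X n) (Abs_ell2 g))\<^sup>2) \<longlonglongrightarrow> 0"
    unfolding dist ap by (rule g(2))
  then have "(\<lambda>n. sqrt ((dist (X n) (Abs_ell2 g))\<^sup>2)) \<longlonglongrightarrow> sqrt 0"
    by (rule tendsto_real_sqrt)
  then have "X \<longlonglongrightarrow> Abs_ell2 g"
    by (subst tendsto_dist_iff) (simp only: real_sqrt_abs abs_of_nonneg[OF zero_le_dist] real_sqrt_zero)
  then show "convergent X" by (rule convergentI)
qed

instantiation ell2 :: (type) complex_hilbert
begin

lift_definition scaleC_ell2 :: "complex \<Rightarrow> 'a ell2 \<Rightarrow> 'a ell2" is "\<lambda>c x i. c * x i"
  unfolding sq_summable_iff by (rule sq_integrable_cmult)

definition cinner_ell2 :: "'a ell2 \<Rightarrow> 'a ell2 \<Rightarrow> complex" where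
  "cinner_ell2 x y = (\<Sum>\<^sub>\<infinity>i. cnj (ell2_apply x i) * ell2_apply y i)"

instance
proof
  fix x y z :: "'a ell2" and r :: real and c d :: complex
  show "c *\<^sub>C (x + y) = c *\<^sub>C x + c *\<^sub>C y" by transfer (simp add: algebra_simps)
  show "(c + d) *\<^sub>C x = c *\<^sub>C x + d *\<^sub>C x" by transfer (simp add: algebra_simps)
  show "c *\<^sub>C (d *\<^sub>C x) = (c * d) *\<^sub>C x" by transfer (simp add: algebra_simps)
  show "r *\<^sub>R x = complex_of_real r *\<^sub>C x" by transfer simp
  show "cinner x y = cnj (cinner y x)"
    unfolding cinner_ell2_def ell2_infsum_integral by (rule integral_cnj_mult_commute)
  show "cinner (x + y) z = cinner x z + cinner y z"
    unfolding cinner_ell2_def ell2_infsum_integral unfolding plus_ell2.rep_eq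
    by (rule integral_cnj_mult_add) (rule ell2_sq_integrable)+
  show "cinner (c *\<^sub>C x) y = cnj c * cinner x y"
    unfolding cinner_ell2_def ell2_infsum_integral unfolding scaleC_ell2.rep_eq
    by (rule integral_cnj_mult_scale)
  show "inner x y = Re (cinner x y)"
    unfolding inner_ell2_def cinner_ell2_def ..
qed

end

section \<open>The free operator\<close>

lift_definition free_op_fun :: "int ell2 \<Rightarrow> int ell2" is
  "\<lambda>x n. 2 * x n - x (n + 1) - x (n - 1)"
proof -
  fix x :: "int \<Rightarrow> complex"
  assume "(\<lambda>n. (cmod (x n))\<^sup>2) summable_on UNIV"
  then have x: "sq_integrable (count_space UNIV) x" by (simp add: sq_summable_iff)
  have shift: "sq_integrable (count_space UNIV) (\<lambda>n. x (n + k))" for k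
  proof -
    have "bij (\<lambda>n::int. n + k)" by (rule bij_plus_right)
    from summable_on_reindex_bij_betw[OF this, of "\<lambda>n. (cmod (x n))\<^sup>2"] x show ?thesis
      by (simp flip: sq_summable_iff)
  qed
  from sq_integrable_diff[OF sq_integrable_diff[OF sq_integrable_cmult[OF x, of 2] shift[of 1]]
      shift[of "-1"]]
  show "(\<lambda>n. (cmod (2 * x n - x (n + 1) - x (n - 1)))\<^sup>2) summable_on UNIV"
    by (simp add: sq_summable_iff)
qed

lift_definition shift_ell2 :: "int \<Rightarrow> int ell2 \<Rightarrow> int ell2" is "\<lambda>k x n. x (n + k)"
proof -
  fix x :: "int \<Rightarrow> complex" and k
  assume x: "(\<lambda>n. (cmod (x n))\<^sup>2) summable_on UNIV"
  have "bij (\<lambda>n::int. n + k)" by (rule bij_plus_right)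
  from summable_on_reindex_bij_betw[OF this, of "\<lambda>n. (cmod (x n))\<^sup>2"] x
  show "(\<lambda>n. (cmod (x (n + k)))\<^sup>2) summable_on UNIV" by simp
qed

lemma norm_shift_ell2: "norm (shift_ell2 k x) = norm x"
proof -
  have "bij (\<lambda>n::int. n + k)" by (rule bij_plus_right)
  from infsum_reindex_bij_betw[OF this, of "\<lambda>n. cnj (ell2_apply x n) * ell2_apply x n"]
  have "cinner (shift_ell2 k x) (shift_ell2 k x) = cinner x x"
    by (simp add: cinner_ell2_def shift_ell2.rep_eq)
  then show ?thesis by (simp add: norm_eq_sqrt_inner inner_eq_Re_cinner)
qed

lemma free_op_fun_shift: "free_op_fun x = 2 *\<^sub>R x - shift_ell2 1 x - shift_ell2 (-1) x"
  by transfer simp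

lift_definition free_op :: "int ell2 \<Rightarrow>\<^sub>L int ell2" is free_op_fun
proof (rule bounded_linear_intro[where K = 4])
  fix r :: real and x y :: "int ell2"
  show "free_op_fun (x + y) = free_op_fun x + free_op_fun y"
    by transfer (simp add: algebra_simps)
  show "free_op_fun (r *\<^sub>R x) = r *\<^sub>R free_op_fun x"
    by transfer (simp add: algebra_simps)
  have "norm (free_op_fun x) \<le> norm (2 *\<^sub>R x - shift_ell2 1 x) + norm (shift_ell2 (-1) x)"
    unfolding free_op_fun_shift by (rule norm_triangle_ineq4)
  also have "norm (2 *\<^sub>R x - shift_ell2 1 x) \<le> norm (2 *\<^sub>R x) + norm (shift_ell2 1 x)"
    by (rule norm_triangle_ineq4)
  finally show "norm (free_op_fun x) \<le> norm x * 4"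
    by (simp add: norm_shift_ell2)
qed


section \<open>The space \<open>L\<^sup>2\<close> of the circle\<close>

text \<open>Functions on the circle of length \<open>2\<pi>\<close> are represented by functions on the reals, of which only
  the values on the period interval \<open>[0, 2\<pi>]\<close> matter; its measure is not normalized.\<close>

definition circle_measure :: "real measure" where
  "circle_measure = restrict_space lborel {0..2 * pi}"

definition L2_rel :: "(real \<Rightarrow> complex) \<Rightarrow> (real \<Rightarrow> complex) \<Rightarrow> bool" where
  "L2_rel f g \<longleftrightarrow> sq_integrable circle_measure f \<and> sq_integrable circle_measure g \<and>
     (AE \<alpha> in circle_measure. f \<alpha> = g \<alpha>)"

lemma L2_rel_refl_iff: "L2_rel f f \<longleftrightarrow> sq_integrable circle_measure f"
  by (simp add: L2_rel_def)

lemma sq_integrable_zero: "sq_integrable M (\<lambda>_. 0)"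
  by (simp add: sq_integrable_def)

quotient_type L2_circle = "real \<Rightarrow> complex" / partial: L2_rel
  morphisms L2_rep L2_class
proof (rule part_equivpI)
  show "\<exists>f. L2_rel f f"
    by (rule exI[of _ "\<lambda>_. 0"]) (simp add: L2_rel_refl_iff sq_integrable_zero)
  show "symp L2_rel"
    by (rule sympI) (auto simp: L2_rel_def elim: AE_mp)
  show "transp L2_rel"
    by (rule transpI) (auto simp: L2_rel_def elim: AE_mp)
qed

lemma L2_class_eq_iff:
  assumes "sq_integrable circle_measure f" "sq_integrable circle_measure g"
  shows "L2_class f = L2_class g \<longleftrightarrow> (AE \<alpha> in circle_measure. f \<alpha> = g \<alpha>)"
  using Quotient_rel[OF Quotient_L2_circle, of f g] assms
  by (auto simp: L2_rel_refl_iff) (auto simp: L2_rel_def)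

lemma L2_circle_cases: "\<exists>f. sq_integrable circle_measure f \<and> u = L2_class f"
  by (metis L2_rel_refl_iff Quotient_L2_circle Quotient_abs_rep Quotient_rep_reflp)

lemma sq_integrable_uminus: "sq_integrable M f \<Longrightarrow> sq_integrable M (\<lambda>x. - f x)"
  by (simp add: sq_integrable_def)

instantiation L2_circle :: real_vector
begin

lift_definition zero_L2_circle :: L2_circle is "\<lambda>_. 0"
  by (simp add: L2_rel_refl_iff sq_integrable_zero)

lift_definition plus_L2_circle :: "L2_circle \<Rightarrow> L2_circle \<Rightarrow> L2_circle" is
  "\<lambda>f g \<alpha>. f \<alpha> + g \<alpha>"
  unfolding L2_rel_def by (auto intro: sq_integrable_add elim: AE_mp)

lift_definition minus_L2_circle :: "L2_circle \<Rightarrow> L2_circle \<Rightarrow> L2_circle" is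
  "\<lambda>f g \<alpha>. f \<alpha> - g \<alpha>"
  unfolding L2_rel_def by (auto intro: sq_integrable_diff elim: AE_mp)

lift_definition uminus_L2_circle :: "L2_circle \<Rightarrow> L2_circle" is "\<lambda>f \<alpha>. - f \<alpha>"
  unfolding L2_rel_def by (auto intro: sq_integrable_uminus elim: AE_mp)

lift_definition scaleR_L2_circle :: "real \<Rightarrow> L2_circle \<Rightarrow> L2_circle" is
  "\<lambda>r f \<alpha>. complex_of_real r * f \<alpha>"
  unfolding L2_rel_def by (auto intro: sq_integrable_cmult elim: AE_mp)

lemma L2_class_plus:
  "sq_integrable circle_measure f \<Longrightarrow> sq_integrable circle_measure g \<Longrightarrow>
    L2_class f + L2_class g = L2_class (\<lambda>\<alpha>. f \<alpha> + g \<alpha>)"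
  by (simp add: plus_L2_circle.abs_eq L2_rel_refl_iff)

lemma L2_class_minus:
  "sq_integrable circle_measure f \<Longrightarrow> sq_integrable circle_measure g \<Longrightarrow>
    L2_class f - L2_class g = L2_class (\<lambda>\<alpha>. f \<alpha> - g \<alpha>)"
  by (simp add: minus_L2_circle.abs_eq L2_rel_refl_iff)

lemma L2_class_uminus:
  "sq_integrable circle_measure f \<Longrightarrow> - L2_class f = L2_class (\<lambda>\<alpha>. - f \<alpha>)"
  by (simp add: uminus_L2_circle.abs_eq L2_rel_refl_iff)

lemma L2_class_scaleR:
  "sq_integrable circle_measure f \<Longrightarrow>
    r *\<^sub>R L2_class f = L2_class (\<lambda>\<alpha>. complex_of_real r * f \<alpha>)"
  by (simp add: scaleR_L2_circle.abs_eq L2_rel_refl_iff)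

instance
proof
  fix x y z :: L2_circle and a b :: real
  obtain f where f: "sq_integrable circle_measure f" "x = L2_class f"
    using L2_circle_cases by blast
  obtain g where g: "sq_integrable circle_measure g" "y = L2_class g"
    using L2_circle_cases by blast
  obtain h where h: "sq_integrable circle_measure h" "z = L2_class h"
    using L2_circle_cases by blast
  note ops = L2_class_plus L2_class_minus L2_class_uminus L2_class_scaleR
    f(1) g(1) h(1) sq_integrable_add sq_integrable_diff sq_integrable_cmult
    sq_integrable_uminus sq_integrable_zero
  note reps = f(2) g(2) h(2) zero_L2_circle_def
  show "x + y + z = x + (y + z)" unfolding reps by (simp add: ops add.assoc)
  show "x + y = y + x" unfolding reps by (simp add: ops add.commute)
  show "0 + x = x" unfolding reps by (simp add: ops)
  show "- x + x = 0" unfolding reps by (simp add: ops)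
  show "x - y = x + - y" unfolding reps by (simp add: ops)
  show "a *\<^sub>R (x + y) = a *\<^sub>R x + a *\<^sub>R y" unfolding reps by (simp add: ops distrib_left)
  show "(a + b) *\<^sub>R x = a *\<^sub>R x + b *\<^sub>R x" unfolding reps by (simp add: ops distrib_right)
  show "a *\<^sub>R b *\<^sub>R x = (a * b) *\<^sub>R x" unfolding reps by (simp add: ops mult.assoc)
  show "1 *\<^sub>R x = x" unfolding reps by (simp add: ops)
qed

end

lift_definition L2_circle_cinner :: "L2_circle \<Rightarrow> L2_circle \<Rightarrow> complex" is
  "\<lambda>f g. LINT \<alpha>|circle_measure. cnj (f \<alpha>) * g \<alpha>"
  unfolding L2_rel_def
proof (elim conjE)
  fix f f' g g' :: "real \<Rightarrow> complex"
  assume sq: "sq_integrable circle_measure f" "sq_integrable circle_measure g"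
      "sq_integrable circle_measure f'" "sq_integrable circle_measure g'"
    and eq: "AE \<alpha> in circle_measure. f \<alpha> = f' \<alpha>" "AE \<alpha> in circle_measure. g \<alpha> = g' \<alpha>"
  show "(LINT \<alpha>|circle_measure. cnj (f \<alpha>) * g \<alpha>) = (LINT \<alpha>|circle_measure. cnj (f' \<alpha>) * g' \<alpha>)"
  proof (rule integral_cong_AE)
    show "(\<lambda>\<alpha>. cnj (f \<alpha>) * g \<alpha>) \<in> borel_measurable circle_measure"
      by (intro borel_measurable_integrable integrable_cnj_mult sq)
    show "(\<lambda>\<alpha>. cnj (f' \<alpha>) * g' \<alpha>) \<in> borel_measurable circle_measure"
      by (intro borel_measurable_integrable integrable_cnj_mult sq)
    show "AE \<alpha> in circle_measure. cnj (f \<alpha>) * g \<alpha> = cnj (f' \<alpha>) * g' \<alpha>"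
      using eq by eventually_elim simp
  qed
qed

lemma L2_class_cinner:
  "sq_integrable circle_measure f \<Longrightarrow> sq_integrable circle_measure g \<Longrightarrow>
    L2_circle_cinner (L2_class f) (L2_class g) = (LINT \<alpha>|circle_measure. cnj (f \<alpha>) * g \<alpha>)"
  by (simp add: L2_circle_cinner.abs_eq L2_rel_refl_iff)

lemma L2_circle_cinner_commute: "L2_circle_cinner u v = cnj (L2_circle_cinner v u)"
  by transfer (rule integral_cnj_mult_commute)

lemma L2_circle_cinner_add:
  "L2_circle_cinner (u + v) w = L2_circle_cinner u w + L2_circle_cinner v w"
  by transfer (rule integral_cnj_mult_add; simp add: L2_rel_refl_iff)

lemma L2_circle_cinner_scaleR:
  "L2_circle_cinner (r *\<^sub>R u) v = complex_of_real r * L2_circle_cinner u v"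
  by transfer (simp only: integral_cnj_mult_scale complex_cnj_complex_of_real)

instantiation L2_circle :: real_inner
begin

definition inner_L2_circle :: "L2_circle \<Rightarrow> L2_circle \<Rightarrow> real" where
  "inner_L2_circle f g = Re (L2_circle_cinner f g)"

definition norm_L2_circle :: "L2_circle \<Rightarrow> real" where
  "norm_L2_circle f = sqrt (inner f f)"

definition dist_L2_circle :: "L2_circle \<Rightarrow> L2_circle \<Rightarrow> real" where
  "dist_L2_circle f g = norm (f - g)"

definition sgn_L2_circle :: "L2_circle \<Rightarrow> L2_circle" where
  "sgn_L2_circle f = scaleR (inverse (norm f)) f"

definition uniformity_L2_circle :: "(L2_circle \<times> L2_circle) filter" where
  "uniformity_L2_circle = (INF e\<in>{0<..}. principal {(x, y). dist x y < e})"

definition open_L2_circle :: "L2_circle set \<Rightarrow> bool" where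
  "open_L2_circle S \<longleftrightarrow> (\<forall>x\<in>S. \<forall>\<^sub>F (x', y) in uniformity. x' = x \<longrightarrow> y \<in> S)"

lemma inner_L2_class:
  assumes "sq_integrable circle_measure f"
  shows "inner (L2_class f) (L2_class f) = (LINT \<alpha>|circle_measure. (cmod (f \<alpha>))\<^sup>2)"
  unfolding inner_L2_circle_def L2_class_cinner[OF assms assms] by (rule Re_integral_cnj_mult_self)

instance
proof
  fix x y z :: L2_circle and a :: real
  obtain f where f: "sq_integrable circle_measure f" "x = L2_class f"
    using L2_circle_cases by blast
  show "inner x y = inner y x"
    unfolding inner_L2_circle_def by (subst L2_circle_cinner_commute) (rule cnj.sel(1))
  show "inner (x + y) z = inner x z + inner y z"
    unfolding inner_L2_circle_def by (simp add: L2_circle_cinner_add)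
  show "inner (a *\<^sub>R x) y = a * inner x y"
    unfolding inner_L2_circle_def by (simp add: L2_circle_cinner_scaleR)
  show "0 \<le> inner x x" unfolding f(2) inner_L2_class[OF f(1)] by simp
  have "inner x x = 0 \<longleftrightarrow> (AE \<alpha> in circle_measure. (cmod (f \<alpha>))\<^sup>2 = 0)"
    unfolding f(2) inner_L2_class[OF f(1)] using f(1)
    by (intro integral_nonneg_eq_0_iff_AE) (auto simp: sq_integrable_def)
  also have "\<dots> \<longleftrightarrow> x = 0"
    unfolding f(2) zero_L2_circle_def L2_class_eq_iff[OF f(1) sq_integrable_zero] by simp
  finally show "inner x x = 0 \<longleftrightarrow> x = 0" .
  show "norm x = sqrt (inner x x)" by (rule norm_L2_circle_def)
  show "dist x y = norm (x - y)" by (rule dist_L2_circle_def)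
  show "sgn x = x /\<^sub>R norm x" by (rule sgn_L2_circle_def)
  show "uniformity = (INF e\<in>{0<..}. principal {(x, y :: L2_circle). dist x y < e})"
    by (rule uniformity_L2_circle_def)
  show "open S \<longleftrightarrow> (\<forall>x\<in>S. \<forall>\<^sub>F (x', y) in uniformity. x' = x \<longrightarrow> y \<in> S)"
    for S :: "L2_circle set" by (rule open_L2_circle_def)
qed

end

instance L2_circle :: banach
proof
  fix X :: "nat \<Rightarrow> L2_circle"
  assume "Cauchy X"
  have "\<exists>f. \<forall>n. sq_integrable circle_measure (f n) \<and> X n = L2_class (f n)"
    by (rule choice) (use L2_circle_cases in blast)
  then obtain f where f: "\<And>n. sq_integrable circle_measure (f n)" "\<And>n. X n = L2_class (f n)"
    by blast
  have dist: "(dist (L2_class u) (L2_class v))\<^sup>2 =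
      (LINT \<alpha>|circle_measure. (cmod (u \<alpha> - v \<alpha>))\<^sup>2)"
    if "sq_integrable circle_measure u" "sq_integrable circle_measure v" for u v
    unfolding dist_norm L2_class_minus[OF that]
    by (simp only: norm_eq_sqrt_inner[where 'a = L2_circle] real_sqrt_pow2 inner_ge_zero)
      (rule inner_L2_class[OF sq_integrable_diff[OF that]])
  have "\<exists>g. sq_integrable circle_measure g \<and>
      (\<lambda>n. LINT \<alpha>|circle_measure. (cmod (f n \<alpha> - g \<alpha>))\<^sup>2) \<longlonglongrightarrow> 0"
  proof (rule sq_integrable_complete[OF f(1)])
    fix e :: real assume "e > 0"
    then obtain N where N: "\<forall>m\<ge>N. \<forall>n\<ge>N. dist (X m) (X n) < sqrt e"
      using \<open>Cauchy X\<close> unfolding Cauchy_def by (meson real_sqrt_gt_zero)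
    show "\<exists>N. \<forall>m\<ge>N. \<forall>n\<ge>N. (LINT \<alpha>|circle_measure. (cmod (f m \<alpha> - f n \<alpha>))\<^sup>2) < e"
    proof (intro exI[of _ N] allI impI)
      fix m n assume "m \<ge> N" "n \<ge> N"
      then have "dist (L2_class (f m)) (L2_class (f n)) < sqrt e" using N f(2) by metis
      from square_less_if_less_sqrt[OF this zero_le_dist]
      show "(LINT \<alpha>|circle_measure. (cmod (f m \<alpha> - f n \<alpha>))\<^sup>2) < e"
        unfolding dist[OF f(1) f(1)] .
    qed
  qed
  then obtain g where g: "sq_integrable circle_measure g"
    "(\<lambda>n. LINT \<alpha>|circle_measure. (cmod (f n \<alpha> - g \<alpha>))\<^sup>2) \<longlonglongrightarrow> 0" by blast
  then have "(\<lambda>n. (dist (X n) (L2_class g))\<^sup>2) \<longlonglongrightarrow> 0"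
    unfolding f(2) dist[OF f(1) g(1)] by simp
  then have "(\<lambda>n. sqrt ((dist (X n) (L2_class g))\<^sup>2)) \<longlonglongrightarrow> sqrt 0"
    by (rule tendsto_real_sqrt)
  then have "X \<longlonglongrightarrow> L2_class g"
    by (subst tendsto_dist_iff) (simp only: real_sqrt_abs abs_of_nonneg[OF zero_le_dist] real_sqrt_zero)
  then show "convergent X" by (rule convergentI)
qed

instantiation L2_circle :: complex_hilbert
begin

lift_definition scaleC_L2_circle :: "complex \<Rightarrow> L2_circle \<Rightarrow> L2_circle" is
  "\<lambda>c f \<alpha>. c * f \<alpha>"
  unfolding L2_rel_def by (auto intro: sq_integrable_cmult elim: AE_mp)

definition cinner_L2_circle :: "L2_circle \<Rightarrow> L2_circle \<Rightarrow> complex" where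
  "cinner_L2_circle = L2_circle_cinner"

lemma L2_class_scaleC:
  "sq_integrable circle_measure f \<Longrightarrow> c *\<^sub>C L2_class f = L2_class (\<lambda>\<alpha>. c * f \<alpha>)"
  by (simp add: scaleC_L2_circle.abs_eq L2_rel_refl_iff)

instance
proof
  fix x y z :: L2_circle and r :: real and c d :: complex
  obtain f where f: "sq_integrable circle_measure f" "x = L2_class f"
    using L2_circle_cases by blast
  obtain g where g: "sq_integrable circle_measure g" "y = L2_class g"
    using L2_circle_cases by blast
  note ops = L2_class_plus L2_class_scaleR L2_class_scaleC
    f(1) g(1) sq_integrable_add sq_integrable_cmult
  note reps = f(2) g(2)
  show "c *\<^sub>C (x + y) = c *\<^sub>C x + c *\<^sub>C y" unfolding reps by (simp add: ops distrib_left)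
  show "(c + d) *\<^sub>C x = c *\<^sub>C x + d *\<^sub>C x" unfolding reps by (simp add: ops distrib_right)
  show "c *\<^sub>C (d *\<^sub>C x) = (c * d) *\<^sub>C x" unfolding reps by (simp add: ops mult.assoc)
  show "r *\<^sub>R x = complex_of_real r *\<^sub>C x" unfolding reps by (simp add: ops)
  show "cinner x y = cnj (cinner y x)"
    unfolding cinner_L2_circle_def by (rule L2_circle_cinner_commute)
  show "cinner (x + y) z = cinner x z + cinner y z"
    unfolding cinner_L2_circle_def by (rule L2_circle_cinner_add)
  show "cinner (c *\<^sub>C x) y = cnj c * cinner x y"
    unfolding cinner_L2_circle_def by transfer (rule integral_cnj_mult_scale)
  show "inner x y = Re (cinner x y)"
    unfolding inner_L2_circle_def cinner_L2_circle_def ..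
qed

end


section \<open>The conjugate operator\<close>

text \<open>The Fourier series converges unconditionally in the norm of \<open>L\<^sup>2\<close> and is summed there.\<close>

definition fourier :: "int ell2 \<Rightarrow> L2_circle" where
  "fourier x = (\<Sum>\<^sub>\<infinity>n. ell2_apply x n *\<^sub>C
     L2_class (\<lambda>\<alpha>. exp (- \<i> * of_int n * complex_of_real \<alpha>) / sqrt (2 * pi)))"

abbreviation ddx :: "(real \<Rightarrow> complex) \<Rightarrow> real \<Rightarrow> complex" where
  "ddx f \<equiv> (\<lambda>\<alpha>. vector_derivative f (at \<alpha>))"

definition smooth_circle_functions :: "(real \<Rightarrow> complex) set" where
  "smooth_circle_functions =
     {f. (\<forall>\<alpha>. f (\<alpha> + 2 * pi) = f \<alpha>) \<and> (\<forall>k \<alpha>. (ddx ^^ k) f differentiable (at \<alpha>))}"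

definition A0_hat_core :: "(L2_circle \<times> L2_circle) set" where
  "A0_hat_core =
     {(L2_class f,
       L2_class (\<lambda>\<alpha>. sin \<alpha> * (- \<i> * ddx f \<alpha>) + (- \<i>) * ddx (\<lambda>\<beta>. sin \<beta> * f \<beta>) \<alpha>)) | f.
      f \<in> smooth_circle_functions}"

text \<open>The core is essentially selfadjoint, so it has exactly one selfadjoint extension.\<close>

definition A0_hat :: "(L2_circle \<times> L2_circle) set" where
  "A0_hat = (THE A. selfadjoint A \<and> A0_hat_core \<subseteq> A)"

text \<open>The graph of \<open>F\<^sup>-\<^sup>1 A F\<close>, for \<open>F\<close> the Fourier transform and \<open>A\<close> the preceding operator.\<close>

definition A0 :: "(int ell2 \<times> int ell2) set" where
  "A0 = {(x, y). (fourier x, fourier y) \<in> A0_hat}"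

end

theory Submission
  imports Defs "Jordan_Normal_Form.Determinant"
begin

text \<open>
  Fourier transformation turns \<open>i A0\<close> into the operator \<open>2 sin \<alpha> d/d\<alpha> + cos \<alpha>\<close>, which generates a flow
  on the circle that fixes \<open>0\<close> and \<open>\<pi>\<close>. The free operator is multiplication by \<open>2 - 2 cos \<alpha>\<close>, and the flow
  moves \<open>cos \<alpha>\<close> by the Moebius transformation \<open>c \<mapsto> (c - \<tau>) / (1 - \<tau> c)\<close> with \<open>\<tau> = tanh 2t\<close>. This
  formula makes sense for all complex \<open>\<tau>\<close> in the unit disc. For non-real \<open>\<tau>\<close> it bends the spectrum
  \<open>[0, 4]\<close> of the free operator into an arc that leaves the real axis everywhere except at the end
  points \<open>0\<close> and \<open>4\<close>, the values at the two fixed points of the flow.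

  The hypothesis on \<open>V\<close> says that \<open>V\<close> can be deformed in the same way, for small \<open>\<tau>\<close>, and its deformation
  remains compact because the compact operators form a closed subspace
  (\<open>op_hol_in_closed_subspace\<close>). Two applications of the analytic Fredholm alternative
  (\<open>analytic_fredholm\<close>) then give the theorem. As functions of \<open>\<tau>\<close>, with the spectral parameter
  \<open>\<lambda>\<close> off the real axis fixed, the deformed operators minus \<open>\<lambda>\<close> are all singular if they are so for
  real \<open>\<tau>\<close>, where the deformation is a unitary conjugation (\<open>singular_persists\<close>): eigenvalues do not
  move. As functions of \<open>\<lambda>\<close>, with a non-real \<open>\<tau>\<close> fixed, the singular points are isolated away from the
  arc, in particular near every point of the open interval \<open>(0, 4)\<close> (\<open>not_limit_inside\<close>). Eigenvalues
  from the upper half plane are treated with \<open>\<tau>\<close> in the upper half plane, those from the lower half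
  plane with \<open>\<tau>\<close> in the lower one. Real points of \<open>(0, 4)\<close> are not isolated in the spectrum since all of
  \<open>[0, 4]\<close> survives compact perturbations (\<open>not_regular_cos_op_compact\<close>), and limit points outside
  \<open>[0, 4]\<close> are excluded by the Fredholm alternative without deformation (\<open>not_limit_outside\<close>).

  The remaining work is to identify the unitary group of \<open>A0\<close>. In Fourier coefficients \<open>A0\<close> is a Jacobi
  matrix with weights of linear growth on its maximal domain. It is selfadjoint by Carleman's
  criterion (\<open>jacobi_symmetric\<close>), it is the only selfadjoint extension of the given core
  (\<open>A0_hat_eq\<close>), and it generates a unique unitary group by Stone's theorem (\<open>stone\<close>). The commutator
  \<open>[i A0, C] = - 2 (1 - C\<^sup>2)\<close>, for \<open>C\<close> multiplication by \<open>cos \<alpha>\<close>, is an identity between matrix entries,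
  and integrating the resulting Riccati equation gives the Moebius formula (\<open>orbit_cos_op\<close>).
\<close>

section \<open>The Banach algebra of bounded operators\<close>

lemma norm_cinner_le: "cmod (cinner x y) \<le> norm x * norm (y::'a::complex_hilbert)"
proof (cases "cinner x y = 0")
  case False
  \<comment> \<open>this phase rotates the inner product onto the positive axis\<close>
  define c where "c = cnj (cinner x y) / cmod (cinner x y)"
  have c: "cmod c = 1" using False by (simp add: c_def norm_divide)
  have "c * cinner x y = complex_of_real (cmod (cinner x y))"
    using False complex_norm_square[of "cinner x y"]
    by (simp add: c_def field_simps power2_eq_square)
  then have "cmod (cinner x y) = inner x (c *\<^sub>C y)"
    by (simp add: inner_eq_Re_cinner cinner_scaleC_right)
  also have "\<dots> \<le> norm x * norm (c *\<^sub>C y)" by (rule norm_cauchy_schwarz)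
  finally show ?thesis by (simp add: norm_scaleC c)
qed simp

lemma cinner_add_right: "cinner x (y + z) = cinner x y + cinner x (z::'a::complex_hilbert)"
  by (metis cinner_commute cinner_add_left complex_cnj_add complex_cnj_cnj)

lemma cinner_scaleR_left: "cinner (r *\<^sub>R x) y = r *\<^sub>R cinner x (y::'a::complex_hilbert)"
  by (simp add: scaleR_scaleC cinner_scaleC_left scaleR_conv_of_real)

lemma cinner_scaleR_right: "cinner x (r *\<^sub>R y) = r *\<^sub>R cinner x (y::'a::complex_hilbert)"
  by (simp add: scaleR_scaleC cinner_scaleC_right scaleR_conv_of_real)

lemma bounded_bilinear_cinner: "bounded_bilinear (cinner :: 'a \<Rightarrow> 'a \<Rightarrow> complex)"
  for dummy :: "'a::complex_hilbert"
  by unfold_locales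
    (auto simp: cinner_add_left cinner_add_right cinner_scaleR_left cinner_scaleR_right
      intro!: exI[of _ 1] norm_cinner_le)

interpretation cinner: bounded_bilinear "cinner :: 'a::complex_hilbert \<Rightarrow> 'a \<Rightarrow> complex"
  by (rule bounded_bilinear_cinner)

lemma cinner_eq_inner: "cinner x y = Complex (inner x y) (- inner x (\<i> *\<^sub>C y))"
  for x :: "'a::complex_hilbert"
  by (simp add: complex_eq_iff inner_eq_Re_cinner cinner_scaleC_right)

lemma cinner_ext: "(\<And>z. cinner z x = cinner z y) \<Longrightarrow> x = (y::'a::complex_hilbert)"
  by (metis inner_eq_Re_cinner inner_eq_zero_iff inner_diff_right diff_self eq_iff_diff_eq_0)

lemma bounded_linear_scaleC: "bounded_linear (\<lambda>x::'a::complex_hilbert. c *\<^sub>C x)"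
  using scalar_op.rep_eq[of c] blinfun.bounded_linear_right by metis

lemma scaleC_minus_right: "c *\<^sub>C (x - y) = c *\<^sub>C x - c *\<^sub>C (y::'a::complex_hilbert)"
  by (rule linear_diff) (use bounded_linear_scaleC in \<open>auto dest: bounded_linear.linear\<close>)

lemma scaleC_uminus_right: "c *\<^sub>C (- x) = - (c *\<^sub>C (x::'a::complex_hilbert))"
  by (rule linear_neg) (use bounded_linear_scaleC in \<open>auto dest: bounded_linear.linear\<close>)

lemma scaleC_zero_right [simp]: "c *\<^sub>C 0 = (0::'a::complex_hilbert)"
  by (rule linear_0) (use bounded_linear_scaleC in \<open>auto dest: bounded_linear.linear\<close>)

lemma scaleC_zero_left [simp]: "0 *\<^sub>C x = (0::'a::complex_hilbert)"
  using scaleR_scaleC[of 0 x] by simp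

lemma scaleC_uminus_left: "(- c) *\<^sub>C x = - (c *\<^sub>C (x::'a::complex_hilbert))"
  by (metis add.left_inverse eq_neg_iff_add_eq_0 scaleC_add_left scaleC_zero_left)

lemma scaleC_diff_left: "(c - d) *\<^sub>C x = c *\<^sub>C x - d *\<^sub>C (x::'a::complex_hilbert)"
  using scaleC_add_left[of c "- d" x] by (simp add: scaleC_uminus_left)

lemma bounded_ops_closed:
  assumes "\<And>n. T n \<in> bounded_ops" "T \<longlonglongrightarrow> (L :: 'a::complex_hilbert \<Rightarrow>\<^sub>L 'a)"
  shows "L \<in> bounded_ops"
  unfolding bounded_ops_def
proof (intro CollectI allI)
  fix c :: complex and x :: 'a
  have l: "(\<lambda>n. blinfun_apply (T n) y) \<longlonglongrightarrow> blinfun_apply L y" for y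
    by (intro tendsto_intros assms)
  have "(\<lambda>n. c *\<^sub>C blinfun_apply (T n) x) \<longlonglongrightarrow> c *\<^sub>C blinfun_apply L x"
    by (rule bounded_linear.tendsto[OF bounded_linear_scaleC l])
  moreover have "blinfun_apply (T n) (c *\<^sub>C x) = c *\<^sub>C blinfun_apply (T n) x" for n
    using assms(1) by (auto simp: bounded_ops_def)
  ultimately show "blinfun_apply L (c *\<^sub>C x) = c *\<^sub>C blinfun_apply L x"
    using l[of "c *\<^sub>C x"] LIMSEQ_unique by fastforce
qed

text \<open>The complex-linear bounded operators form a type of their own, so that the ring laws, the
  exponential series and the differential calculus of normed algebras apply to them. The sort
  excludes the zero space, on which the identity would have norm zero.\<close>

typedef (overloaded) 'a op = "bounded_ops :: ('a::{complex_hilbert,perfect_space} \<Rightarrow>\<^sub>L 'a) set"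
  morphisms op_blinfun Op
  by (rule exI[of _ 0]) (simp add: bounded_ops_def)

setup_lifting type_definition_op

instantiation op :: ("{complex_hilbert,perfect_space}") "{real_vector, one, times}"
begin

lift_definition zero_op :: "'a op" is 0 by (simp add: bounded_ops_def)
lift_definition one_op :: "'a op" is id_blinfun by (simp add: bounded_ops_def)
lift_definition plus_op :: "'a op \<Rightarrow> 'a op \<Rightarrow> 'a op" is "(+)"
  by (simp add: bounded_ops_def plus_blinfun.rep_eq scaleC_add_right)
lift_definition minus_op :: "'a op \<Rightarrow> 'a op \<Rightarrow> 'a op" is "(-)"
  by (simp add: bounded_ops_def minus_blinfun.rep_eq scaleC_minus_right)
lift_definition uminus_op :: "'a op \<Rightarrow> 'a op" is uminus
  by (simp add: bounded_ops_def uminus_blinfun.rep_eq scaleC_uminus_right)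
lift_definition scaleR_op :: "real \<Rightarrow> 'a op \<Rightarrow> 'a op" is scaleR
  by (simp add: bounded_ops_def scaleR_blinfun.rep_eq scaleR_scaleC scaleC_scaleC mult.commute)
lift_definition times_op :: "'a op \<Rightarrow> 'a op \<Rightarrow> 'a op" is "(o\<^sub>L)"
  by (simp add: bounded_ops_def)
instance
proof
  fix S T W :: "'a op" and r q :: real
  show "S + T + W = S + (T + W)" by transfer (rule add.assoc)
  show "S + T = T + S" by transfer (rule add.commute)
  show "0 + S = S" by transfer simp
  show "- S + S = 0" by transfer simp
  show "S - T = S + - T" by transfer simp
  show "r *\<^sub>R (S + T) = r *\<^sub>R S + r *\<^sub>R T" by transfer (rule scaleR_add_right)
  show "(r + q) *\<^sub>R S = r *\<^sub>R S + q *\<^sub>R S" by transfer (rule scaleR_add_left)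
  show "r *\<^sub>R q *\<^sub>R S = (r * q) *\<^sub>R S" by transfer simp
  show "1 *\<^sub>R S = S" by transfer simp
qed

end

instantiation op :: ("{complex_hilbert,perfect_space}") real_normed_algebra_1
begin

lift_definition norm_op :: "'a op \<Rightarrow> real" is norm .

definition dist_op :: "'a op \<Rightarrow> 'a op \<Rightarrow> real" where "dist_op S T = norm (S - T)"
definition sgn_op :: "'a op \<Rightarrow> 'a op" where "sgn_op T = inverse (norm T) *\<^sub>R T"
definition uniformity_op :: "('a op \<times> 'a op) filter" where
  "uniformity_op = (INF e\<in>{0<..}. principal {(x, y). dist x y < e})"
definition open_op :: "'a op set \<Rightarrow> bool" where
  "open_op S \<longleftrightarrow> (\<forall>x\<in>S. \<forall>\<^sub>F (x', y) in uniformity. x' = x \<longrightarrow> y \<in> S)"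

instance
proof
  fix S T W :: "'a op" and r q :: real
  show "S * T * W = S * (T * W)" by transfer (rule blinfun_eqI, simp)
  show "1 * S = S" "S * 1 = S" by (transfer, rule blinfun_eqI, simp)+
  show "(S + T) * W = S * W + T * W"
    by transfer (rule blinfun_eqI, simp add: plus_blinfun.rep_eq)
  show "S * (T + W) = S * T + S * W"
    by transfer (rule blinfun_eqI, simp add: plus_blinfun.rep_eq blinfun.add_right)
  show "r *\<^sub>R S * T = r *\<^sub>R (S * T)"
    by transfer (rule blinfun_eqI, simp add: scaleR_blinfun.rep_eq)
  show "S * r *\<^sub>R T = r *\<^sub>R (S * T)"
    by transfer (rule blinfun_eqI, simp add: scaleR_blinfun.rep_eq blinfun.scaleR_right)
  show norm_0: "norm S = 0 \<longleftrightarrow> S = 0" for S :: "'a op" by transfer simp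
  show "norm (S + T) \<le> norm S + norm T" by transfer (rule norm_triangle_ineq)
  show "norm (r *\<^sub>R S) = \<bar>r\<bar> * norm S" by transfer simp
  show "norm (S * T) \<le> norm S * norm T" by transfer (rule norm_blinfun_compose)
  show "norm (1 :: 'a op) = 1" by transfer (rule norm_blinfun_id)
  then show "(0 :: 'a op) \<noteq> 1" using norm_0[of 0] by (metis zero_neq_one)
  show "dist S T = norm (S - T)" by (rule dist_op_def)
  show "sgn S = S /\<^sub>R norm S" by (rule sgn_op_def)
  show "uniformity = (INF e\<in>{0<..}. principal {(x, y :: 'a op). dist x y < e})"
    by (rule uniformity_op_def)
  show "open U \<longleftrightarrow> (\<forall>x\<in>U. \<forall>\<^sub>F (x', y) in uniformity. x' = x \<longrightarrow> y \<in> U)" for U :: "'a op set"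
    by (rule open_op_def)
qed

end

lemma dist_op_blinfun: "dist (op_blinfun S) (op_blinfun T) = dist S T"
  unfolding dist_norm by transfer simp

instance op :: ("{complex_hilbert,perfect_space}") banach
proof
  fix X :: "nat \<Rightarrow> 'a op"
  assume "Cauchy X"
  then have "Cauchy (\<lambda>n. op_blinfun (X n))" by (simp add: Cauchy_def dist_op_blinfun)
  then obtain L where L: "(\<lambda>n. op_blinfun (X n)) \<longlonglongrightarrow> L"
    using Cauchy_convergent convergent_def by blast
  have "L \<in> bounded_ops" by (rule bounded_ops_closed[OF op_blinfun L])
  then obtain T where "L = op_blinfun T" using Op_inverse[of L] by metis
  with L have "(\<lambda>n. dist (op_blinfun (X n)) (op_blinfun T)) \<longlonglongrightarrow> 0"
    by (simp add: tendsto_dist_iff[symmetric])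
  then have "X \<longlonglongrightarrow> T" by (simp add: dist_op_blinfun tendsto_dist_iff[symmetric])
  then show "convergent X" by (rule convergentI)
qed

text \<open>Application \<open>ap\<close> of an operator and the embedding \<open>sc\<close> of the scalars as multiples of the
  identity; since \<open>sc\<close> is a central ring homomorphism, complex multiples of operators are ring
  products.\<close>

lift_definition ap :: "'a::{complex_hilbert,perfect_space} op \<Rightarrow> 'a \<Rightarrow> 'a" is blinfun_apply .
lift_definition sc :: "complex \<Rightarrow> 'a::{complex_hilbert,perfect_space} op" is scalar_op
  by (simp add: bounded_ops_def scalar_op.rep_eq scaleC_scaleC mult.commute)

lemma op_eqI: "(\<And>x. ap S x = ap T x) \<Longrightarrow> S = T"
  by transfer (rule blinfun_eqI)

lemma norm_ap: "norm (ap T x) \<le> norm T * norm x"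
  by transfer (rule norm_blinfun)

lemma norm_op_bound: "0 \<le> b \<Longrightarrow> (\<And>x. norm (ap T x) \<le> b * norm x) \<Longrightarrow> norm T \<le> b"
  by transfer (rule norm_blinfun_bound)

lemma bounded_bilinear_ap:
  "bounded_bilinear (ap :: 'a::{complex_hilbert,perfect_space} op \<Rightarrow> _)"
proof
  fix S T :: "'a op" and x y :: 'a and r :: real
  show "ap (S + T) x = ap S x + ap T x" by transfer (simp add: plus_blinfun.rep_eq)
  show "ap T (x + y) = ap T x + ap T y" by transfer (rule blinfun.add_right)
  show "ap (r *\<^sub>R T) x = r *\<^sub>R ap T x" by transfer (simp add: scaleR_blinfun.rep_eq)
  show "ap T (r *\<^sub>R x) = r *\<^sub>R ap T x" by transfer (rule blinfun.scaleR_right)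
  show "\<exists>K. \<forall>(T :: 'a op) x. norm (ap T x) \<le> norm T * norm x * K"
    by (rule exI[of _ 1]) (simp add: norm_ap)
qed

interpretation ap: bounded_bilinear "ap :: 'a::{complex_hilbert,perfect_space} op \<Rightarrow> 'a \<Rightarrow> 'a"
  by (rule bounded_bilinear_ap)

lemma ap_mult [simp]: "ap (S * T) x = ap S (ap T x)"
  by transfer simp

lemma ap_one [simp]: "ap 1 x = x"
  by transfer simp

lemma ap_scaleC: "ap T (c *\<^sub>C x) = c *\<^sub>C ap T x"
  by transfer (simp add: bounded_ops_def)

lemma ap_sc [simp]: "ap (sc c) x = c *\<^sub>C x"
  by transfer (simp add: scalar_op.rep_eq)

lemma sc_add: "sc (c + d) = sc c + sc d"
  by (rule op_eqI) (simp add: ap.add_left scaleC_add_left)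

lemma sc_mult: "sc (c * d) = sc c * sc d"
  by (rule op_eqI) (simp add: scaleC_scaleC)

lemma sc_of_real: "sc (complex_of_real r) = r *\<^sub>R 1"
  by (rule op_eqI) (simp add: scaleR_scaleC ap.scaleR_left)

lemma sc_0 [simp]: "sc 0 = 0" and sc_1 [simp]: "sc 1 = 1"
  using sc_of_real[of 0] sc_of_real[of 1] by simp_all

lemma sc_uminus: "sc (- c) = - sc c"
  by (rule op_eqI) (simp add: ap.minus_left scaleC_uminus_left)

lemma sc_diff: "sc (c - d) = sc c - sc d"
  by (rule op_eqI) (simp add: ap.diff_left scaleC_diff_left)

lemma sc_commute: "T * sc c = sc c * T"
  by (rule op_eqI) (simp add: ap_scaleC)

lemma sc_left_commute: "S * (sc c * T) = sc c * (S * T)"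
  by (simp only: mult.assoc[symmetric] sc_commute)

lemma norm_sc_mult: "norm (sc c * T) = cmod c * norm T"
proof -
  have le: "norm (sc c * T) \<le> cmod c * norm T" for c and T :: "'a op"
  proof (rule norm_op_bound)
    fix x
    have "norm (ap (sc c * T) x) = cmod c * norm (ap T x)" by (simp add: norm_scaleC)
    also have "\<dots> \<le> cmod c * (norm T * norm x)" by (intro mult_left_mono norm_ap) simp
    finally show "norm (ap (sc c * T) x) \<le> cmod c * norm T * norm x" by (simp add: mult.assoc)
  qed simp
  show ?thesis
  proof (cases "c = 0")
    case False
    have "T = sc (inverse c) * (sc c * T)"
      using False by (simp add: sc_mult[symmetric] mult.assoc[symmetric])
    then have "norm T \<le> cmod (inverse c) * norm (sc c * T)" using le by metis
    then have "cmod c * norm T \<le> cmod c * (cmod (inverse c) * norm (sc c * T))"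
      by (rule mult_left_mono) simp
    also have "\<dots> = norm (sc c * T)" using False by (simp add: norm_inverse)
    finally show ?thesis using le[of c T] by linarith
  qed simp
qed

lemma norm_sc [simp]: "norm (sc c) = cmod c"
  using norm_sc_mult[of c 1] by simp

lemma bounded_linear_sc: "bounded_linear sc"
  by (rule bounded_linear_intro[of _ 1])
    (simp_all add: sc_add sc_mult sc_of_real scaleR_conv_of_real)


definition mk_op :: "('a::{complex_hilbert,perfect_space} \<Rightarrow> 'a) \<Rightarrow> 'a op" where
  "mk_op f = Op (Blinfun f)"

lemma ap_mk_op:
  assumes "\<And>x y. f (x + y) = f x + f y" "\<And>c x. f (c *\<^sub>C x) = c *\<^sub>C f x"
    and "\<And>x. norm (f x) \<le> K * norm x"
  shows "ap (mk_op f) = f"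
proof -
  have "bounded_linear f"
    by (rule bounded_linear_intro[of _ K])
      (use assms in \<open>auto simp: scaleR_scaleC mult.commute\<close>)
  then have b: "blinfun_apply (Blinfun f) = f" by (rule bounded_linear_Blinfun_apply)
  then have "Blinfun f \<in> bounded_ops" by (simp add: bounded_ops_def assms)
  then show ?thesis unfolding ap.rep_eq mk_op_def by (simp add: Op_inverse b)
qed

subsection \<open>Invertible operators\<close>

definition regular :: "'a::{complex_hilbert,perfect_space} op \<Rightarrow> bool" where
  "regular T \<longleftrightarrow> (\<exists>R. R * T = 1 \<and> T * R = 1)"

definition op_inv :: "'a::{complex_hilbert,perfect_space} op \<Rightarrow> 'a op" where
  "op_inv T = (SOME R. R * T = 1 \<and> T * R = 1)"

lemma op_inv: "regular T \<Longrightarrow> op_inv T * T = 1" "regular T \<Longrightarrow> T * op_inv T = 1"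
  unfolding regular_def op_inv_def by (metis (mono_tags, lifting) someI_ex)+

lemma regularI: "R * T = 1 \<Longrightarrow> T * R = 1 \<Longrightarrow> regular T"
  unfolding regular_def by blast

lemma regular_mult: "regular S \<Longrightarrow> regular T \<Longrightarrow> regular (S * T)"
proof (rule regularI[of "op_inv T * op_inv S"])
  assume S: "regular S" and T: "regular T"
  have "op_inv T * op_inv S * (S * T) = op_inv T * (op_inv S * S) * T" by (simp only: mult.assoc)
  then show "op_inv T * op_inv S * (S * T) = 1" by (simp add: op_inv S T)
  have "S * T * (op_inv T * op_inv S) = S * (T * op_inv T) * op_inv S" by (simp only: mult.assoc)
  then show "S * T * (op_inv T * op_inv S) = 1" by (simp add: op_inv S T)
qed

lemma regular_op_inv: "regular T \<Longrightarrow> regular (op_inv T)"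
  by (rule regularI[of T]) (simp_all add: op_inv)

lemma regular_mult_left_iff:
  assumes "regular S"
  shows "regular (S * T) \<longleftrightarrow> regular T"
proof
  assume "regular (S * T)"
  then have "regular (op_inv S * (S * T))" using assms regular_mult regular_op_inv by blast
  then show "regular T" by (simp add: mult.assoc[symmetric] op_inv assms)
qed (rule regular_mult[OF assms])

lemma regular_mult_right_iff:
  assumes "regular S"
  shows "regular (T * S) \<longleftrightarrow> regular T"
proof
  assume "regular (T * S)"
  then have "regular (T * S * op_inv S)" using assms regular_mult regular_op_inv by blast
  then show "regular T" by (simp add: mult.assoc op_inv assms)
qed (rule regular_mult[OF _ assms])

lemma regular_sc: "c \<noteq> 0 \<Longrightarrow> regular (sc c)"
  by (rule regularI[of "sc (inverse c)"]) (simp_all add: sc_mult[symmetric])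

lemma not_regular_if_kernel: "ap T x = 0 \<Longrightarrow> x \<noteq> 0 \<Longrightarrow> \<not> regular T"
  by (metis ap.zero_right ap_mult ap_one op_inv(1))

lemma regular_one_minus:
  assumes "norm T < 1"
  shows "regular (1 - T)"
proof -
  have sm: "summable (\<lambda>n. T ^ n)" by (rule complete_algebra_summable_geometric[OF assms])
  define R where "R = (\<Sum>n. T ^ n)"
  have split: "R = (\<Sum>n. T ^ Suc n) + 1" unfolding R_def using suminf_split_initial_segment[OF sm, of 1] by simp
  have "(\<Sum>n. T ^ Suc n) = T * R" unfolding R_def power_Suc by (rule suminf_mult[OF sm])
  moreover have "(\<Sum>n. T ^ Suc n) = R * T" unfolding R_def power_Suc2 by (rule suminf_mult2[symmetric, OF sm])
  ultimately have "T * R = R - 1" "R * T = R - 1" using split by (auto simp: algebra_simps)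
  then show ?thesis by (intro regularI[of R]) (simp_all add: algebra_simps)
qed

lemma regular_one_plus: "norm T < 1 \<Longrightarrow> regular (1 + T)"
  using regular_one_minus[of "- T"] by simp

lemma regular_near:
  assumes "regular T" "norm (S - T) * norm (op_inv T) < 1"
  shows "regular S"
proof -
  have "norm (op_inv T * (S - T)) < 1"
    using norm_mult_ineq[of "op_inv T" "S - T"] assms(2) by (simp add: mult.commute)
  then have "regular (T * (1 + op_inv T * (S - T)))"
    using assms(1) regular_one_plus regular_mult by blast
  moreover have "T * (1 + op_inv T * (S - T)) = T + (T * op_inv T) * (S - T)"
    by (simp only: distrib_left mult.assoc mult_1_right)
  ultimately show ?thesis using assms(1) by (simp add: op_inv)
qed

text \<open>The remainder of the first-order expansion
  \<open>S\<inverse> = T\<inverse> - T\<inverse> (S - T) T\<inverse> + \<dots>\<close> is exactly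
  \<open>S\<inverse> (S - T) T\<inverse> (S - T) T\<inverse>\<close>, and \<open>S\<inverse>\<close> is bounded by \<open>2 \<parallel>T\<inverse>\<parallel>\<close> for \<open>S\<close> near \<open>T\<close>.\<close>

lemma has_derivative_op_inv:
  fixes T :: "'a::{complex_hilbert,perfect_space} op"
  assumes T: "regular T"
  shows "(op_inv has_derivative (\<lambda>H. - (op_inv T * H * op_inv T))) (at T)"
proof -
  let ?I = "op_inv T"
  \<comment> \<open>within this distance the Neumann perturbation is at most one half\<close>
  define e where "e = 1 / (2 * (norm ?I + 1))"
  have e: "e > 0" by (simp add: e_def add_nonneg_pos)
  have est: "norm (op_inv S - ?I - - (?I * (S - T) * ?I)) / norm (S - T)
      \<le> 2 * norm ?I ^ 3 * norm (S - T)"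
    if S: "S \<noteq> T" "dist S T < e" for S
  proof -
    let ?d = "norm (S - T)"
    have d: "?d * norm ?I \<le> 1/2"
    proof -
      have "?d * norm ?I \<le> e * (norm ?I + 1)"
        using S e by (intro mult_mono) (auto simp: dist_norm)
      also have "\<dots> = 1/2"
        unfolding e_def using norm_ge_zero[of ?I] by (simp add: field_simps add_nonneg_eq_0_iff)
      finally show ?thesis .
    qed
    have S': "regular S" by (rule regular_near[OF T]) (use d in linarith)
    have split: "op_inv S = ?I - op_inv S * (S - T) * ?I"
    proof -
      have "op_inv S * (S - T) * ?I = op_inv S * S * ?I - op_inv S * (T * ?I)"
        by (simp add: algebra_simps)
      then show ?thesis by (simp add: op_inv T S')
    qed
    have "norm (op_inv S) \<le> norm ?I + norm (op_inv S * (S - T) * ?I)"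
      by (subst split) (rule norm_triangle_ineq4)
    also have "norm (op_inv S * (S - T) * ?I) \<le> norm (op_inv S) * ?d * norm ?I"
      by (meson mult_right_mono norm_ge_zero norm_mult_ineq order_trans)
    also have "norm (op_inv S) * ?d * norm ?I \<le> norm (op_inv S) * (1/2)"
      unfolding mult.assoc by (intro mult_left_mono d) simp
    finally have nS: "norm (op_inv S) \<le> 2 * norm ?I" by simp
    have "op_inv S - ?I - - (?I * (S - T) * ?I) = (?I - op_inv S) * (S - T) * ?I"
      by (subst (1) split) (simp add: algebra_simps)
    also have "?I - op_inv S = op_inv S * (S - T) * ?I"
      using split by (metis add_diff_cancel_left' diff_add_cancel)
    finally have "norm (op_inv S - ?I - - (?I * (S - T) * ?I)) =
        norm (op_inv S * (S - T) * ?I * (S - T) * ?I)" by simp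
    also have "\<dots> \<le> norm (op_inv S) * ?d * norm ?I * ?d * norm ?I"
      by (meson mult_right_mono norm_ge_zero norm_mult_ineq order_trans)
    also have "\<dots> = norm (op_inv S) * (?d * norm ?I * ?d * norm ?I)" by (simp add: mult_ac)
    also have "\<dots> \<le> 2 * norm ?I * (?d * norm ?I * ?d * norm ?I)"
      by (rule mult_right_mono[OF nS]) simp
    also have "\<dots> = (2 * norm ?I ^ 3 * ?d) * ?d" by (simp add: power3_eq_cube mult_ac)
    finally show ?thesis using S(1) by (simp add: divide_le_eq)
  qed
  show ?thesis
  proof (rule has_derivativeI_sandwich[OF e, where H = "\<lambda>S. 2 * norm ?I ^ 3 * norm (S - T)"])
    show "bounded_linear (\<lambda>H. - (?I * H * ?I))"
      by (intro bounded_linear_minus bounded_linear_compose[OF bounded_linear_mult_left]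
          bounded_linear_mult_right)
    have "((\<lambda>S. 2 * norm ?I ^ 3 * norm (S - T)) \<longlongrightarrow> 2 * norm ?I ^ 3 * norm (T - T)) (at T)"
      by (intro tendsto_intros)
    then show "((\<lambda>S. 2 * norm ?I ^ 3 * norm (S - T)) \<longlongrightarrow> 0) (at T)" by simp
  qed (use est in blast)
qed


subsection \<open>Holomorphic families of operators\<close>

definition op_hol_at :: "(complex \<Rightarrow> 'a::{complex_hilbert,perfect_space} op) \<Rightarrow> complex \<Rightarrow> bool" where
  "op_hol_at F z \<longleftrightarrow> (\<exists>D. (F has_derivative (\<lambda>h. sc h * D)) (at z))"

lemma op_hol_at_const: "op_hol_at (\<lambda>_. T) z"
  unfolding op_hol_at_def by (rule exI[of _ 0]) simp

lemma op_hol_at_sc: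
  assumes "f field_differentiable (at z)"
  shows "op_hol_at (\<lambda>w. sc (f w)) z"
proof -
  obtain f' where "(f has_derivative (*) f') (at z)"
    using assms by (auto simp: field_differentiable_def has_field_derivative_def)
  from bounded_linear.has_derivative[OF bounded_linear_sc this]
  have "((\<lambda>w. sc (f w)) has_derivative (\<lambda>h. sc h * sc f')) (at z)"
    by (simp add: sc_mult[symmetric] mult.commute)
  then show ?thesis unfolding op_hol_at_def by blast
qed

lemma op_hol_at_add:
  assumes "op_hol_at F z" "op_hol_at G z"
  shows "op_hol_at (\<lambda>w. F w + G w) z"
proof -
  obtain D E where "(F has_derivative (\<lambda>h. sc h * D)) (at z)" "(G has_derivative (\<lambda>h. sc h * E)) (at z)"
    using assms unfolding op_hol_at_def by blast
  from has_derivative_add[OF this]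
  have "((\<lambda>w. F w + G w) has_derivative (\<lambda>h. sc h * (D + E))) (at z)"
    by (simp add: distrib_left)
  then show ?thesis unfolding op_hol_at_def by blast
qed

lemma op_hol_at_mult:
  assumes "op_hol_at F z" "op_hol_at G z"
  shows "op_hol_at (\<lambda>w. F w * G w) z"
proof -
  obtain D E where "(F has_derivative (\<lambda>h. sc h * D)) (at z)" "(G has_derivative (\<lambda>h. sc h * E)) (at z)"
    using assms unfolding op_hol_at_def by blast
  from has_derivative_mult[OF this]
  have "((\<lambda>w. F w * G w) has_derivative (\<lambda>h. sc h * (F z * E + D * G z))) (at z)"
    by (rule has_derivative_eq_rhs) (simp add: fun_eq_iff distrib_left mult.assoc sc_left_commute)
  then show ?thesis unfolding op_hol_at_def by blast
qed

lemma op_hol_at_diff: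
  assumes "op_hol_at F z" "op_hol_at G z"
  shows "op_hol_at (\<lambda>w. F w - G w) z"
  using op_hol_at_add[OF assms(1) op_hol_at_mult[OF op_hol_at_const[of "-1"] assms(2)]] by simp

lemma op_hol_at_op_inv:
  assumes "op_hol_at F z" "regular (F z)"
  shows "op_hol_at (\<lambda>w. op_inv (F w)) z"
proof -
  obtain D where "(F has_derivative (\<lambda>h. sc h * D)) (at z)"
    using assms unfolding op_hol_at_def by blast
  from has_derivative_compose[OF this has_derivative_op_inv[OF assms(2)]]
  have "((\<lambda>w. op_inv (F w)) has_derivative (\<lambda>h. sc h * - (op_inv (F z) * D * op_inv (F z)))) (at z)"
    by (rule has_derivative_eq_rhs) (simp add: fun_eq_iff mult.assoc sc_left_commute)
  then show ?thesis unfolding op_hol_at_def by blast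
qed

lemma op_hol_at_compose:
  assumes "f field_differentiable (at z)" "op_hol_at F (f z)"
  shows "op_hol_at (\<lambda>w. F (f w)) z"
proof -
  obtain f' where f: "(f has_derivative (*) f') (at z)"
    using assms by (auto simp: field_differentiable_def has_field_derivative_def)
  obtain D where "(F has_derivative (\<lambda>h. sc h * D)) (at (f z))"
    using assms unfolding op_hol_at_def by blast
  from has_derivative_compose[OF f this]
  have "((\<lambda>w. F (f w)) has_derivative (\<lambda>h. sc h * (sc f' * D))) (at z)"
    by (rule has_derivative_eq_rhs) (simp only: fun_eq_iff mult.assoc[symmetric] sc_mult[symmetric] mult.commute[of f'], simp)
  then show ?thesis unfolding op_hol_at_def by blast
qed

lemma op_hol_at_isCont: "op_hol_at F z \<Longrightarrow> isCont F z"
  unfolding op_hol_at_def using has_derivative_continuous by blast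

text \<open>Statements about operator families are reduced to classical function theory through their
  matrix entries.\<close>

lemma op_hol_at_entry:
  assumes "op_hol_at F z"
  shows "(\<lambda>w. cinner y (ap (F w) x)) field_differentiable (at z)"
proof -
  obtain D where "(F has_derivative (\<lambda>h. sc h * D)) (at z)"
    using assms unfolding op_hol_at_def by blast
  from bounded_linear.has_derivative[OF cinner.bounded_linear_right
      bounded_linear.has_derivative[OF ap.bounded_linear_left this]]
  have "((\<lambda>w. cinner y (ap (F w) x)) has_derivative (*) (cinner y (ap D x))) (at z)"
    by (rule has_derivative_eq_rhs) (simp add: fun_eq_iff cinner_scaleC_right)
  then show ?thesis unfolding field_differentiable_def has_field_derivative_def by blast
qed

subsection \<open>Taylor expansion of a holomorphic family\<close>

text \<open>The coefficients are the Cauchy integrals over the circle of radius \<open>r\<close>, as integrals of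
  continuous operator-valued functions. Their size makes the series converge in norm, and its sum
  has the right matrix entries by the scalar Taylor theorem.\<close>

lemma op_hol_taylor:
  fixes F :: "complex \<Rightarrow> 'a::{complex_hilbert,perfect_space} op"
  assumes hol: "\<And>z. cmod z < R \<Longrightarrow> op_hol_at F z" and r: "0 < r" "r < R"
  obtains A M where "\<And>k. norm (A k) \<le> M / r ^ k"
    and "\<And>z. cmod z < r \<Longrightarrow> (\<lambda>k. sc (z ^ k) * A k) sums F z"
proof -
  define u where "u x = circlepath 0 r x" for x
  have u: "u x = r * exp (2 * of_real pi * \<i> * of_real x)" for x
    by (simp add: u_def circlepath)
  have nu: "cmod (u x) = r" for x using r by (simp add: u norm_mult)
  have u0: "u x \<noteq> 0" for x using nu[of x] r by auto
  have contu: "continuous_on {0..1} u" unfolding u by (intro continuous_intros)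
  have contF: "continuous_on (sphere 0 r) F"
    by (intro continuous_at_imp_continuous_on ballI op_hol_at_isCont hol) (use r in auto)
  have "bounded (F ` sphere 0 r)"
    by (intro compact_imp_bounded compact_continuous_image contF compact_sphere)
  then obtain M where M: "\<And>w. cmod w = r \<Longrightarrow> norm (F w) \<le> M"
    unfolding bounded_iff using dist_0_norm[where 'a=complex] by (metis imageI mem_sphere)
  have contFu: "continuous_on {0..1} (\<lambda>x. F (u x))"
    by (rule continuous_on_compose2[OF contF contu]) (auto simp: nu)
  define g where "g k x = sc (inverse (u x ^ k)) * F (u x)" for k x
  have contg: "continuous_on {0..1} (g k)" for k
    unfolding g_def
    by (intro continuous_intros contFu bounded_linear.continuous_on[OF bounded_linear_sc] contu)
      (simp add: u0)
  define A where "A k = integral {0..1} (g k)" for k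
  have nA: "norm (A k) \<le> M / r ^ k" for k
  proof -
    have "norm (integral {0..1} (g k)) \<le> (M / r ^ k) * (1 - 0)"
    proof (rule integral_bound[OF _ contg])
      fix x :: real
      have "norm (g k x) = norm (F (u x)) / r ^ k"
        unfolding g_def norm_sc_mult by (simp add: norm_inverse norm_power nu divide_inverse mult.commute)
      also have "\<dots> \<le> M / r ^ k" using r M[OF nu] by (intro divide_right_mono) auto
      finally show "norm (g k x) \<le> M / r ^ k" .
    qed simp
    then show ?thesis by (simp add: A_def)
  qed
  have sums: "(\<lambda>k. sc (z ^ k) * A k) sums F z" if z: "cmod z < r" for z
  proof -
    have bnd: "norm (sc (z ^ k) * A k) \<le> M * (cmod z / r) ^ k" for k
    proof -
      have "norm (sc (z ^ k) * A k) \<le> cmod z ^ k * (M / r ^ k)"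
        unfolding norm_sc_mult norm_power by (intro mult_left_mono nA) simp
      then show ?thesis by (simp add: power_divide field_simps)
    qed
    have "summable (\<lambda>k. M * (cmod z / r) ^ k)"
      by (intro summable_mult summable_geometric) (use z r in auto)
    then have sm: "summable (\<lambda>k. sc (z ^ k) * A k)"
      by (rule summable_comparison_test'[of _ 0]) (rule bnd)
    have "(\<Sum>k. sc (z ^ k) * A k) = F z"
    proof (rule op_eqI, rule cinner_ext)
      fix v y :: 'a
      let ?\<phi> = "\<lambda>T :: 'a op. cinner y (ap T v)"
      have bl: "bounded_linear ?\<phi>"
        by (rule bounded_linear_compose[OF cinner.bounded_linear_right ap.bounded_linear_left])
      define f where "f w = ?\<phi> (F w)" for w
      have fh: "f holomorphic_on ball 0 R"
        unfolding f_def holomorphic_on_def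
        by (auto intro!: field_differentiable_at_within op_hol_at_entry hol)
      have coeff: "?\<phi> (A k) = (deriv ^^ k) f 0 / fact k" for k
      proof -
        have "((\<lambda>w. f w / (w - 0) ^ Suc k) has_contour_integral
            of_real (2 * pi) * \<i> / fact k * (deriv ^^ k) f 0) (circlepath 0 r)"
        proof (rule Cauchy_has_contour_integral_higher_derivative_circlepath)
          show "continuous_on (cball 0 r) f" "f holomorphic_on ball 0 r"
            using fh r by (auto intro!: holomorphic_on_imp_continuous_on
                intro: holomorphic_on_subset)
          show "0 \<in> ball 0 r" using r by simp
        qed
        then have "((\<lambda>x. f (u x) / u x ^ Suc k * (2 * of_real pi * \<i> * u x)) has_integral
            of_real (2 * pi) * \<i> / fact k * (deriv ^^ k) f 0) {0..1}"
          unfolding has_contour_integral_def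
          by (rule has_integral_eq[rotated])
            (auto simp: vector_derivative_circlepath01 u_def[symmetric] u)
        from has_integral_mult_right[OF this, of "1 / (2 * of_real pi * \<i>)"]
        have "((\<lambda>x. f (u x) / u x ^ k) has_integral (deriv ^^ k) f 0 / fact k) {0..1}"
          by (rule has_integral_eq_rhs[OF has_integral_eq[rotated]]) (auto simp: u0 field_simps)
        moreover have "((\<lambda>x. ?\<phi> (g k x)) has_integral ?\<phi> (A k)) {0..1}"
          using has_integral_linear[OF integrable_integral[OF integrable_continuous_real[OF contg]] bl]
          by (simp add: A_def o_def)
        then have "((\<lambda>x. f (u x) / u x ^ k) has_integral ?\<phi> (A k)) {0..1}"
          by (rule has_integral_eq[rotated])
            (simp add: g_def f_def cinner_scaleC_right divide_inverse mult.commute)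
        ultimately show ?thesis using has_integral_unique by blast
      qed
      have "(\<lambda>k. (deriv ^^ k) f 0 / fact k * (z - 0) ^ k) sums f z"
        by (rule holomorphic_power_series[OF fh]) (use z r in auto)
      moreover have "(\<lambda>k. ?\<phi> (sc (z ^ k) * A k)) sums ?\<phi> (\<Sum>k. sc (z ^ k) * A k)"
        by (rule bounded_linear.sums[OF bl summable_sums[OF sm]])
      then have "(\<lambda>k. (deriv ^^ k) f 0 / fact k * (z - 0) ^ k) sums ?\<phi> (\<Sum>k. sc (z ^ k) * A k)"
        by (simp add: cinner_scaleC_right coeff mult.commute)
      ultimately show "?\<phi> (\<Sum>k. sc (z ^ k) * A k) = ?\<phi> (F z)"
        unfolding f_def using sums_unique2 by blast
    qed
    with summable_sums[OF sm] show ?thesis by simp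
  qed
  show ?thesis by (rule that[OF nA sums])
qed

text \<open>The Taylor coefficients at the origin can be recovered from the values at real points alone,
  as limits of divided remainders.\<close>

lemma op_hol_in_closed_subspace:
  fixes F :: "complex \<Rightarrow> 'a::{complex_hilbert,perfect_space} op"
  assumes hol: "\<And>z. cmod z < R \<Longrightarrow> op_hol_at F z"
    and K: "closed K" "0 \<in> K" "\<And>S T. S \<in> K \<Longrightarrow> T \<in> K \<Longrightarrow> S + T \<in> K"
      "\<And>c T. T \<in> K \<Longrightarrow> sc c * T \<in> K"
    and real: "\<And>t::real. \<bar>t\<bar> < R \<Longrightarrow> F (complex_of_real t) \<in> K"
    and z: "cmod z < R"
  shows "F z \<in> K"
proof -
  obtain r where r: "cmod z < r" "r < R" using dense[OF z] by blast
  then have r0: "0 < r" using norm_ge_zero[of z] by linarith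
  obtain A M where A: "\<And>k. norm (A k) \<le> M / r ^ k"
    and sums: "\<And>z. cmod z < r \<Longrightarrow> (\<lambda>k. sc (z ^ k) * A k) sums F z"
    using op_hol_taylor[OF hol r0 r(2)] by blast
  have sumK: "finite I \<Longrightarrow> (\<And>k. k \<in> I \<Longrightarrow> T k \<in> K) \<Longrightarrow> sum T I \<in> K" for I :: "nat set" and T
    by (induction rule: finite_induct) (auto intro: K)
  have "0 \<le> M" using A[of 0] norm_ge_zero[of "A 0"] by (simp del: norm_ge_zero)
  have AK: "A k \<in> K" for k
  proof (induction k rule: less_induct)
    case (less k)
    \<comment> \<open>positive points tending to the origin, at most half the radius so that the tails are geometric with ratio one half\<close>
    define t where "t n = r / (2 * real (Suc n))" for n
    have t: "0 < t n" "t n \<le> r / 2" for n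
      using r0 by (auto simp: t_def field_simps)
    define G where "G n = sc (1 / of_real (t n) ^ k) *
        (F (of_real (t n)) - (\<Sum>j<k. sc (of_real (t n) ^ j) * A j))" for n
    have GK: "G n \<in> K" for n
    proof -
      have "(-1 :: 'a op) = sc (-1)" by (simp add: sc_uminus)
      then have "- (\<Sum>j<k. sc (of_real (t n) ^ j) * A j) \<in> K"
        using K(4)[of "\<Sum>j<k. sc (of_real (t n) ^ j) * A j" "-1"]
        by (auto intro!: sumK K less simp: sc_uminus)
      then show ?thesis
        unfolding G_def diff_conv_add_uminus using t[of n] r r0
        by (intro K real) auto
    qed
    have bnd: "norm (G n - A k) \<le> 2 * M / r ^ Suc k * t n" for n
    proof -
      let ?t = "of_real (t n) :: complex"
      have tr: "t n / r < 1" "t n < r" using t[of n] r0 by (auto simp: field_simps)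
      have "(\<lambda>j. sc (?t ^ (j + Suc k)) * A (j + Suc k)) sums
          (F ?t - (\<Sum>j<Suc k. sc (?t ^ j) * A j))"
        by (rule sums_split_initial_segment[OF sums]) (use t[of n] tr in auto)
      then have eq: "F ?t - (\<Sum>j<Suc k. sc (?t ^ j) * A j) = (\<Sum>j. sc (?t ^ (j + Suc k)) * A (j + Suc k))"
        by (rule sums_unique)
      have "norm (\<Sum>j. sc (?t ^ (j + Suc k)) * A (j + Suc k)) \<le>
          (\<Sum>j. M * (t n / r) ^ Suc k * (t n / r) ^ j)"
      proof (rule norm_suminf_le)
        fix j
        have "norm (sc (?t ^ (j + Suc k)) * A (j + Suc k)) \<le> t n ^ (j + Suc k) * (M / r ^ (j + Suc k))"
          unfolding norm_sc_mult norm_power using t[of n] by (intro mult_mono A) auto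
        then show "norm (sc (?t ^ (j + Suc k)) * A (j + Suc k)) \<le> M * (t n / r) ^ Suc k * (t n / r) ^ j"
          by (simp add: power_divide power_add field_simps)
      next
        show "summable (\<lambda>j. M * (t n / r) ^ Suc k * (t n / r) ^ j)"
          by (intro summable_mult summable_geometric) (use t[of n] r0 tr in auto)
      qed
      also have "\<dots> = M * (t n / r) ^ Suc k * (1 / (1 - t n / r))"
        using t[of n] r0 tr by (subst suminf_mult) (auto simp: suminf_geometric intro!: summable_geometric)
      also have "\<dots> \<le> M * (t n / r) ^ Suc k * 2"
        using t[of n] r0 tr \<open>0 \<le> M\<close> by (intro mult_left_mono) (auto simp: field_simps)
      finally have *: "norm (F ?t - (\<Sum>j<Suc k. sc (?t ^ j) * A j)) \<le> M * (t n / r) ^ Suc k * 2"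
        unfolding eq .
      have "G n - A k = sc (1 / ?t ^ k) * (F ?t - (\<Sum>j<Suc k. sc (?t ^ j) * A j))"
        using t[of n] by (simp add: G_def algebra_simps mult.assoc[symmetric] sc_mult[symmetric])
      then have "norm (G n - A k) = 1 / t n ^ k * norm (F ?t - (\<Sum>j<Suc k. sc (?t ^ j) * A j))"
        using t[of n] by (simp add: norm_sc_mult norm_divide norm_power)
      also have "\<dots> \<le> 1 / t n ^ k * (M * (t n / r) ^ Suc k * 2)"
        using t[of n] by (intro mult_left_mono *) auto
      also have "\<dots> = 2 * M / r ^ Suc k * t n"
        using t[of n] r0 by (simp add: power_divide field_simps)
      finally show ?thesis .
    qed
    have "t = (\<lambda>n. r / 2 * inverse (real (Suc n)))"
      by (rule ext) (simp only: t_def divide_inverse inverse_mult_distrib mult.assoc)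
    then have "t \<longlonglongrightarrow> 0"
      using tendsto_mult[OF tendsto_const[of "r / 2"] LIMSEQ_inverse_real_of_nat] by simp
    then have "(\<lambda>n. 2 * M / r ^ Suc k * t n) \<longlonglongrightarrow> 0"
      by (rule tendsto_mult_right_zero)
    then have "(\<lambda>n. norm (G n - A k)) \<longlonglongrightarrow> 0"
      by (rule tendsto_sandwich[OF _ _ tendsto_const, rotated 2]) (simp_all only: bnd norm_ge_zero eventually_True)
    then have "G \<longlonglongrightarrow> A k" by (simp add: LIM_zero_iff tendsto_norm_zero_iff)
    then show ?case using closed_sequentially[OF K(1)] GK by blast
  qed
  have "(\<lambda>n. \<Sum>k<n. sc (z ^ k) * A k) \<longlonglongrightarrow> F z"
    using sums[OF r(1)] by (simp add: sums_def)
  then show ?thesis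
    by (rule closed_sequentially[OF K(1), rotated]) (auto intro!: sumK K AK)
qed

section \<open>Coordinates in the space of square-summable functions\<close>

lift_definition delta :: "'i \<Rightarrow> 'i ell2" is "\<lambda>i j. if j = i then 1 else 0"
proof -
  fix i :: 'i
  show "(\<lambda>j. (cmod (if j = i then 1 else 0))\<^sup>2) summable_on UNIV"
    by (rule finite_nonzero_values_imp_summable_on) (rule finite_subset[of _ "{i}"], auto)
qed

lemma cinner_delta [simp]: "cinner (delta i) x = ell2_apply x i"
proof -
  have "cinner (delta i) x = (\<Sum>\<^sub>\<infinity>j. cnj (ell2_apply (delta i) j) * ell2_apply x j)"
    by (rule cinner_ell2_def)
  also have "\<dots> = (\<Sum>\<^sub>\<infinity>j\<in>{i}. cnj (ell2_apply (delta i) j) * ell2_apply x j)"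
    by (rule infsum_cong_neutral) (auto simp: delta.rep_eq)
  finally show ?thesis by (simp add: delta.rep_eq)
qed

lemma ell2_eqI: "(\<And>i. ell2_apply x i = ell2_apply y i) \<Longrightarrow> x = y"
  by (metis ell2_apply_inject ext)

lemma ell2_apply_simps [simp]:
  "ell2_apply (x + y) i = ell2_apply x i + ell2_apply y i"
  "ell2_apply (x - y) i = ell2_apply x i - ell2_apply y i"
  "ell2_apply (- x) i = - ell2_apply x i"
  "ell2_apply 0 i = 0"
  "ell2_apply (c *\<^sub>C x) i = c * ell2_apply x i"
  "ell2_apply (r *\<^sub>R x) i = of_real r * ell2_apply x i"
  by (simp_all add: plus_ell2.rep_eq minus_ell2.rep_eq uminus_ell2.rep_eq zero_ell2.rep_eq
      scaleC_ell2.rep_eq scaleR_ell2.rep_eq)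

lemma ell2_apply_sum [simp]: "ell2_apply (sum f I) i = (\<Sum>k\<in>I. ell2_apply (f k) i)"
  by (induction I rule: infinite_finite_induct) auto

lemma ell2_apply_delta [simp]: "ell2_apply (delta i) j = (if j = i then 1 else 0)"
  by (simp add: delta.rep_eq)

lemma norm_ell2_sq: "(norm x)\<^sup>2 = (\<Sum>\<^sub>\<infinity>i. (cmod (ell2_apply x i))\<^sup>2)"
  and ell2_summable: "(\<lambda>i. (cmod (ell2_apply x i))\<^sup>2) summable_on UNIV"
proof -
  show "(\<lambda>i. (cmod (ell2_apply x i))\<^sup>2) summable_on UNIV" using ell2_apply[of x] by simp
  have "integrable (count_space UNIV) (\<lambda>i. (cmod (ell2_apply x i))\<^sup>2)"
    using ell2_sq_integrable[of x] by (simp add: sq_integrable_def)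
  then show "(norm x)\<^sup>2 = (\<Sum>\<^sub>\<infinity>i. (cmod (ell2_apply x i))\<^sup>2)"
    unfolding power2_norm_eq_inner inner_ell2_self by (rule infsum_eq_integral[symmetric])
qed

lemma norm_delta [simp]: "norm (delta i) = 1"
proof -
  have "cinner (delta i) (delta i) = 1" by simp
  then show ?thesis by (simp add: norm_eq_sqrt_inner inner_eq_Re_cinner)
qed

lemma cmod_ell2_apply_le: "cmod (ell2_apply x i) \<le> norm x"
  using norm_cinner_le[of "delta i" x] by simp

instance ell2 :: (type) perfect_space
proof
  fix x :: "'a ell2"
  show "\<not> open {x}"
  proof
    assume "open {x}"
    then obtain e where e: "e > 0" "ball x e \<subseteq> {x}" using open_contains_ball by blast
    let ?y = "x + (e / 2) *\<^sub>R delta undefined"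
    have "dist x ?y = e / 2" using e by (simp add: dist_norm)
    then have "?y \<in> ball x e" using e by simp
    then have "?y = x" using e by blast
    with \<open>dist x ?y = e / 2\<close> e show False by simp
  qed
qed

lift_definition restrict_ell2 :: "'i set \<Rightarrow> 'i ell2 \<Rightarrow> 'i ell2" is
  "\<lambda>F x i. if i \<in> F then x i else 0"
proof -
  fix F :: "'i set" and x :: "'i \<Rightarrow> complex"
  assume "(\<lambda>i. (cmod (x i))\<^sup>2) summable_on UNIV"
  then show "(\<lambda>i. (cmod (if i \<in> F then x i else 0))\<^sup>2) summable_on UNIV"
    by (rule summable_on_comparison_test) auto
qed

lemma norm_restrict_le: "norm (restrict_ell2 F x) \<le> norm x"
proof (rule power2_le_imp_le)
  show "(norm (restrict_ell2 F x))\<^sup>2 \<le> (norm x)\<^sup>2"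
    unfolding norm_ell2_sq
    by (rule infsum_mono[OF ell2_summable ell2_summable]) (simp add: restrict_ell2.rep_eq)
qed simp

definition coord_proj :: "'i set \<Rightarrow> 'i ell2 op" where
  "coord_proj F = mk_op (restrict_ell2 F)"

lemma ap_coord_proj: "ap (coord_proj F) = restrict_ell2 F"
  unfolding coord_proj_def
  by (rule ap_mk_op[where K = 1])
    (auto intro!: ell2_eqI simp: restrict_ell2.rep_eq norm_restrict_le)

lemma ell2_apply_coord_proj [simp]: "ell2_apply (ap (coord_proj F) x) i = (if i \<in> F then ell2_apply x i else 0)"
  by (simp add: ap_coord_proj restrict_ell2.rep_eq)

lemma norm_one_minus_coord_proj_le: "norm (1 - coord_proj F) \<le> 1"
proof (rule norm_op_bound)
  fix x :: "'a ell2"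
  have "ap (1 - coord_proj F) x = restrict_ell2 (- F) x"
    by (rule ell2_eqI) (simp add: ap.diff_left restrict_ell2.rep_eq)
  then show "norm (ap (1 - coord_proj F) x) \<le> 1 * norm x" by (simp add: norm_restrict_le)
qed simp

text \<open>The truncations to larger and larger finite sets of coordinates tend strongly to the identity.\<close>

lemma coord_proj_tail_small:
  assumes "e > 0"
  shows "\<exists>F. finite F \<and> (\<forall>G. F \<subseteq> G \<longrightarrow> norm (x - ap (coord_proj G) x) < e)"
proof -
  let ?f = "\<lambda>i. (cmod (ell2_apply x i))\<^sup>2"
  have "(?f has_sum (norm x)\<^sup>2) UNIV"
    using has_sum_infsum[OF ell2_summable[of x]] by (simp add: norm_ell2_sq)
  then have "\<forall>\<^sub>F F in finite_subsets_at_top UNIV. dist (sum ?f F) ((norm x)\<^sup>2) < e\<^sup>2"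
    unfolding has_sum_def tendsto_iff using assms by simp
  then obtain F where F: "finite F"
      "\<forall>Y. finite Y \<and> F \<subseteq> Y \<and> Y \<subseteq> UNIV \<longrightarrow> dist (sum ?f Y) ((norm x)\<^sup>2) < e\<^sup>2"
    unfolding eventually_finite_subsets_at_top by blast
  then have F: "finite F" "dist (sum ?f F) ((norm x)\<^sup>2) < e\<^sup>2" by auto
  show ?thesis
  proof (intro exI[of _ F] conjI allI impI F(1))
    fix G assume G: "F \<subseteq> G"
    have "(norm (x - ap (coord_proj G) x))\<^sup>2 = (\<Sum>\<^sub>\<infinity>i. ?f i * (if i \<in> G then 0 else 1))"
      unfolding norm_ell2_sq by (intro infsum_cong) simp
    also have "\<dots> = infsum ?f (- G)"
      by (rule infsum_cong_neutral) auto
    also have "\<dots> \<le> infsum ?f (- F)"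
      by (rule infsum_mono2) (use G in \<open>auto intro: summable_on_subset_banach[OF ell2_summable]\<close>)
    also have "\<dots> = (norm x)\<^sup>2 - sum ?f F"
      using infsum_Diff[OF ell2_summable[of x], of F] F(1)
      by (simp add: norm_ell2_sq Compl_eq_Diff_UNIV)
    also have "\<dots> < e\<^sup>2" using F(2) by (simp add: dist_real_def)
    finally show "norm (x - ap (coord_proj G) x) < e" using assms by (simp add: power2_less_imp_less)
  qed
qed


section \<open>The analytic Fredholm alternative\<close>

text \<open>The compact operators, in the form of norm limits of their truncations to finitely many
  coordinates of the image. In this form they are visibly a closed complex subspace and a right
  ideal.\<close>

definition approximable :: "'i ell2 op \<Rightarrow> bool" where
  "approximable T \<longleftrightarrow> (\<forall>e>0. \<exists>F. finite F \<and> norm ((1 - coord_proj F) * T) < e)"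

lemma approximable_mult: 
  assumes "approximable T" shows "approximable (T * S)"
  unfolding approximable_def
proof (intro allI impI)
  fix e :: real assume e: "e > 0"
  have "e / (norm S + 1) > 0" using e by (simp add: add_nonneg_pos)
  then obtain F where F: "finite F" "norm ((1 - coord_proj F) * T) < e / (norm S + 1)"
    using assms unfolding approximable_def by blast
  have "norm ((1 - coord_proj F) * (T * S)) \<le> norm ((1 - coord_proj F) * T) * norm S"
    by (metis mult.assoc norm_mult_ineq)
  also have "\<dots> \<le> e / (norm S + 1) * norm S" using F by (intro mult_right_mono) auto
  also have "\<dots> < e / (norm S + 1) * (norm S + 1)"
    using \<open>e / (norm S + 1) > 0\<close> by (intro mult_strict_left_mono) auto
  also have "\<dots> = e" using norm_ge_zero[of S] by (simp del: norm_ge_zero add: add_nonneg_eq_0_iff)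
  finally show "\<exists>F. finite F \<and> norm ((1 - coord_proj F) * (T * S)) < e" using F by blast
qed

lemma norm_coord_proj_mono:
  assumes "F \<subseteq> G"
  shows "norm ((1 - coord_proj G) * T) \<le> norm ((1 - coord_proj F) * T)"
proof -
  have "(1 - coord_proj G) * T = (1 - coord_proj G) * ((1 - coord_proj F) * T)"
    using assms by (intro op_eqI ell2_eqI) (auto simp: ap.diff_left)
  also have "norm \<dots> \<le> norm (1 - coord_proj G) * norm ((1 - coord_proj F) * T)" by (rule norm_mult_ineq)
  also have "\<dots> \<le> 1 * norm ((1 - coord_proj F) * T)" by (intro mult_right_mono norm_one_minus_coord_proj_le) simp
  finally show ?thesis by simp
qed

lemma approximable_0: "approximable 0"
  unfolding approximable_def by (auto intro: exI[of _ "{}"])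

lemma approximable_add:
  assumes "approximable S" "approximable T" shows "approximable (S + T)"
  unfolding approximable_def
proof (intro allI impI)
  fix e :: real assume e: "e > 0"
  obtain F G where F: "finite F" "norm ((1 - coord_proj F) * S) < e / 2"
    and G: "finite G" "norm ((1 - coord_proj G) * T) < e / 2"
    using assms e unfolding approximable_def by (metis half_gt_zero)
  have "norm ((1 - coord_proj (F \<union> G)) * (S + T)) \<le>
      norm ((1 - coord_proj (F \<union> G)) * S) + norm ((1 - coord_proj (F \<union> G)) * T)"
    unfolding distrib_left by (rule norm_triangle_ineq)
  also have "\<dots> < e"
    using F G norm_coord_proj_mono[of F "F \<union> G" S] norm_coord_proj_mono[of G "F \<union> G" T] by simp
  finally show "\<exists>F. finite F \<and> norm ((1 - coord_proj F) * (S + T)) < e" using F G by blast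
qed

lemma approximable_sc: "approximable T \<Longrightarrow> approximable (sc c * T)"
  using approximable_mult[of T "sc c"] by (simp add: sc_commute)

lemma closed_approximable: "closed {T. approximable T}"
  unfolding closed_sequential_limits
proof (intro allI impI CollectI, elim conjE)
  fix X :: "nat \<Rightarrow> 'a ell2 op" and L
  assume X: "\<forall>n. X n \<in> {T. approximable T}" and lim: "X \<longlonglongrightarrow> L"
  show "approximable L"
    unfolding approximable_def
  proof (intro allI impI)
    fix e :: real assume e: "e > 0"
    then obtain n where n: "norm (X n - L) < e / 2"
      using lim unfolding LIMSEQ_iff by (meson half_gt_zero order_refl)
    have "approximable (X n)" "0 < e / 2" using X e by auto
    then obtain F where F: "finite F" "norm ((1 - coord_proj F) * X n) < e / 2"
      unfolding approximable_def by blast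
    have "(1 - coord_proj F) * L = (1 - coord_proj F) * X n - (1 - coord_proj F) * (X n - L)"
      by (simp add: algebra_simps)
    also have "norm \<dots> \<le> norm ((1 - coord_proj F) * X n) + norm ((1 - coord_proj F) * (X n - L))"
      by (rule norm_triangle_ineq4)
    also have "norm ((1 - coord_proj F) * (X n - L)) \<le> 1 * norm (X n - L)"
      using norm_mult_ineq[of "1 - coord_proj F" "X n - L"]
        mult_right_mono[OF norm_one_minus_coord_proj_le[of F], of "norm (X n - L)"] by simp
    finally have "norm ((1 - coord_proj F) * L) < e" using F n by simp
    then show "\<exists>F. finite F \<and> norm ((1 - coord_proj F) * L) < e" using F by blast
  qed
qed

text \<open>Truncation converges uniformly on the points of a finite net of the image of the unit ball,
  and it is a contraction, so it converges uniformly on the whole image.\<close>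

lemma approximable_if_compact:
  fixes T :: "'i ell2 op"
  assumes "compact (closure (ap T ` cball 0 1))"
  shows "approximable T"
  unfolding approximable_def
proof (intro allI impI)
  fix e :: real assume e: "e > 0"
  then obtain C where C: "finite C" "closure (ap T ` cball 0 1) \<subseteq> (\<Union>x\<in>C. ball x (e / 4))"
    using assms unfolding compact_eq_totally_bounded by (metis zero_less_divide_iff zero_less_numeral)
  have "\<exists>F. \<forall>x :: 'i ell2. finite (F x) \<and> (\<forall>G. F x \<subseteq> G \<longrightarrow> norm (x - ap (coord_proj G) x) < e / 4)"
    by (rule choice, rule allI, rule coord_proj_tail_small) (use e in simp)
  then obtain F where F: "\<And>x. finite (F x)"
    "\<And>(x :: 'i ell2) G. F x \<subseteq> G \<Longrightarrow> norm (x - ap (coord_proj G) x) < e / 4" by metis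
  define G where "G = (\<Union>x\<in>C. F x)"
  have "norm ((1 - coord_proj G) * T) \<le> e / 2"
  proof (rule norm_op_bound)
    fix x
    have unit: "norm (ap ((1 - coord_proj G) * T) y) \<le> e / 2" if y: "norm y \<le> 1" for y
    proof -
      have "ap T y \<in> closure (ap T ` cball 0 1)" using y closure_subset by fastforce
      then obtain c where c: "c \<in> C" "dist c (ap T y) < e / 4" using C(2) by auto
      have "ap ((1 - coord_proj G) * T) y = ap (1 - coord_proj G) (ap T y - c) + (c - ap (coord_proj G) c)"
        by (simp add: ap.diff_left ap.diff_right)
      also have "norm \<dots> \<le> norm (ap (1 - coord_proj G) (ap T y - c)) + norm (c - ap (coord_proj G) c)"
        by (rule norm_triangle_ineq)
      also have "norm (ap (1 - coord_proj G) (ap T y - c)) \<le> 1 * norm (ap T y - c)"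
        by (rule order_trans[OF norm_ap]) (intro mult_right_mono norm_one_minus_coord_proj_le norm_ge_zero)
      also have "norm (ap T y - c) < e / 4" using c(2) by (simp add: dist_norm norm_minus_commute)
      also have "norm (c - ap (coord_proj G) c) < e / 4" using c(1) by (intro F) (auto simp: G_def)
      finally show ?thesis by simp
    qed
    show "norm (ap ((1 - coord_proj G) * T) x) \<le> e / 2 * norm x"
    proof (cases "x = 0")
      case False
      have "norm (ap ((1 - coord_proj G) * T) ((1 / norm x) *\<^sub>R x)) \<le> e / 2"
        by (rule unit) (use False in simp)
      then have "(1 / norm x) * norm (ap ((1 - coord_proj G) * T) x) \<le> e / 2"
        by (simp only: ap.scaleR_right norm_scaleR) simp
      then show ?thesis using False by (simp add: field_simps)
    qed (simp add: ap.zero_right)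
  qed (use e in simp)
  then show "\<exists>F. finite F \<and> norm ((1 - coord_proj F) * T) < e"
    using e F(1) C(1) by (intro exI[of _ G]) (auto simp: G_def)
qed

definition mat_op :: "nat \<Rightarrow> (nat \<Rightarrow> 'i) \<Rightarrow> complex mat \<Rightarrow> 'i ell2 op" where
  "mat_op n h A = mk_op (\<lambda>x. \<Sum>i<n. (\<Sum>j<n. A $$ (i, j) * ell2_apply x (h j)) *\<^sub>C delta (h i))"

lemma ap_mat_op:
  "ap (mat_op n h A) x = (\<Sum>i<n. (\<Sum>j<n. A $$ (i, j) * ell2_apply x (h j)) *\<^sub>C delta (h i))"
proof -
  let ?f = "\<lambda>x. \<Sum>i<n. (\<Sum>j<n. A $$ (i, j) * ell2_apply x (h j)) *\<^sub>C delta (h i)"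
  have "ap (mat_op n h A) = ?f"
    unfolding mat_op_def
  proof (rule ap_mk_op[where K = "\<Sum>i<n. \<Sum>j<n. cmod (A $$ (i, j))"])
    show "norm (?f x) \<le> (\<Sum>i<n. \<Sum>j<n. cmod (A $$ (i, j))) * norm x" for x
      unfolding sum_distrib_right
      by (auto intro!: sum_norm_le order_trans[OF norm_sum] sum_mono mult_left_mono cmod_ell2_apply_le
          simp: norm_scaleC norm_mult)
  qed (auto intro!: ell2_eqI simp: sum.distrib algebra_simps sum_distrib_left sum_distrib_right)
  then show ?thesis by simp
qed

lemma ell2_apply_mat_op:
  assumes "inj_on h {..<n}" "i < n"
  shows "ell2_apply (ap (mat_op n h A) x) (h i) = (\<Sum>j<n. A $$ (i, j) * ell2_apply x (h j))"
proof -
  have "ell2_apply (ap (mat_op n h A) x) (h i) =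
      (\<Sum>k<n. if k = i then \<Sum>j<n. A $$ (k, j) * ell2_apply x (h j) else 0)"
    unfolding ap_mat_op ell2_apply_sum
    by (intro sum.cong refl) (use assms in \<open>auto dest: inj_onD\<close>)
  then show ?thesis using assms(2) by simp
qed

lemma mat_op_off_range: "a \<notin> h ` {..<n} \<Longrightarrow> ell2_apply (ap (mat_op n h A) x) a = 0"
  unfolding ap_mat_op ell2_apply_sum by (intro sum.neutral) auto

lemma mat_op_mult:
  assumes h: "inj_on h {..<n}" and A: "A \<in> carrier_mat n n" and B: "B \<in> carrier_mat n n"
  shows "mat_op n h A * mat_op n h B = mat_op n h (A * B)"
proof (intro op_eqI ell2_eqI)
  fix x :: "'a ell2" and a
  show "ell2_apply (ap (mat_op n h A * mat_op n h B) x) a = ell2_apply (ap (mat_op n h (A * B)) x) a"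
  proof (cases "a \<in> h ` {..<n}")
    case True
    then obtain i where i: "i < n" "a = h i" by auto
    have "(\<Sum>j<n. A $$ (i, j) * (\<Sum>k<n. B $$ (j, k) * ell2_apply x (h k))) =
        (\<Sum>k<n. \<Sum>j<n. A $$ (i, j) * B $$ (j, k) * ell2_apply x (h k))"
      by (subst sum.swap) (simp add: sum_distrib_left mult.assoc)
    also have "\<dots> = (\<Sum>k<n. (A * B) $$ (i, k) * ell2_apply x (h k))"
      using A B i by (intro sum.cong refl)
        (auto simp: scalar_prod_def sum_distrib_right lessThan_atLeast0)
    finally show ?thesis
      by (simp add: i ell2_apply_mat_op[OF h])
  qed (simp add: mat_op_off_range)
qed

lemma mat_op_one:
  assumes h: "inj_on h {..<n}" shows "mat_op n h (1\<^sub>m n) = coord_proj (h ` {..<n})"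
proof (intro op_eqI ell2_eqI)
  fix x :: "'a ell2" and a
  show "ell2_apply (ap (mat_op n h (1\<^sub>m n)) x) a = ell2_apply (ap (coord_proj (h ` {..<n})) x) a"
  proof (cases "a \<in> h ` {..<n}")
    case True
    then obtain i where i: "i < n" "a = h i" by auto
    have "(\<Sum>j<n. 1\<^sub>m n $$ (i, j) * ell2_apply x (h j)) = (\<Sum>j<n. if j = i then ell2_apply x (h j) else 0)"
      using i by (intro sum.cong) auto
    then show ?thesis using i True by (simp add: ell2_apply_mat_op[OF h])
  qed (simp add: mat_op_off_range)
qed

text \<open>On the range of a coordinate projection \<open>P\<close> the operator \<open>1 + P N\<close> acts as the matrix
  \<open>1 + P N P\<close>, and modulo that range it is the identity.\<close>

lemma regular_one_plus_coord_proj_iff_det: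
  fixes N :: "'i ell2 op"
  assumes h: "inj_on h {..<n}"
  defines "A \<equiv> mat n n (\<lambda>(i, j). (if i = j then 1 else 0) + ell2_apply (ap N (delta (h j))) (h i))"
  shows "regular (1 + coord_proj (h ` {..<n}) * N) \<longleftrightarrow> det A \<noteq> 0"
proof -
  let ?P = "coord_proj (h ` {..<n})"
  have A: "A \<in> carrier_mat n n" by (simp add: A_def)
  have PP: "?P * ?P = ?P" by (intro op_eqI ell2_eqI) auto
  have cutx: "ap ?P x = (\<Sum>j<n. ell2_apply x (h j) *\<^sub>C delta (h j))" for x
  proof -
    have "ap ?P x = (\<Sum>i<n. (\<Sum>j<n. (1\<^sub>m n) $$ (i, j) * ell2_apply x (h j)) *\<^sub>C delta (h i))"
      by (simp only: mat_op_one[OF h, symmetric] ap_mat_op)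
    also have "\<dots> = (\<Sum>i<n. ell2_apply x (h i) *\<^sub>C delta (h i))"
    proof (intro sum.cong refl)
      fix i assume "i \<in> {..<n}"
      then have "(\<Sum>j<n. (1\<^sub>m n) $$ (i, j) * ell2_apply x (h j)) = (\<Sum>j<n. if j = i then ell2_apply x (h j) else 0)"
        by (intro sum.cong) auto
      with \<open>i \<in> {..<n}\<close> show "(\<Sum>j<n. (1\<^sub>m n) $$ (i, j) * ell2_apply x (h j)) *\<^sub>C delta (h i) =
          ell2_apply x (h i) *\<^sub>C delta (h i)" by simp
    qed
    finally show ?thesis .
  qed
  have PNP: "?P + ?P * N * ?P = mat_op n h A"
  proof (intro op_eqI ell2_eqI)
    fix x :: "'i ell2" and a
    show "ell2_apply (ap (?P + ?P * N * ?P) x) a = ell2_apply (ap (mat_op n h A) x) a"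
    proof (cases "a \<in> h ` {..<n}")
      case True
      then obtain i where i: "i < n" "a = h i" by auto
      have "ell2_apply (ap N (ap ?P x)) (h i) =
          (\<Sum>j<n. ell2_apply x (h j) * ell2_apply (ap N (delta (h j))) (h i))"
        unfolding cutx ap.sum_right ap_scaleC by simp
      moreover have "ell2_apply x (h i) = (\<Sum>j<n. (if i = j then 1 else 0) * ell2_apply x (h j))"
        using i by (simp add: if_distrib[of "\<lambda>a. a * _"] cong: if_cong)
      ultimately have "ell2_apply x (h i) + ell2_apply (ap N (ap ?P x)) (h i) =
          (\<Sum>j<n. A $$ (i, j) * ell2_apply x (h j))"
        using i by (simp add: A_def sum.distrib[symmetric] algebra_simps)
      then show ?thesis using i True by (simp add: ell2_apply_mat_op[OF h] ap.add_left)
    qed (simp add: mat_op_off_range ap.add_left)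
  qed
  show ?thesis
  proof
    assume reg: "regular (1 + ?P * N)"
    show "det A \<noteq> 0"
    proof
      assume "det A = 0"
      then obtain v where v: "v \<in> carrier_vec n" "v \<noteq> 0\<^sub>v n" "A *\<^sub>v v = 0\<^sub>v n"
        using det_0_iff_vec_prod_zero[OF A] by blast
      define x where "x = (\<Sum>i<n. (v $ i) *\<^sub>C delta (h i))"
      have xh: "ell2_apply x (h j) = v $ j" if "j < n" for j
      proof -
        have "ell2_apply x (h j) = (\<Sum>i<n. if i = j then v $ i else 0)"
          unfolding x_def ell2_apply_sum by (intro sum.cong) (use h that in \<open>auto dest: inj_onD\<close>)
        then show ?thesis using that by simp
      qed
      have Px: "ap ?P x = x" unfolding cutx by (subst (2) x_def) (simp add: xh)
      have "ap (1 + ?P * N) x = ap (?P + ?P * N * ?P) x" by (simp add: ap.add_left Px)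
      also have "\<dots> = 0"
      proof (rule ell2_eqI)
        fix a
        show "ell2_apply (ap (?P + ?P * N * ?P) x) a = ell2_apply 0 a"
        proof (cases "a \<in> h ` {..<n}")
          case True
          then obtain i where i: "i < n" "a = h i" by auto
          have "(\<Sum>j<n. A $$ (i, j) * v $ j) = (A *\<^sub>v v) $ i"
            using i v(1) A by (simp add: scalar_prod_def lessThan_atLeast0)
          then show ?thesis using i v(3) unfolding PNP by (simp add: ell2_apply_mat_op[OF h] xh)
        qed (simp add: PNP mat_op_off_range)
      qed
      finally have "ap (1 + ?P * N) x = 0" .
      moreover have "x \<noteq> 0"
      proof
        assume "x = 0"
        then have "v $ j = 0" if "j < n" for j using xh[OF that] by simp
        then have "v = 0\<^sub>v n" using v(1) by (intro eq_vecI) auto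
        with v(2) show False by simp
      qed
      ultimately show False using reg not_regular_if_kernel by blast
    qed
  next
    assume "det A \<noteq> 0"
    then have "A \<in> Units (ring_mat TYPE(complex) n ())" by (rule det_non_zero_imp_unit[OF A])
    then obtain B where B: "B \<in> carrier_mat n n" and BA: "B * A = 1\<^sub>m n" and AB: "A * B = 1\<^sub>m n"
      unfolding Units_def by (auto simp: ring_mat_simps)
    define Q where "Q = mat_op n h B"
    have 1: "(?P + ?P * N * ?P) * Q = ?P" "Q * (?P + ?P * N * ?P) = ?P"
      unfolding PNP Q_def mat_op_mult[OF h A B] mat_op_mult[OF h B A] AB BA mat_op_one[OF h]
      by (rule refl)+
    have 2: "?P * Q = Q" "Q * ?P = Q"
      unfolding mat_op_one[OF h, symmetric] Q_def
      using mat_op_mult[OF h one_carrier_mat B] mat_op_mult[OF h B one_carrier_mat]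
      left_mult_one_mat[OF B] right_mult_one_mat[OF B] by simp_all
    have 3: "Q + ?P * (N * Q) = ?P" "Q + Q * (N * ?P) = ?P"
      using 1 2 by (simp_all add: distrib_left distrib_right mult.assoc)
        (metis (no_types, lifting) 2 mult.assoc)+
    have e1: "?P * (N * Q) = ?P - Q" and e2: "Q * (N * ?P) = ?P - Q"
      using 3 by (simp_all add: algebra_simps)
    have "(1 + ?P * N) * (1 - Q * N) = 1 + ?P * N - Q * N - ?P * (N * Q) * N"
      by (simp add: algebra_simps)
    also have "\<dots> = 1" unfolding e1 by (simp add: algebra_simps)
    finally have r1: "(1 + ?P * N) * (1 - Q * N) = 1" .
    have "(1 - Q * N) * (1 + ?P * N) = 1 + ?P * N - Q * N - Q * (N * ?P) * N"
      by (simp add: algebra_simps)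
    also have "\<dots> = 1" unfolding e2 by (simp add: algebra_simps)
    finally show "regular (1 + ?P * N)" using r1 by (intro regularI)
  qed
qed

text \<open>Let \<open>P\<close> be a truncation that captures \<open>K z0\<close> up to norm less than one. Near \<open>z0\<close> the factor
  \<open>G = 1 + (1 - P) K\<close> is invertible by the Neumann series, and \<open>1 + K = (1 + P (K G\<inverse>)) G\<close>, so that
  invertibility is decided by a finite determinant with holomorphic entries.\<close>

lemma local_determinant:
  fixes K :: "complex \<Rightarrow> 'i ell2 op"
  assumes "open \<Omega>" "z0 \<in> \<Omega>" and hol: "\<And>z. z \<in> \<Omega> \<Longrightarrow> op_hol_at K z" and "approximable (K z0)"
  obtains r d where "r > 0" "ball z0 r \<subseteq> \<Omega>" "d holomorphic_on ball z0 r"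
    "\<And>z. z \<in> ball z0 r \<Longrightarrow> regular (1 + K z) \<longleftrightarrow> d z \<noteq> 0"
proof -
  obtain F where F: "finite F" "norm ((1 - coord_proj F) * K z0) < 1"
    using assms(4)[unfolded approximable_def, rule_format, of 1] by auto
  have "((\<lambda>z. norm ((1 - coord_proj F) * K z)) \<longlongrightarrow> norm ((1 - coord_proj F) * K z0)) (at z0)"
    using op_hol_at_isCont[OF hol[OF assms(2)]] unfolding isCont_def by (intro tendsto_intros)
  then have "\<forall>\<^sub>F z in at z0. norm ((1 - coord_proj F) * K z) < 1"
    using F(2) by (rule order_tendstoD)
  then have "\<forall>\<^sub>F z in nhds z0. norm ((1 - coord_proj F) * K z) < 1"
    unfolding eventually_at_filter by eventually_elim (use F(2) in auto)
  moreover have "\<forall>\<^sub>F z in nhds z0. z \<in> \<Omega>" using assms(1,2) by (rule eventually_nhds_in_open)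
  ultimately have "\<forall>\<^sub>F z in nhds z0. norm ((1 - coord_proj F) * K z) < 1 \<and> z \<in> \<Omega>"
    by (rule eventually_conj)
  then obtain r where r: "r > 0"
    "\<And>z. dist z z0 < r \<Longrightarrow> norm ((1 - coord_proj F) * K z) < 1 \<and> z \<in> \<Omega>"
    unfolding eventually_nhds_metric by blast
  obtain h where h: "bij_betw h {..<card F} F"
    using ex_bij_betw_nat_finite[OF F(1)] by (auto simp: lessThan_atLeast0)
  define n where "n = card F"
  have inj: "inj_on h {..<n}" and Fh: "F = h ` {..<n}"
    using h by (auto simp: bij_betw_def n_def)
  define G where "G z = 1 + (1 - coord_proj F) * K z" for z
  define N where "N z = K z * op_inv (G z)" for z
  define d where "d z = det (mat n n (\<lambda>(i, j). (if i = j then 1 else 0) +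
    ell2_apply (ap (N z) (delta (h j))) (h i)))" for z
  have reg: "regular (G z)" if "z \<in> ball z0 r" for z
    unfolding G_def using r(2)[of z] that by (intro regular_one_plus) (simp add: dist_commute)
  have N_hol: "op_hol_at N z" if "z \<in> ball z0 r" for z
    unfolding N_def using reg[OF that]
    by (intro op_hol_at_mult op_hol_at_op_inv)
      (use r(2)[of z] that hol in \<open>auto simp: G_def dist_commute
        intro!: op_hol_at_add op_hol_at_mult op_hol_at_const\<close>)
  show ?thesis
  proof (rule that[of r d])
    show "r > 0" by fact
    show "ball z0 r \<subseteq> \<Omega>" using r(2) by (auto simp: dist_commute)
    have entry: "(\<lambda>z. ell2_apply (ap (N z) (delta (h j))) (h i)) holomorphic_on ball z0 r" for i j
      unfolding holomorphic_on_def
      using op_hol_at_entry[OF N_hol, of _ "delta (h i)" "delta (h j)"]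
      by (auto intro: field_differentiable_at_within)
    show "d holomorphic_on ball z0 r"
    proof -
      have "d = (\<lambda>z. \<Sum>p | p permutes {0..<n}. signof p * (\<Prod>i = 0..<n.
          (if i = p i then 1 else 0) + ell2_apply (ap (N z) (delta (h (p i)))) (h i)))"
        unfolding d_def det_def
        by (auto intro!: ext sum.cong prod.cong simp: permutes_in_image)
      then show ?thesis by (auto intro!: holomorphic_intros entry)
    qed
    fix z assume z: "z \<in> ball z0 r"
    have "(1 + coord_proj F * N z) * G z = G z + coord_proj F * (K z * (op_inv (G z) * G z))"
      by (simp add: N_def distrib_right mult.assoc)
    also have "\<dots> = G z + coord_proj F * K z" by (simp add: op_inv reg[OF z])
    also have "\<dots> = 1 + K z" by (simp add: G_def algebra_simps)
    finally have "regular (1 + K z) \<longleftrightarrow> regular (1 + coord_proj F * N z)"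
      using regular_mult_right_iff[OF reg[OF z]] by metis
    also have "\<dots> \<longleftrightarrow> d z \<noteq> 0"
      unfolding d_def Fh by (rule regular_one_plus_coord_proj_iff_det[OF inj])
    finally show "regular (1 + K z) \<longleftrightarrow> d z \<noteq> 0" .
  qed
qed

text \<open>By the local determinants, a point where singular points accumulate has a whole neighbourhood
  of singular points. The set of accumulation points is thus open as well as closed, and on a
  connected domain it is empty or everything.\<close>

theorem analytic_fredholm:
  fixes K :: "complex \<Rightarrow> 'i ell2 op"
  assumes \<Omega>: "open \<Omega>" "connected \<Omega>" and hol: "\<And>z. z \<in> \<Omega> \<Longrightarrow> op_hol_at K z"
    and app: "\<And>z. z \<in> \<Omega> \<Longrightarrow> approximable (K z)"
    and w: "w \<in> \<Omega>" "regular (1 + K w)" and \<zeta>: "\<zeta> \<in> \<Omega>"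
  shows "\<not> \<zeta> islimpt {z \<in> \<Omega>. \<not> regular (1 + K z)}"
proof
  define S where "S = {z \<in> \<Omega>. \<not> regular (1 + K z)}"
  define Z where "Z = {z. z islimpt S}"
  assume "\<zeta> islimpt {z \<in> \<Omega>. \<not> regular (1 + K z)}"
  then have "\<zeta> \<in> Z \<inter> \<Omega>" using \<zeta> by (simp add: Z_def S_def)
  have nbhd: "\<exists>r>0. ball z0 r \<subseteq> S" if z0: "z0 \<in> Z \<inter> \<Omega>" for z0
  proof -
    have "z0 \<in> \<Omega>" using z0 by simp
    from local_determinant[OF \<Omega>(1) this hol app[OF this]]
    obtain r d where r: "r > 0" "ball z0 r \<subseteq> \<Omega>" "d holomorphic_on ball z0 r"
      "\<And>z. z \<in> ball z0 r \<Longrightarrow> regular (1 + K z) \<longleftrightarrow> d z \<noteq> 0" by blast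
    have "z0 islimpt (S \<inter> ball z0 r)"
      using z0 r(1) by (intro islimpt_Int_eventually eventually_at_in_open') (auto simp: Z_def)
    have "d z = 0" if "z \<in> ball z0 r" for z
    proof (rule analytic_continuation[OF r(3), where U = "S \<inter> ball z0 r" and \<xi> = z0])
      show "z0 islimpt (S \<inter> ball z0 r)" by fact
      show "d u = 0" if "u \<in> S \<inter> ball z0 r" for u using that r(4) by (auto simp: S_def)
    qed (use r(1) that in auto)
    then have "ball z0 r \<subseteq> S" using r(2,4) by (auto simp: S_def)
    then show ?thesis using r(1) by blast
  qed
  have "open (Z \<inter> \<Omega>)"
    unfolding open_contains_ball
  proof
    fix z0 assume z0: "z0 \<in> Z \<inter> \<Omega>"
    obtain r where r: "r > 0" "ball z0 r \<subseteq> S" using nbhd[OF z0] by blast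
    have "z islimpt ball z0 r" if "z \<in> ball z0 r" for z
      using that by (intro interior_limit_point) auto
    then have "ball z0 r \<subseteq> Z" using r(2) unfolding Z_def by (blast intro: islimpt_subset)
    moreover have "ball z0 r \<subseteq> \<Omega>" using r(2) by (auto simp: S_def)
    ultimately show "\<exists>e>0. ball z0 e \<subseteq> Z \<inter> \<Omega>" using r(1) by blast
  qed
  moreover have "open (- Z)" unfolding Z_def using closed_limpts by (simp add: open_closed)
  moreover have "(Z \<inter> \<Omega>) \<inter> (- Z) \<inter> \<Omega> = {}" "\<Omega> \<subseteq> (Z \<inter> \<Omega>) \<union> (- Z)" by auto
  ultimately have "(Z \<inter> \<Omega>) \<inter> \<Omega> = {} \<or> (- Z) \<inter> \<Omega> = {}" using connectedD[OF \<Omega>(2)] by blast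
  then have "w \<in> Z \<inter> \<Omega>" using \<open>\<zeta> \<in> Z \<inter> \<Omega>\<close> w(1) by blast
  from nbhd[OF this] obtain r where "r > 0" "ball w r \<subseteq> S" by blast
  then have "w \<in> S" by auto
  with w(2) show False by (simp add: S_def)
qed

section \<open>The free operator and its compact perturbations\<close>

definition translation :: "int \<Rightarrow> int ell2 op" where
  "translation k = mk_op (shift_ell2 k)"

lemma ap_translation: "ap (translation k) = shift_ell2 k"
  unfolding translation_def
  by (rule ap_mk_op[where K = 1]) (auto intro!: ell2_eqI simp: shift_ell2.rep_eq norm_shift_ell2)

lemma ell2_apply_translation [simp]: "ell2_apply (ap (translation k) x) n = ell2_apply x (n + k)"
  by (simp add: ap_translation shift_ell2.rep_eq)

lemma norm_translation: "norm (translation k) \<le> 1"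
  by (rule norm_op_bound) (simp_all add: ap_translation norm_shift_ell2)

text \<open>On the Fourier side this is multiplication by \<open>cos \<alpha>\<close>.\<close>

definition cos_op :: "int ell2 op" where
  "cos_op = (1 / 2) *\<^sub>R (translation 1 + translation (- 1))"

lemma ell2_apply_cos_op [simp]:
  "ell2_apply (ap cos_op x) n = (ell2_apply x (n + 1) + ell2_apply x (n - 1)) / 2"
  by (simp add: cos_op_def ap.scaleR_left ap.add_left)

lemma norm_cos_op: "norm cos_op \<le> 1"
proof -
  have "norm (translation 1 + translation (- 1)) \<le> 1 + 1"
    using norm_triangle_ineq norm_translation by (metis add_mono order_trans)
  then show ?thesis by (simp add: cos_op_def)
qed

lemma free_op_bounded: "free_op \<in> bounded_ops"
  unfolding bounded_ops_def
  by (auto intro!: ell2_eqI simp: free_op.rep_eq free_op_fun.rep_eq algebra_simps)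

lemma free_op_eq: "Op free_op = sc 2 - sc 2 * cos_op"
proof (intro op_eqI ell2_eqI)
  fix x n
  have "ap (Op free_op) x = free_op_fun x"
    by (simp add: ap.rep_eq Op_inverse free_op_bounded free_op.rep_eq)
  then show "ell2_apply (ap (Op free_op) x) n = ell2_apply (ap (sc 2 - sc 2 * cos_op) x) n"
    by (simp add: ap.diff_left free_op_fun.rep_eq field_simps)
qed

lemma spectrum_op_blinfun: "z \<in> spectrum (op_blinfun T) \<longleftrightarrow> \<not> regular (T - sc z)"
proof -
  have eq: "op_blinfun T - scalar_op z = op_blinfun (T - sc z)"
    by (simp add: minus_op.rep_eq sc.rep_eq)
  have "is_op_inverse (op_blinfun S) (op_blinfun R) \<longleftrightarrow> R * S = 1 \<and> S * R = 1" for R S :: "'a op"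
    unfolding is_op_inverse_def
    by (simp add: op_blinfun times_op.rep_eq[symmetric] one_op.rep_eq[symmetric] op_blinfun_inject)
  then have "(\<exists>R. is_op_inverse (op_blinfun (T - sc z)) R) \<longleftrightarrow> regular (T - sc z)"
    unfolding regular_def by (metis Op_inverse is_op_inverse_def)
  then show ?thesis by (simp only: spectrum_def mem_Collect_eq eq)
qed

text \<open>With \<open>\<mu> = (z + 1/z) / 2\<close> the operator \<open>cos_op - \<mu>\<close> factors into
  \<open>- (1 - z S) (1 - z S\<inverse>) / (2 z)\<close>, \<open>S\<close> the unitary shift, and off the interval \<open>[-1, 1]\<close>
  the root \<open>z\<close> can be taken inside the unit disc.\<close>

lemma regular_cos_op_minus:
  assumes "\<mu> \<notin> complex_of_real ` {-1..1}"
  shows "regular (cos_op - sc \<mu>)"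
proof -
  define z1 where "z1 = \<mu> + csqrt (\<mu>\<^sup>2 - 1)"
  have "(z1 - \<mu>)\<^sup>2 = \<mu>\<^sup>2 - 1" by (simp add: z1_def)
  then have q: "z1 * (2 * \<mu> - z1) = 1" by (simp add: power2_eq_square algebra_simps)
  have z10: "z1 \<noteq> 0" using q by auto
  have "\<exists>z. z \<noteq> 0 \<and> cmod z < 1 \<and> 2 * \<mu> = z + 1 / z"
  proof (cases "cmod z1 < 1")
    case True
    then show ?thesis using q z10 by (intro exI[of _ z1]) (auto simp: field_simps)
  next
    case False
    have "cmod z1 \<noteq> 1"
    proof
      assume "cmod z1 = 1"
      then have "z1 * cnj z1 = 1" by (simp add: complex_norm_square[symmetric])
      then have "2 * \<mu> - z1 = cnj z1" using q z10 by (metis mult_left_cancel)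
      then have "\<mu> = complex_of_real (Re z1)" by (simp add: complex_eq_iff)
      moreover have "\<bar>Re z1\<bar> \<le> 1" using abs_Re_le_cmod[of z1] \<open>cmod z1 = 1\<close> by simp
      ultimately show False using assms by (auto simp: abs_le_iff)
    qed
    then have "cmod z1 > 1" using False by linarith
    then have "cmod (1 / z1) < 1" by (simp add: norm_divide divide_less_eq)
    moreover have "2 * \<mu> = 1 / z1 + 1 / (1 / z1)" using q z10 by (simp add: field_simps)
    ultimately show ?thesis using z10 by (intro exI[of _ "1 / z1"]) auto
  qed
  then obtain z where z: "z \<noteq> 0" "cmod z < 1" "2 * \<mu> = z + 1 / z" by blast
  have reg: "regular (1 - sc z * translation k)" for k
  proof (rule regular_one_minus)
    have "norm (sc z * translation k) \<le> cmod z * 1"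
      unfolding norm_sc_mult by (intro mult_left_mono norm_translation) simp
    then show "norm (sc z * translation k) < 1" using z by simp
  qed
  have "cos_op - sc \<mu> = sc (- 1 / (2 * z)) * ((1 - sc z * translation 1) * (1 - sc z * translation (- 1)))"
  proof (intro op_eqI ell2_eqI)
    fix x n
    have mu: "\<mu> = (z + 1 / z) / 2" using z(3) by (simp add: field_simps)
    show "ell2_apply (ap (cos_op - sc \<mu>) x) n = ell2_apply (ap (sc (- 1 / (2 * z)) *
        ((1 - sc z * translation 1) * (1 - sc z * translation (- 1)))) x) n"
      using z(1) by (simp add: ap.diff_left ap.diff_right mu) (simp add: field_simps)
  qed
  then show ?thesis using z(1) by (simp only:) (intro regular_mult regular_sc reg; simp)
qed

definition plane_wave :: "real \<Rightarrow> int \<Rightarrow> nat \<Rightarrow> int ell2" where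
  "plane_wave \<phi> a N = (\<Sum>k<N. cis (real k * \<phi>) *\<^sub>C delta (a + int k))"

lemma orthogonal_delta: "a \<noteq> b \<Longrightarrow> inner (c *\<^sub>C delta a) (d *\<^sub>C delta b) = 0"
  by (simp add: inner_eq_Re_cinner cinner_scaleC_left)

lemma norm_plane_wave: "norm (plane_wave \<phi> a N) = sqrt N"
proof -
  have "(norm (plane_wave \<phi> a N))\<^sup>2 = (\<Sum>k<N. (norm (cis (real k * \<phi>) *\<^sub>C delta (a + int k)))\<^sup>2)"
    unfolding plane_wave_def
    by (rule norm_sum_Pythagorean) (auto simp: pairwise_def real_inner_class.orthogonal_def orthogonal_delta)
  also have "\<dots> = N" by (simp add: norm_scaleC)
  finally show ?thesis by (simp add: real_sqrt_unique)
qed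

text \<open>A truncated plane wave is an eigenvector of \<open>cos_op\<close> up to four boundary terms, however long
  it is.\<close>

lemma cos_op_plane_wave:
  "2 *\<^sub>R ap (cos_op - sc (of_real (cos \<phi>))) (plane_wave \<phi> a N) =
    delta (a - 1) - cis (- \<phi>) *\<^sub>C delta a
    - cis (real N * \<phi>) *\<^sub>C delta (a + int N - 1) + cis ((real N - 1) * \<phi>) *\<^sub>C delta (a + int N)"
proof (induction N)
  case 0
  show ?case by (rule ell2_eqI) (simp add: plane_wave_def ap.zero_right)
next
  case (Suc N)
  let ?T = "cos_op - sc (of_real (cos \<phi>))"
  have c: "2 * complex_of_real (cos \<phi>) = cis \<phi> + cis (- \<phi>)"
    by (simp add: complex_eq_iff)
  have e: "cis ((1 + real N) * \<phi>) = cis (real N * \<phi>) * cis \<phi>"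
    "cis ((real N - 1) * \<phi>) = cis (real N * \<phi>) * cis (- \<phi>)"
    by (simp_all add: cis_mult algebra_simps)
  have step: "2 *\<^sub>R ap ?T (cis (real N * \<phi>) *\<^sub>C delta (a + int N)) =
      cis (real N * \<phi>) *\<^sub>C delta (a + int N - 1) + cis (real N * \<phi>) *\<^sub>C delta (a + int N + 1)
      - cis ((1 + real N) * \<phi>) *\<^sub>C delta (a + int N) - cis ((real N - 1) * \<phi>) *\<^sub>C delta (a + int N)"
    unfolding e
  proof (rule ell2_eqI)
    fix n
    define p where "p = cis (real N * \<phi>)"
    have cp: "p * cis \<phi> + p * cis (- \<phi>) = 2 * (complex_of_real (cos \<phi>) * p)"
      using c by (simp only: mult.assoc[symmetric] distrib_left[symmetric]) (simp only: mult.commute)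
    consider "n = a + int N" | "n = a + int N - 1" | "n = a + int N + 1"
      | "n \<noteq> a + int N" "n \<noteq> a + int N - 1" "n \<noteq> a + int N + 1" by blast
    then show "ell2_apply (2 *\<^sub>R ap ?T (cis (real N * \<phi>) *\<^sub>C delta (a + int N))) n =
      ell2_apply (cis (real N * \<phi>) *\<^sub>C delta (a + int N - 1) + cis (real N * \<phi>) *\<^sub>C delta (a + int N + 1)
      - (cis (real N * \<phi>) * cis \<phi>) *\<^sub>C delta (a + int N)
      - (cis (real N * \<phi>) * cis (- \<phi>)) *\<^sub>C delta (a + int N)) n"
      unfolding p_def[symmetric] using cp by cases (auto simp: ap.diff_left algebra_simps)
  qed
  have "plane_wave \<phi> a (Suc N) = plane_wave \<phi> a N + cis (real N * \<phi>) *\<^sub>C delta (a + int N)"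
    by (simp add: plane_wave_def)
  then have "2 *\<^sub>R ap ?T (plane_wave \<phi> a (Suc N)) =
      2 *\<^sub>R ap ?T (plane_wave \<phi> a N) + 2 *\<^sub>R ap ?T (cis (real N * \<phi>) *\<^sub>C delta (a + int N))"
    by (simp add: ap.add_right scaleR_add_right)
  also have "\<dots> = delta (a - 1) - cis (- \<phi>) *\<^sub>C delta a
      - cis ((1 + real N) * \<phi>) *\<^sub>C delta (a + int N) + cis (real N * \<phi>) *\<^sub>C delta (a + int N + 1)"
    unfolding Suc step by simp
  finally show ?case by (simp add: add.assoc add.commute[of 1])
qed

lemma norm_cos_op_plane_wave: "norm (ap (cos_op - sc (of_real (cos \<phi>))) (plane_wave \<phi> a N)) \<le> 2"
proof -
  have "norm (2 *\<^sub>R ap (cos_op - sc (of_real (cos \<phi>))) (plane_wave \<phi> a N)) \<le> 1 + 1 + 1 + 1"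
    unfolding cos_op_plane_wave
    by (intro order_trans[OF norm_triangle_ineq] order_trans[OF norm_triangle_ineq4] add_mono)
      (simp_all add: norm_scaleC)
  then show ?thesis by simp
qed

text \<open>A compact operator sends any orthonormal sequence to zero: a nonzero limit \<open>y\<close> of images would
  give sums of \<open>M\<close> of the vectors, of norm \<open>\<surd>M\<close>, with images of norm of order \<open>M\<close>.\<close>

lemma compact_orthonormal:
  fixes W :: "'a::{complex_hilbert,perfect_space} op" and y :: "nat \<Rightarrow> 'a"
  assumes W: "compact (closure (ap W ` cball 0 1))"
    and y: "\<And>m. norm (y m) = 1" "\<And>m n. m \<noteq> n \<Longrightarrow> inner (y m) (y n) = 0"
    and \<delta>: "\<delta> > 0"
  shows "\<exists>m. norm (ap W (y m)) < \<delta>"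
proof (rule ccontr)
  assume "\<not> ?thesis"
  then have ge: "\<delta> \<le> norm (ap W (y m))" for m by (simp add: not_less)
  have "seq_compact (closure (ap W ` cball 0 1))" using W by (simp add: compact_eq_seq_compact_metric)
  moreover have "ap W (y m) \<in> closure (ap W ` cball 0 1)" for m
    by (intro subsetD[OF closure_subset] imageI) (simp add: y)
  ultimately have "\<exists>l\<in>closure (ap W ` cball 0 1). \<exists>r :: nat \<Rightarrow> nat.
      strict_mono r \<and> ((\<lambda>m. ap W (y m)) \<circ> r) \<longlonglongrightarrow> l"
    unfolding seq_compact_def by simp
  then obtain l r where r: "strict_mono (r :: nat \<Rightarrow> nat)" "((\<lambda>m. ap W (y m)) \<circ> r) \<longlonglongrightarrow> l"
    by blast
  have l: "\<delta> \<le> norm l"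
    by (rule LIMSEQ_le_const[OF tendsto_norm[OF r(2)]]) (auto simp: ge)
  obtain K where K: "\<And>k. k \<ge> K \<Longrightarrow> norm (ap W (y (r k)) - l) < \<delta> / 2"
    using LIMSEQ_D[OF r(2), of "\<delta> / 2"] \<delta> by auto
  have bound: "real M * (\<delta> / 2) \<le> norm W * sqrt M" for M
  proof -
    define s where "s = (\<Sum>k\<in>{K..<K + M}. y (r k))"
    have "(norm s)\<^sup>2 = (\<Sum>k\<in>{K..<K + M}. (norm (y (r k)))\<^sup>2)"
      unfolding s_def
      by (rule norm_sum_Pythagorean)
        (use strict_mono_eq[OF r(1)] in \<open>auto simp: pairwise_def real_inner_class.orthogonal_def y(2)\<close>)
    then have ns: "norm s = sqrt M" by (simp add: y real_sqrt_unique)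
    have "ap W s = of_nat M *\<^sub>R l + (\<Sum>k\<in>{K..<K + M}. ap W (y (r k)) - l)"
      by (simp add: s_def ap.sum_right sum_subtractf sum_constant_scaleR)
    then have "norm (of_nat M *\<^sub>R l) \<le> norm (ap W s) + norm (\<Sum>k\<in>{K..<K + M}. ap W (y (r k)) - l)"
      by (metis add_diff_cancel_right' norm_triangle_ineq4)
    moreover have "norm (\<Sum>k\<in>{K..<K + M}. ap W (y (r k)) - l) \<le> (\<Sum>k\<in>{K..<K + M}. \<delta> / 2)"
      by (rule sum_norm_le) (use K in \<open>auto intro: less_imp_le\<close>)
    moreover have "norm (ap W s) \<le> norm W * sqrt M" using norm_ap[of W s] by (simp add: ns)
    moreover have "real M * \<delta> \<le> norm (of_nat M *\<^sub>R l)" using l by (simp add: mult_left_mono)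
    ultimately show ?thesis by simp
  qed
  have "sqrt (real M) * \<delta> \<le> 2 * norm W" if "M > 0" for M
  proof -
    have "sqrt M * (sqrt M * \<delta>) = real M * \<delta>" by (simp add: mult.assoc[symmetric])
    also have "\<dots> \<le> sqrt M * (2 * norm W)" using bound[of M] by (simp add: mult_ac)
    finally have "sqrt M * (sqrt M * \<delta>) \<le> sqrt M * (2 * norm W)" .
    then show ?thesis using that by simp
  qed
  moreover obtain M where "real M > (2 * norm W / \<delta> + 1)\<^sup>2" using reals_Archimedean2 by blast
  then have "sqrt (real M) > 2 * norm W / \<delta> + 1"
    using \<delta> by (intro real_less_rsqrt) auto
  moreover have "M > 0" using \<open>real M > (2 * norm W / \<delta> + 1)\<^sup>2\<close> by (cases M) auto
  ultimately have "sqrt (real M) * \<delta> \<le> 2 * norm W" "sqrt (real M) > 2 * norm W / \<delta> + 1" by auto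
  with \<delta> show False by (simp add: field_simps)
qed

text \<open>The interval \<open>[-1, 1]\<close> survives every compact perturbation, since it carries approximate
  eigenvectors in the form of disjoint copies of one long truncated plane wave.\<close>

lemma not_regular_cos_op_compact:
  assumes W: "compact (closure (ap W ` cball 0 1))" and c: "-1 \<le> c" "c \<le> 1"
  shows "\<not> regular (cos_op - sc (complex_of_real c) + W)"
proof
  let ?T = "cos_op - sc (complex_of_real c) + W"
  assume reg: "regular ?T"
  define \<phi> where "\<phi> = arccos c"
  have \<phi>: "cos \<phi> = c" unfolding \<phi>_def using c by (rule cos_arccos)
  let ?R = "op_inv ?T"
  obtain N where N: "real N > (4 * norm ?R + 1)\<^sup>2" using reals_Archimedean2 by blast
  then have "sqrt (real N) > 4 * norm ?R + 1" by (intro real_less_rsqrt) auto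
  moreover have "N > 0" using N by (cases N) auto
  ultimately have N: "N > 0" "4 * norm ?R < sqrt N" by auto
  \<comment> \<open>blocks of length N placed side by side, hence orthonormal\<close>
  define y where "y m = (1 / sqrt N) *\<^sub>R plane_wave \<phi> (int (m * N)) N" for m
  have y1: "norm (y m) = 1" for m using N by (simp add: y_def norm_plane_wave)
  have yo: "inner (y m) (y n) = 0" if "m \<noteq> n" for m n
  proof -
    have ne: "int (m * N) + int k \<noteq> int (n * N) + int l" if "k < N" "l < N" for k l
    proof
      assume "int (m * N) + int k = int (n * N) + int l"
      then have "m * N + k = n * N + l" by (metis of_nat_add of_nat_eq_iff)
      then have "(m * N + k) div N = (n * N + l) div N" by simp
      with that N \<open>m \<noteq> n\<close> show False by simp
    qed
    have "inner (plane_wave \<phi> (int (m * N)) N) (plane_wave \<phi> (int (n * N)) N) = 0"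
      unfolding plane_wave_def inner_sum_left inner_sum_right
      by (intro sum.neutral ballI orthogonal_delta ne) auto
    then show ?thesis by (simp add: y_def)
  qed
  have ny: "norm (ap (cos_op - sc (complex_of_real c)) (y m)) \<le> 2 / sqrt N" for m
    using norm_cos_op_plane_wave[of \<phi> "int (m * N)" N]
    by (simp add: y_def \<phi> ap.scaleR_right divide_right_mono)
  define \<delta> where "\<delta> = 1 / (2 * norm ?R + 1)"
  have dpos: "\<delta> > 0" by (simp add: \<delta>_def add_nonneg_pos)
  have "\<exists>m. norm (ap W (y m)) < \<delta>" by (rule compact_orthonormal[OF W y1 yo dpos])
  then obtain m where m: "norm (ap W (y m)) < \<delta>" ..
  have "y m = ap ?R (ap (cos_op - sc (complex_of_real c)) (y m) + ap W (y m))"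
    by (simp only: ap.add_left[symmetric] ap_mult[symmetric] op_inv(1)[OF reg] ap_one)
  then have "1 \<le> norm ?R * norm (ap (cos_op - sc (complex_of_real c)) (y m) + ap W (y m))"
    using norm_ap y1 by metis
  also have "\<dots> \<le> norm ?R * (2 / sqrt N + \<delta>)"
    by (intro mult_left_mono order_trans[OF norm_triangle_ineq] add_mono ny less_imp_le[OF m]) simp
  also have "\<dots> = (4 * norm ?R) / sqrt N / 2 + norm ?R * \<delta>" by (simp add: distrib_left)
  also have "(4 * norm ?R) / sqrt N / 2 < 1 / 2" using N by (simp add: divide_less_eq)
  also have "norm ?R * \<delta> \<le> 1 / 2"
    unfolding \<delta>_def using norm_ge_zero[of ?R] by (simp add: divide_le_eq add_nonneg_pos)
  finally show False by simp
qed

section \<open>Stone's theorem\<close>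

text \<open>The difference of a point off the subspace and its closest point. The parallelogram law makes
  a minimizing sequence converge.\<close>

lemma closed_subspace_orthogonal:
  fixes M :: "'a::{real_inner,banach} set"
  assumes M: "subspace M" "closed M" "M \<noteq> UNIV"
  obtains z where "z \<noteq> 0" "\<And>m. m \<in> M \<Longrightarrow> inner z m = 0"
proof -
  obtain y where y: "y \<notin> M" using M(3) by blast
  have M0: "M \<noteq> {}" using subspace_0[OF M(1)] by blast
  define d where "d = infdist y M"
  have d0: "0 \<le> d" by (simp add: d_def infdist_nonneg)
  have dle: "d \<le> norm (y - m)" if "m \<in> M" for m
    using infdist_le[OF that, of y] by (simp add: d_def dist_norm)
  have "\<exists>m\<in>M. norm (y - m) < d + 1 / real (Suc n)" for n
  proof -
    have "infdist y M < d + 1 / real (Suc n)" by (simp add: d_def)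
    then have "\<exists>r\<in>dist y ` M. r < d + 1 / real (Suc n)"
      using M0 by (intro cInf_lessD) (simp_all add: infdist_notempty)
    then show ?thesis by (auto simp: dist_norm)
  qed
  then obtain m where m: "\<And>n. m n \<in> M" "\<And>n. norm (y - m n) < d + 1 / real (Suc n)" by metis
  have sq: "(norm (y - m n))\<^sup>2 \<le> d\<^sup>2 + (2 * d + 1) / real (Suc n)" for n
  proof -
    have sq': "(d + e)\<^sup>2 = d\<^sup>2 + (2 * d + e) * e" for e by (simp add: power2_eq_square algebra_simps)
    have e: "0 < 1 / real (Suc n)" "1 / real (Suc n) \<le> 1" by simp_all
    have "(norm (y - m n))\<^sup>2 \<le> (d + 1 / real (Suc n))\<^sup>2"
      using m(2)[of n] d0 by (intro power_mono) auto
    also have "\<dots> = d\<^sup>2 + (2 * d + 1 / real (Suc n)) * (1 / real (Suc n))"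
      by (simp only: sq')
    also have "\<dots> \<le> d\<^sup>2 + (2 * d + 1) * (1 / real (Suc n))"
      using e d0 by (intro add_mono mult_right_mono) auto
    finally show ?thesis by simp
  qed
  have par: "(norm (m i - m j))\<^sup>2 \<le> 2 * ((2 * d + 1) / real (Suc i)) + 2 * ((2 * d + 1) / real (Suc j))" for i j
  proof -
    have "(1 / 2) *\<^sub>R (m i + m j) \<in> M" by (intro subspace_scale subspace_add M m)
    then have "d\<^sup>2 \<le> (norm (y - (1 / 2) *\<^sub>R (m i + m j)))\<^sup>2" using dle d0 by (intro power_mono)
    moreover have "(norm (m i - m j))\<^sup>2 =
        2 * (norm (y - m i))\<^sup>2 + 2 * (norm (y - m j))\<^sup>2 - 4 * (norm (y - (1 / 2) *\<^sub>R (m i + m j)))\<^sup>2"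
      by (simp add: power2_norm_eq_inner inner_diff_left inner_diff_right inner_add_left
          inner_add_right inner_commute algebra_simps)
    ultimately show ?thesis using sq[of i] sq[of j] by linarith
  qed
  have "Cauchy m"
  proof (rule CauchyI)
    fix e :: real assume e: "e > 0"
    obtain K where K: "4 * (2 * d + 1) / e\<^sup>2 < real K" using reals_Archimedean2 by blast
    have "norm (m i - m j) < e" if "i \<ge> K" "j \<ge> K" for i j
    proof -
      have c: "2 * ((2 * d + 1) / real (Suc i)) < e\<^sup>2 / 2" if "i \<ge> K" for i
      proof -
        have "4 * (2 * d + 1) / e\<^sup>2 < real (Suc i)" using K that by linarith
        then show ?thesis using e by (simp add: field_simps)
      qed
      have "(norm (m i - m j))\<^sup>2 < e\<^sup>2" using par[of i j] c[OF that(1)] c[OF that(2)] by linarith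
      then show ?thesis using e by (simp add: power_less_imp_less_base)
    qed
    then show "\<exists>K. \<forall>i\<ge>K. \<forall>j\<ge>K. norm (m i - m j) < e" by blast
  qed
  then obtain p where p: "m \<longlonglongrightarrow> p" using Cauchy_convergent convergent_def by blast
  have pM: "p \<in> M" using closed_sequentially[OF M(2)] m(1) p by blast
  have "norm (y - p) \<le> d"
  proof (rule LIMSEQ_le)
    show "(\<lambda>n. norm (y - m n)) \<longlonglongrightarrow> norm (y - p)" by (intro tendsto_intros p)
    have "(\<lambda>n. d + 1 / real (Suc n)) \<longlonglongrightarrow> d + 0"
      using LIMSEQ_inverse_real_of_nat by (intro tendsto_intros) (simp add: divide_inverse)
    then show "(\<lambda>n. d + 1 / real (Suc n)) \<longlonglongrightarrow> d" by simp
  qed (use m(2) less_imp_le in blast)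
  then have dp: "norm (y - p) = d" using dle[OF pM] by simp
  show ?thesis
  proof (rule that[of "y - p"])
    show "y - p \<noteq> 0" using y pM by auto
    fix v assume v: "v \<in> M"
    show "inner (y - p) v = 0"
    proof (cases "v = 0")
      case False
      define t where "t = inner (y - p) v / inner v v"
      have vv: "inner v v > 0" using False by simp
      have expand: "(norm (a - t *\<^sub>R v))\<^sup>2 = (norm a)\<^sup>2 - 2 * t * inner a v + t * t * inner v v" for a
        by (simp add: power2_norm_eq_inner inner_diff_left inner_diff_right inner_commute[of v a] algebra_simps)
      have "p + t *\<^sub>R v \<in> M" by (intro subspace_add subspace_scale M pM v)
      then have "(norm (y - p))\<^sup>2 \<le> (norm (y - (p + t *\<^sub>R v)))\<^sup>2"
        using dle dp by (intro power_mono) auto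
      also have "y - (p + t *\<^sub>R v) = (y - p) - t *\<^sub>R v" by simp
      also have "(norm ((y - p) - t *\<^sub>R v))\<^sup>2 = (norm (y - p))\<^sup>2 - 2 * t * inner (y - p) v + t * t * inner v v"
        by (rule expand)
      also have "t * t * inner v v = t * inner (y - p) v" using vv by (simp add: t_def)
      finally have "t * inner (y - p) v \<le> 0" by simp
      then have "(inner (y - p) v)\<^sup>2 / inner v v \<le> 0" by (simp add: t_def power2_eq_square)
      then show ?thesis using vv by (simp add: divide_le_0_iff)
    qed simp
  qed
qed

lemma divide_succ_mult_cancel: "0 \<le> a \<Longrightarrow> c / (a + 1) * (a + 1) = (c :: real)"
  by auto

lemma has_vector_derivative_lipschitz:
  fixes f :: "real \<Rightarrow> 'a::real_normed_vector"
  assumes "\<And>t. (f has_vector_derivative f' t) (at t)" "\<And>t. norm (f' t) \<le> B"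
  shows "norm (f t - f s) \<le> B * \<bar>t - s\<bar>"
proof -
  have "norm (f t - f s) \<le> B * norm (t - s)"
  proof (rule differentiable_bound[where S = UNIV and f' = "\<lambda>t h. h *\<^sub>R f' t"])
    show "onorm (\<lambda>h. h *\<^sub>R f' t) \<le> B" for t
      using assms(2)[of t] order_trans[OF norm_ge_zero assms(2)[of t]]
      by (intro onorm_bound) (simp_all add: mult.commute[of B] mult_left_mono)
  qed (use assms(1) in \<open>auto simp: has_vector_derivative_def\<close>)
  then show ?thesis by simp
qed

text \<open>For a skew-adjoint bounded \<open>Z\<close> the exponential series gives a group of isometries.\<close>

definition skew :: "'a::{complex_hilbert,perfect_space} op \<Rightarrow> bool" where
  "skew Z \<longleftrightarrow> (\<forall>x. inner (ap Z x) x = 0)"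

lemma skew_diff: 
  assumes "skew Y" "skew Z" shows "skew (Y - Z)"
  using assms by (simp add: skew_def ap.diff_left inner_diff_left)

lemma exp_op_derivative:
  "((\<lambda>t. ap (exp (t *\<^sub>R Z)) x) has_vector_derivative ap (exp (t *\<^sub>R Z)) (ap Z x)) (at t)"
  using bounded_linear.has_vector_derivative[OF ap.bounded_linear_left
      exp_scaleR_has_vector_derivative_right[of Z t UNIV], of x] by simp

lemma norm_exp_skew:
  assumes "skew Z"
  shows "norm (ap (exp (t *\<^sub>R Z)) x) = norm x"
proof -
  let ?f = "\<lambda>t. ap (exp (t *\<^sub>R Z)) x"
  have eq: "ap (exp (t *\<^sub>R Z)) (ap Z x) = ap Z (?f t)" for t
    using exp_times_scaleR_commute[of t Z] by (metis ap_mult)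
  have "((\<lambda>t. inner (?f t) (?f t)) has_vector_derivative 0) (at t)" for t
  proof -
    have d: "(?f has_derivative (\<lambda>h. h *\<^sub>R ap Z (?f t))) (at t)"
      using exp_op_derivative[of Z x t] by (simp add: has_vector_derivative_def eq)
    have "inner (ap Z (?f t)) (?f t) = 0" using assms by (simp add: skew_def)
    then show ?thesis
      using has_derivative_inner[OF d d] unfolding has_vector_derivative_def
      by (simp add: inner_commute[of "?f t"])
  qed
  from has_vector_derivative_lipschitz[OF this, of 0 t 0]
  have "inner (?f t) (?f t) = inner (?f 0) (?f 0)" by simp
  then show ?thesis by (simp add: norm_eq_sqrt_inner)
qed

lemma norm_exp_skew_diff:
  assumes "skew Z"
  shows "norm (ap (exp (t *\<^sub>R Z)) x - ap (exp (s *\<^sub>R Z)) x) \<le> norm (ap Z x) * \<bar>t - s\<bar>"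
  by (rule has_vector_derivative_lipschitz[OF exp_op_derivative]) (simp add: norm_exp_skew[OF assms])

lemma norm_exp_skew_minus_one:
  assumes "skew Z"
  shows "norm (ap (exp (t *\<^sub>R Z)) x - x) \<le> norm (ap Z x) * \<bar>t\<bar>"
  using norm_exp_skew_diff[OF assms, of t x 0] by simp

text \<open>Polarization, with the imaginary part of the inner product recovered by complex linearity.\<close>

lemma norm_preserving_cinner:
  fixes f :: "'a::complex_hilbert \<Rightarrow> 'a"
  assumes "\<And>x y. f (x + y) = f x + f y" "\<And>c x. f (c *\<^sub>C x) = c *\<^sub>C f x" "\<And>x. norm (f x) = norm x"
  shows "cinner (f x) (f y) = cinner x y"
proof -
  have "inner (f x) (f y) = inner x y" for x y
  proof -
    have "inner (f x + f y) (f x + f y) = inner (x + y) (x + y)"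
      by (metis assms(1,3) power2_norm_eq_inner)
    moreover have "inner (f x) (f x) = inner x x" "inner (f y) (f y) = inner y y"
      by (metis assms(3) power2_norm_eq_inner)+
    ultimately show ?thesis by (simp add: inner_add_left inner_add_right inner_commute)
  qed
  then show ?thesis unfolding cinner_eq_inner by (simp add: assms(2)[symmetric])
qed

text \<open>Stone's theorem by the method of Yosida: \<open>B = i A\<close> is approximated by bounded skew-adjoint
  functions of its resolvents, whose exponentials converge strongly.\<close>

locale selfadjoint_operator =
  fixes A :: "('a::{complex_hilbert,perfect_space} \<times> 'a) set"
  assumes sa: "selfadjoint A"
begin

lemma mem_iff: "(y, z) \<in> A \<longleftrightarrow> (\<forall>(x, w) \<in> A. cinner y w = cinner z x)"
proof -
  have "A = adjoint_graph A" using sa by (simp add: selfadjoint_def)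
  then have "(y, z) \<in> A \<longleftrightarrow> (y, z) \<in> adjoint_graph A" by simp
  then show ?thesis by (simp add: adjoint_graph_def)
qed

lemma symm: "(x, w) \<in> A \<Longrightarrow> (x', w') \<in> A \<Longrightarrow> cinner x w' = cinner w x'"
  using mem_iff[of x w] by blast

lemma dense_domain: "closure (Domain A) = UNIV"
  using sa by (simp add: selfadjoint_def)

lemma add: "(x, w) \<in> A \<Longrightarrow> (x', w') \<in> A \<Longrightarrow> (x + x', w + w') \<in> A"
  using sa by (simp add: selfadjoint_def linear_operator_def)

lemma scale: "(x, w) \<in> A \<Longrightarrow> (c *\<^sub>C x, c *\<^sub>C w) \<in> A"
  using sa by (simp add: selfadjoint_def linear_operator_def)

lemma diff: "(x, w) \<in> A \<Longrightarrow> (x', w') \<in> A \<Longrightarrow> (x - x', w - w') \<in> A"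
  using add[of x w "- x'" "- w'"] scale[of x' w' "-1"]
  by (simp add: scaleC_uminus_left scaleC_one)

lemma scaleR: "(x, w) \<in> A \<Longrightarrow> (r *\<^sub>R x, r *\<^sub>R w) \<in> A"
  by (simp add: scaleR_scaleC scale)

lemma zero: "(0, 0) \<in> A"
  using sa by (simp add: selfadjoint_def linear_operator_def)

lemma closed_graph:
  assumes "\<And>n. (x n, w n) \<in> A" "x \<longlonglongrightarrow> l" "w \<longlonglongrightarrow> m"
  shows "(l, m) \<in> A"
  unfolding mem_iff
proof clarify
  fix u v assume uv: "(u, v) \<in> A"
  have "(\<lambda>n. cinner (x n) v) \<longlonglongrightarrow> cinner l v" "(\<lambda>n. cinner (w n) u) \<longlonglongrightarrow> cinner m u"
    by (intro cinner.tendsto tendsto_const assms)+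
  moreover have "cinner (x n) v = cinner (w n) u" for n using symm[OF assms(1) uv] .
  ultimately show "cinner l v = cinner m u" using LIMSEQ_unique by simp
qed

lemma quadratic_form_real: "(x, w) \<in> A \<Longrightarrow> inner x (\<i> *\<^sub>C w) = 0"
proof -
  assume xw: "(x, w) \<in> A"
  have "cinner x w = cinner w x" by (rule symm[OF xw xw])
  also have "\<dots> = cnj (cinner x w)" by (rule cinner_commute)
  finally have "Im (cinner x w) = 0" by (simp add: complex_eq_iff)
  then show ?thesis by (simp add: inner_eq_Re_cinner cinner_scaleC_right)
qed

text \<open>The quadratic form of \<open>A\<close> is real, so the cross term vanishes and both summands are controlled
  by the whole.\<close>

lemma norm_shifted:
  assumes "(x, w) \<in> A"
  shows "(norm (l *\<^sub>R x - \<i> *\<^sub>C w))\<^sup>2 = l\<^sup>2 * (norm x)\<^sup>2 + (norm w)\<^sup>2"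
proof -
  have "(norm (l *\<^sub>R x - \<i> *\<^sub>C w))\<^sup>2 = l\<^sup>2 * inner x x - 2 * l * inner x (\<i> *\<^sub>C w) + (norm (\<i> *\<^sub>C w))\<^sup>2"
    unfolding power2_norm_eq_inner
    by (simp add: inner_diff_left inner_diff_right inner_commute[of "\<i> *\<^sub>C w" x] power2_eq_square right_diff_distrib)
  then show ?thesis using quadratic_form_real[OF assms]
    by (simp add: norm_scaleC power2_norm_eq_inner)
qed

lemma norm_shifted_ge:
  assumes "(x, w) \<in> A"
  shows "\<bar>l\<bar> * norm x \<le> norm (l *\<^sub>R x - \<i> *\<^sub>C w)" "norm w \<le> norm (l *\<^sub>R x - \<i> *\<^sub>C w)"
proof -
  have "(\<bar>l\<bar> * norm x)\<^sup>2 \<le> (norm (l *\<^sub>R x - \<i> *\<^sub>C w))\<^sup>2"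
    unfolding norm_shifted[OF assms] by (simp add: power_mult_distrib)
  then show "\<bar>l\<bar> * norm x \<le> norm (l *\<^sub>R x - \<i> *\<^sub>C w)" by (rule power2_le_imp_le) simp
  have "(norm w)\<^sup>2 \<le> (norm (l *\<^sub>R x - \<i> *\<^sub>C w))\<^sup>2" unfolding norm_shifted[OF assms] by simp
  then show "norm w \<le> norm (l *\<^sub>R x - \<i> *\<^sub>C w)" by (rule power2_le_imp_le) simp
qed

text \<open>The range of \<open>l - i A\<close> is closed, and a vector orthogonal to it would be an eigenvector of
  \<open>A\<close> for an imaginary eigenvalue.\<close>

lemma shifted_surj:
  assumes l: "l \<noteq> 0"
  shows "\<exists>x w. (x, w) \<in> A \<and> l *\<^sub>R x - \<i> *\<^sub>C w = y"
proof (rule ccontr)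
  assume neg: "\<not> ?thesis"
  define M where "M = {l *\<^sub>R x - \<i> *\<^sub>C w | x w. (x, w) \<in> A}"
  have "subspace M"
    unfolding subspace_def
  proof (intro conjI allI ballI)
    show "0 \<in> M" unfolding M_def using zero by (intro CollectI exI[of _ 0]) auto
  next
    fix p q assume "p \<in> M" "q \<in> M"
    then obtain x w x' w' where "(x, w) \<in> A" "p = l *\<^sub>R x - \<i> *\<^sub>C w" "(x', w') \<in> A" "q = l *\<^sub>R x' - \<i> *\<^sub>C w'"
      unfolding M_def by blast
    then show "p + q \<in> M" unfolding M_def
      by (intro CollectI exI[of _ "x + x'"] exI[of _ "w + w'"])
        (auto simp: add scaleC_add_right scaleR_add_right)
  next
    fix r :: real and p assume "p \<in> M"
    then obtain x w where "(x, w) \<in> A" "p = l *\<^sub>R x - \<i> *\<^sub>C w"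
      unfolding M_def by blast
    moreover have "r *\<^sub>R (l *\<^sub>R x - \<i> *\<^sub>C w) = l *\<^sub>R (r *\<^sub>R x) - \<i> *\<^sub>C (r *\<^sub>R w)"
      by (simp add: scaleC_minus_right scaleR_scaleC scaleC_scaleC mult.commute)
    ultimately show "r *\<^sub>R p \<in> M" unfolding M_def using scaleR by blast
  qed
  moreover have "closed M"
    unfolding closed_sequential_limits
  proof (intro allI impI, elim conjE)
    fix p q assume "\<forall>n. p n \<in> M" and lim: "p \<longlonglongrightarrow> q"
    then have "\<exists>x w. (x, w) \<in> A \<and> p n = l *\<^sub>R x - \<i> *\<^sub>C w" for n unfolding M_def by blast
    then obtain x w where xw: "\<And>n. (x n, w n) \<in> A" "\<And>n. p n = l *\<^sub>R x n - \<i> *\<^sub>C w n" by metis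
    have eq: "p i - p j = l *\<^sub>R (x i - x j) - \<i> *\<^sub>C (w i - w j)" for i j
      by (simp add: xw(2) scaleR_diff_right scaleC_minus_right)
    have C: "Cauchy p" using lim convergent_Cauchy convergent_def by blast
    have "Cauchy w"
    proof (rule CauchyI)
      fix e :: real assume "e > 0"
      then obtain K where K: "\<forall>i\<ge>K. \<forall>j\<ge>K. norm (p i - p j) < e" using CauchyD[OF C] by blast
      have "norm (w i - w j) \<le> norm (p i - p j)" for i j
        unfolding eq by (rule norm_shifted_ge(2)[OF diff[OF xw(1) xw(1)]])
      then show "\<exists>K. \<forall>i\<ge>K. \<forall>j\<ge>K. norm (w i - w j) < e" using K by (meson le_less_trans)
    qed
    then obtain m where m: "w \<longlonglongrightarrow> m" using Cauchy_convergent convergent_def by blast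
    have "x = (\<lambda>n. (1 / l) *\<^sub>R (p n + \<i> *\<^sub>C w n))" using l by (simp add: xw(2))
    then have xl: "x \<longlonglongrightarrow> (1 / l) *\<^sub>R (q + \<i> *\<^sub>C m)"
      by (simp only:) (intro tendsto_intros lim bounded_linear.tendsto[OF bounded_linear_scaleC] m)
    from closed_graph[OF xw(1) xl m] have "((1 / l) *\<^sub>R (q + \<i> *\<^sub>C m), m) \<in> A" .
    moreover have "q = l *\<^sub>R ((1 / l) *\<^sub>R (q + \<i> *\<^sub>C m)) - \<i> *\<^sub>C m" using l by simp
    ultimately show "q \<in> M" unfolding M_def by blast
  qed
  moreover have "y \<notin> M" using neg unfolding M_def by auto
  then have "M \<noteq> UNIV" by auto
  ultimately obtain z where z: "z \<noteq> 0" "\<And>m. m \<in> M \<Longrightarrow> inner z m = 0"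
    using closed_subspace_orthogonal by blast
  have "(z, (\<i> * of_real l) *\<^sub>C z) \<in> A"
    unfolding mem_iff
  proof clarify
    fix x w assume xw: "(x, w) \<in> A"
    have "inner z (l *\<^sub>R x - \<i> *\<^sub>C w) = 0" using xw by (intro z) (auto simp: M_def)
    moreover have "inner z (l *\<^sub>R (\<i> *\<^sub>C x) - \<i> *\<^sub>C (\<i> *\<^sub>C w)) = 0"
      using scale[OF xw, of \<i>] by (intro z) (auto simp: M_def)
    ultimately have "cinner z (l *\<^sub>R x - \<i> *\<^sub>C w) = 0"
      by (simp add: complex_eq_iff inner_eq_Re_cinner cinner.diff_right cinner_scaleC_right scaleR_scaleC)
    then show "cinner z w = cinner ((\<i> * of_real l) *\<^sub>C z) x"
      by (simp add: cinner.diff_right cinner_scaleC_right cinner_scaleC_left scaleR_scaleC complex_eq_iff)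
  qed
  from quadratic_form_real[OF this] have "l * (inner z z) = 0"
    by (simp add: scaleC_scaleC inner_eq_Re_cinner cinner_scaleC_right)
  with z(1) l show False by simp
qed

text \<open>\<open>res l\<close> is the bounded inverse of \<open>l - i A\<close> for real \<open>l \<noteq> 0\<close>.\<close>

definition res :: "real \<Rightarrow> 'a op" where
  "res l = mk_op (\<lambda>y. SOME x. \<exists>w. (x, w) \<in> A \<and> l *\<^sub>R x - \<i> *\<^sub>C w = y)"

lemma res_exists:
  assumes l: "l \<noteq> 0"
  shows "\<exists>w. (ap (res l) y, w) \<in> A \<and> l *\<^sub>R ap (res l) y - \<i> *\<^sub>C w = y"
proof -
  let ?f = "\<lambda>y. SOME x. \<exists>w. (x, w) \<in> A \<and> l *\<^sub>R x - \<i> *\<^sub>C w = y"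
  have f: "\<exists>w. (?f y, w) \<in> A \<and> l *\<^sub>R ?f y - \<i> *\<^sub>C w = y" for y
    using shifted_surj[OF l, of y] by (rule someI_ex)
  have uniq: "x = x'" if "(x, w) \<in> A" "(x', w') \<in> A" "l *\<^sub>R x - \<i> *\<^sub>C w = l *\<^sub>R x' - \<i> *\<^sub>C w'" for x w x' w'
  proof -
    have "\<bar>l\<bar> * norm (x - x') \<le> norm (l *\<^sub>R (x - x') - \<i> *\<^sub>C (w - w'))"
      by (rule norm_shifted_ge(1)[OF diff[OF that(1,2)]])
    also have "l *\<^sub>R (x - x') - \<i> *\<^sub>C (w - w') = 0"
      using that(3) by (simp add: scaleR_diff_right scaleC_minus_right algebra_simps)
    finally show ?thesis using l by (simp add: mult_le_0_iff)
  qed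
  have fI: "?f y = x" if "(x, w) \<in> A" "l *\<^sub>R x - \<i> *\<^sub>C w = y" for x w y
  proof -
    obtain w' where "(?f y, w') \<in> A" "l *\<^sub>R ?f y - \<i> *\<^sub>C w' = y" using f[of y] by blast
    then show ?thesis using uniq[of "?f y" w' x w] that by simp
  qed
  have "ap (res l) = ?f"
    unfolding res_def
  proof (rule ap_mk_op[where K = "1 / \<bar>l\<bar>"])
    fix x y
    obtain v where v: "(?f x, v) \<in> A" "l *\<^sub>R ?f x - \<i> *\<^sub>C v = x" using f[of x] by blast
    obtain v' where v': "(?f y, v') \<in> A" "l *\<^sub>R ?f y - \<i> *\<^sub>C v' = y" using f[of y] by blast
    note uv = v v'
    show "?f (x + y) = ?f x + ?f y"
    proof (rule fI[OF add[OF uv(1,3)]])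
      have "l *\<^sub>R (?f x + ?f y) - \<i> *\<^sub>C (v + v') = (l *\<^sub>R ?f x - \<i> *\<^sub>C v) + (l *\<^sub>R ?f y - \<i> *\<^sub>C v')"
        by (simp add: scaleR_add_right scaleC_add_right)
      then show "l *\<^sub>R (?f x + ?f y) - \<i> *\<^sub>C (v + v') = x + y" by (simp only: uv)
    qed
    show "?f (c *\<^sub>C x) = c *\<^sub>C ?f x" for c
    proof (rule fI[OF scale[OF uv(1)]])
      have "l *\<^sub>R (c *\<^sub>C ?f x) - \<i> *\<^sub>C (c *\<^sub>C v) = c *\<^sub>C (l *\<^sub>R ?f x - \<i> *\<^sub>C v)"
        by (simp add: scaleC_minus_right scaleR_scaleC scaleC_scaleC mult.commute)
      then show "l *\<^sub>R (c *\<^sub>C ?f x) - \<i> *\<^sub>C (c *\<^sub>C v) = c *\<^sub>C x" by (simp only: uv)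
    qed
    have "\<bar>l\<bar> * norm (?f x) \<le> norm x" using norm_shifted_ge(1)[OF uv(1), of l] unfolding uv(2) .
    then show "norm (?f x) \<le> 1 / \<bar>l\<bar> * norm x" using l by (simp add: field_simps)
  qed
  then show ?thesis using f[of y] by simp
qed

lemma res_eq:
  assumes l: "l \<noteq> 0" and xw: "(x, w) \<in> A"
  shows "ap (res l) (l *\<^sub>R x - \<i> *\<^sub>C w) = x"
proof -
  let ?y = "l *\<^sub>R x - \<i> *\<^sub>C w"
  obtain v where v: "(ap (res l) ?y, v) \<in> A" "l *\<^sub>R ap (res l) ?y - \<i> *\<^sub>C v = ?y"
    using res_exists[OF l] by blast
  have "\<bar>l\<bar> * norm (ap (res l) ?y - x) \<le> norm (l *\<^sub>R (ap (res l) ?y - x) - \<i> *\<^sub>C (v - w))"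
    by (rule norm_shifted_ge(1)[OF diff[OF v(1) xw]])
  also have "l *\<^sub>R (ap (res l) ?y - x) - \<i> *\<^sub>C (v - w) = (l *\<^sub>R ap (res l) ?y - \<i> *\<^sub>C v) - ?y"
    by (simp add: scaleR_diff_right scaleC_minus_right)
  also have "\<dots> = 0" unfolding v(2) by simp
  finally show ?thesis using l by (simp add: mult_le_0_iff)
qed

lemma norm_res: "l \<noteq> 0 \<Longrightarrow> norm (ap (res l) y) \<le> norm y / \<bar>l\<bar>"
proof -
  assume l: "l \<noteq> 0"
  obtain w where w: "(ap (res l) y, w) \<in> A" "l *\<^sub>R ap (res l) y - \<i> *\<^sub>C w = y"
    using res_exists[OF l] by blast
  have "\<bar>l\<bar> * norm (ap (res l) y) \<le> norm y"
    using norm_shifted_ge(1)[OF w(1), of l] unfolding w(2) .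
  then show ?thesis using l by (simp add: field_simps)
qed

lemma res_adjoint:
  assumes l: "l \<noteq> 0"
  shows "cinner (ap (res l) x) y = - cinner x (ap (res (- l)) y)"
proof -
  let ?u = "ap (res l) x" and ?v = "ap (res (- l)) y"
  obtain w where w: "(?u, w) \<in> A" "l *\<^sub>R ?u - \<i> *\<^sub>C w = x" using res_exists[OF l] by blast
  obtain q where q: "(?v, q) \<in> A" "(- l) *\<^sub>R ?v - \<i> *\<^sub>C q = y" using res_exists[of "- l"] l by force
  have "cinner ?u y = cinner ?u ((- l) *\<^sub>R ?v - \<i> *\<^sub>C q)" by (simp only: q)
  also have "\<dots> = - (l *\<^sub>R cinner ?u ?v + \<i> * cinner w ?v)"
    using symm[OF w(1) q(1)]
    by (simp add: cinner.diff_right cinner.scaleR_right cinner_scaleC_right cinner.minus_right)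
  also have "\<dots> = - cinner (l *\<^sub>R ?u - \<i> *\<^sub>C w) ?v"
    by (simp add: cinner.diff_left cinner.scaleR_left cinner_scaleC_left)
  finally show ?thesis by (simp only: w)
qed

text \<open>The resolvent identity, used in both orders.\<close>

lemma res_commute:
  assumes l: "l \<noteq> 0" and m: "m \<noteq> 0"
  shows "res l * res m = res m * res l"
proof -
  have id: "ap (res l) y + (l - m) *\<^sub>R ap (res l) (ap (res m) y) = ap (res m) y"
    if l: "l \<noteq> 0" and m: "m \<noteq> 0" for l m y
  proof -
    obtain w where w: "(ap (res m) y, w) \<in> A" "m *\<^sub>R ap (res m) y - \<i> *\<^sub>C w = y"
      using res_exists[OF m] by blast
    have "l *\<^sub>R ap (res m) y - \<i> *\<^sub>C w = (m *\<^sub>R ap (res m) y - \<i> *\<^sub>C w) + (l - m) *\<^sub>R ap (res m) y"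
      by (simp add: scaleR_diff_left)
    then have "ap (res l) (y + (l - m) *\<^sub>R ap (res m) y) = ap (res m) y"
      using res_eq[OF l w(1)] by (simp only: w)
    then show ?thesis by (simp add: ap.add_right ap.scaleR_right)
  qed
  show ?thesis
  proof (cases "l = m")
    case False
    have "ap (res l * res m) y = ap (res m * res l) y" for y
    proof -
      have "(l - m) *\<^sub>R ap (res l) (ap (res m) y) + (m - l) *\<^sub>R ap (res m) (ap (res l) y) = 0"
      proof -
        have "(l - m) *\<^sub>R ap (res l) (ap (res m) y) = ap (res m) y - ap (res l) y"
          using id[OF l m, of y] by (metis add_diff_cancel_left')
        moreover have "(m - l) *\<^sub>R ap (res m) (ap (res l) y) = ap (res l) y - ap (res m) y"
          using id[OF m l, of y] by (metis add_diff_cancel_left')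
        ultimately show ?thesis by (simp only:) simp
      qed
      then have "(l - m) *\<^sub>R (ap (res l) (ap (res m) y) - ap (res m) (ap (res l) y)) = 0"
        by (simp add: algebra_simps)
      then show ?thesis using False by simp
    qed
    then show ?thesis by (rule op_eqI)
  qed simp
qed

text \<open>\<open>yosida n\<close> is \<open>l\<^sup>2 B / (l\<^sup>2 - B\<^sup>2)\<close> with \<open>B = i A\<close> and \<open>l = n + 1\<close>: a bounded skew-adjoint
  operator that tends to \<open>B\<close> on the domain of \<open>A\<close>.\<close>

definition yosida :: "nat \<Rightarrow> 'a op" where
  "yosida n = ((real (Suc n))\<^sup>2 / 2) *\<^sub>R (res (real (Suc n)) + res (- real (Suc n)))"

lemma yosida_commute: "yosida m * yosida n = yosida n * yosida m"
proof -
  have "(res l + res (- l)) * (res k + res (- k)) = (res k + res (- k)) * (res l + res (- l))"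
    if "l \<noteq> 0" "k \<noteq> 0" for l k
    using that res_commute[of l k] res_commute[of l "- k"] res_commute[of "- l" k] res_commute[of "- l" "- k"]
    by (simp add: distrib_left distrib_right add_ac)
  from this[of "real (Suc m)" "real (Suc n)"] show ?thesis
    unfolding yosida_def mult_scaleR_left mult_scaleR_right
    by (simp only: scaleR_left_commute of_nat_eq_0_iff nat.distinct simp_thms)
qed

lemma skew_yosida: "skew (yosida n)"
proof -
  let ?l = "real (Suc n)"
  have "inner (ap (res ?l + res (- ?l)) x) x = 0" for x
  proof -
    have "inner (ap (res ?l) x) x = - inner x (ap (res (- ?l)) x)"
      using res_adjoint[of ?l x x] by (simp add: inner_eq_Re_cinner del: of_nat_Suc)
    then show ?thesis by (simp add: ap.add_left inner_add_left inner_commute[of x] del: of_nat_Suc)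
  qed
  then show ?thesis by (simp add: skew_def yosida_def ap.scaleR_left)
qed

lemma yosida_apply:
  assumes "(x, w) \<in> A"
  shows "ap (yosida n) x =
    (real (Suc n) / 2) *\<^sub>R (ap (res (real (Suc n))) (\<i> *\<^sub>C w) - ap (res (- real (Suc n))) (\<i> *\<^sub>C w))"
proof -
  let ?l = "real (Suc n)"
  have neg: "p = - x - q" if "- p - q = x" for p q x :: 'a using that by auto
  have "ap (res ?l) (?l *\<^sub>R x - \<i> *\<^sub>C w) = x" by (rule res_eq[OF _ assms]) simp
  then have 1: "?l *\<^sub>R ap (res ?l) x = x + ap (res ?l) (\<i> *\<^sub>C w)"
    by (simp add: ap.diff_right ap.scaleR_right algebra_simps del: of_nat_Suc)
  have "ap (res (- ?l)) ((- ?l) *\<^sub>R x - \<i> *\<^sub>C w) = x" by (rule res_eq[OF _ assms]) simp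
  then have 2: "?l *\<^sub>R ap (res (- ?l)) x = - x - ap (res (- ?l)) (\<i> *\<^sub>C w)"
    using neg[of "?l *\<^sub>R ap (res (- ?l)) x" "ap (res (- ?l)) (\<i> *\<^sub>C w)" x]
    by (simp add: ap.diff_right ap.minus_right ap.scaleR_right del: of_nat_Suc)
  have "ap (yosida n) x = (?l / 2) *\<^sub>R (?l *\<^sub>R ap (res ?l) x + ?l *\<^sub>R ap (res (- ?l)) x)"
    by (simp add: yosida_def ap.scaleR_left ap.add_left scaleR_add_right power2_eq_square del: of_nat_Suc)
  also have "\<dots> = (?l / 2) *\<^sub>R (ap (res ?l) (\<i> *\<^sub>C w) - ap (res (- ?l)) (\<i> *\<^sub>C w))"
    unfolding 1 2 by simp
  finally show ?thesis .
qed

lemma half_diff_res_bound: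
  "norm ((real (Suc n) / 2) *\<^sub>R (ap (res (real (Suc n))) v - ap (res (- real (Suc n))) v)) \<le> norm v"
proof -
  let ?l = "real (Suc n)"
  have "norm (ap (res ?l) v - ap (res (- ?l)) v) \<le> norm v / ?l + norm v / ?l"
    using norm_res[of ?l v] norm_res[of "- ?l" v]
    by (intro order_trans[OF norm_triangle_ineq4] add_mono) (simp_all del: of_nat_Suc)
  then have "?l / 2 * norm (ap (res ?l) v - ap (res (- ?l)) v) \<le> ?l / 2 * (norm v / ?l + norm v / ?l)"
    by (intro mult_left_mono) auto
  also have "\<dots> = norm v" by (simp del: of_nat_Suc)
  finally show ?thesis by (simp del: of_nat_Suc)
qed

lemma domain_approx:
  assumes "e > 0"
  obtains x w where "(x, w) \<in> A" "norm (x - v) < e"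
proof -
  have "v \<in> closure (Domain A)" using dense_domain by simp
  then obtain x where "x \<in> Domain A" "dist x v < e" using assms closure_approachable by blast
  then show ?thesis using that by (auto simp: dist_norm)
qed

text \<open>On the domain, \<open>yosida n\<close> is \<open>J\<^sub>n B\<close> with contractions \<open>J\<^sub>n\<close> built from the resolvents. These tend
  to the identity on the domain at the rate \<open>1 / n\<close>, and by density everywhere.\<close>

lemma yosida_tendsto:
  assumes "(x, w) \<in> A"
  shows "(\<lambda>n. ap (yosida n) x) \<longlonglongrightarrow> \<i> *\<^sub>C w"
proof -
  let ?J = "\<lambda>n v. (real (Suc n) / 2) *\<^sub>R (ap (res (real (Suc n))) v - ap (res (- real (Suc n))) v)"
  have J: "?J n (u - v) = ?J n u - ?J n v" for n u v
    by (simp add: ap.diff_right scaleR_diff_right algebra_simps del: of_nat_Suc)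
  have neg: "p = - x - q" if "- p - q = x" for p q x :: 'a using that by auto
  have dom: "norm (?J n v - v) \<le> norm q / real (Suc n)" if vq: "(v, q) \<in> A" for n v q
  proof -
    let ?l = "real (Suc n)"
    have "ap (res ?l) (?l *\<^sub>R v - \<i> *\<^sub>C q) = v" by (rule res_eq[OF _ vq]) simp
    then have 1: "?l *\<^sub>R ap (res ?l) v = v + ap (res ?l) (\<i> *\<^sub>C q)"
      by (simp add: ap.diff_right ap.scaleR_right algebra_simps del: of_nat_Suc)
    have "ap (res (- ?l)) ((- ?l) *\<^sub>R v - \<i> *\<^sub>C q) = v" by (rule res_eq[OF _ vq]) simp
    then have 2: "?l *\<^sub>R ap (res (- ?l)) v = - v - ap (res (- ?l)) (\<i> *\<^sub>C q)"
      using neg[of "?l *\<^sub>R ap (res (- ?l)) v" "ap (res (- ?l)) (\<i> *\<^sub>C q)" v]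
      by (simp add: ap.diff_right ap.minus_right ap.scaleR_right del: of_nat_Suc)
    have "?J n v = (1 / 2) *\<^sub>R (?l *\<^sub>R ap (res ?l) v - ?l *\<^sub>R ap (res (- ?l)) v)"
      by (simp add: scaleR_diff_right del: of_nat_Suc)
    also have "\<dots> = (1 / 2) *\<^sub>R (v + v) + (1 / 2) *\<^sub>R (ap (res ?l) (\<i> *\<^sub>C q) + ap (res (- ?l)) (\<i> *\<^sub>C q))"
      unfolding 1 2 scaleR_add_right[symmetric] by simp
    also have "(1 / 2) *\<^sub>R (v + v) = v" by (simp add: scaleR_2[symmetric])
    finally have "?J n v - v = (1 / 2) *\<^sub>R (ap (res ?l) (\<i> *\<^sub>C q) + ap (res (- ?l)) (\<i> *\<^sub>C q))" by simp
    then have "norm (?J n v - v) = norm (ap (res ?l) (\<i> *\<^sub>C q) + ap (res (- ?l)) (\<i> *\<^sub>C q)) / 2"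
      by (simp del: of_nat_Suc)
    also have "\<dots> \<le> (norm q / ?l + norm q / ?l) / 2"
      using norm_res[of ?l "\<i> *\<^sub>C q"] norm_res[of "- ?l" "\<i> *\<^sub>C q"]
      by (intro divide_right_mono order_trans[OF norm_triangle_ineq] add_mono)
        (simp_all add: norm_scaleC del: of_nat_Suc)
    finally show ?thesis by (simp del: of_nat_Suc)
  qed
  have "(\<lambda>n. ?J n v) \<longlonglongrightarrow> v" for v
  proof (rule LIMSEQ_I)
    fix e :: real assume e: "e > 0"
    obtain u q where uq: "(u, q) \<in> A" "norm (u - v) < e / 4" using domain_approx[of "e / 4"] e by auto
    obtain N where N: "norm q / (e / 4) < real N" using reals_Archimedean2 by blast
    have "norm (?J n v - v) < e" if "n \<ge> N" for n
    proof -
      have "norm q / (e / 4) < real (Suc n)" using N that by linarith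
      then have "norm q / real (Suc n) < e / 4" using e by (simp add: field_simps)
      then have 1: "norm (?J n u - u) < e / 4" using dom[OF uq(1), of n] by linarith
      have "?J n v - v = (?J n u - u) - ?J n (u - v) + (u - v)" unfolding J by simp
      also have "norm \<dots> \<le> norm (?J n u - u) + norm (?J n (u - v)) + norm (u - v)"
        by (intro order_trans[OF norm_triangle_ineq] add_right_mono norm_triangle_ineq4)
      finally show ?thesis using 1 half_diff_res_bound[of n "u - v"] uq(2) e by linarith
    qed
    then show "\<exists>N. \<forall>n\<ge>N. norm (?J n v - v) < e" by blast
  qed
  then show ?thesis by (simp only: yosida_apply[OF assms])
qed

definition apx :: "nat \<Rightarrow> real \<Rightarrow> 'a op" where
  "apx n t = exp (t *\<^sub>R yosida n)"

lemma norm_apx [simp]: "norm (ap (apx n t) x) = norm x"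
  unfolding apx_def by (rule norm_exp_skew[OF skew_yosida])

text \<open>The approximants commute, so the quotient of two of the groups is the group of the difference
  of the generators.\<close>

lemma apx_diff: "norm (ap (apx n t) x - ap (apx m t) x) \<le> norm (ap (yosida n) x - ap (yosida m) x) * \<bar>t\<bar>"
proof -
  let ?Z = "yosida n - yosida m"
  have "t *\<^sub>R yosida n = t *\<^sub>R yosida m + t *\<^sub>R ?Z" by (simp add: scaleR_diff_right)
  moreover have "(t *\<^sub>R yosida m) * (t *\<^sub>R ?Z) = (t *\<^sub>R ?Z) * (t *\<^sub>R yosida m)"
    by (simp add: algebra_simps yosida_commute)
  ultimately have "apx n t = apx m t * exp (t *\<^sub>R ?Z)"
    unfolding apx_def by (simp only: exp_add_commuting)
  then have "ap (apx n t) x - ap (apx m t) x = ap (apx m t) (ap (exp (t *\<^sub>R ?Z)) x - x)"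
    by (simp add: ap.diff_right)
  then have "norm (ap (apx n t) x - ap (apx m t) x) = norm (ap (exp (t *\<^sub>R ?Z)) x - x)" by simp
  also have "\<dots> \<le> norm (ap ?Z x) * \<bar>t\<bar>"
    by (rule norm_exp_skew_minus_one[OF skew_diff[OF skew_yosida skew_yosida]])
  finally show ?thesis by (simp add: ap.diff_left)
qed

lemma apx_Cauchy: "Cauchy (\<lambda>n. ap (apx n t) x)"
proof (rule CauchyI)
  fix e :: real assume e: "e > 0"
  obtain u w where u: "(u, w) \<in> A" "norm (u - x) < e / 3" using domain_approx[of "e / 3"] e by auto
  have "Cauchy (\<lambda>n. ap (yosida n) u)" using yosida_tendsto[OF u(1)] convergent_Cauchy convergent_def by blast
  then obtain N where N: "\<And>i j. i \<ge> N \<Longrightarrow> j \<ge> N \<Longrightarrow> norm (ap (yosida i) u - ap (yosida j) u) < e / 3 / (\<bar>t\<bar> + 1)"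
    using CauchyD[of "\<lambda>n. ap (yosida n) u" "e / 3 / (\<bar>t\<bar> + 1)"] e by (auto simp: add_nonneg_pos)
  have "norm (ap (apx i t) x - ap (apx j t) x) < e" if "i \<ge> N" "j \<ge> N" for i j
  proof -
    have "norm (ap (apx i t) u - ap (apx j t) u) \<le> e / 3 / (\<bar>t\<bar> + 1) * \<bar>t\<bar>"
      using N[OF that] by (intro order_trans[OF apx_diff] mult_right_mono) auto
    also have "\<dots> \<le> e / 3 / (\<bar>t\<bar> + 1) * (\<bar>t\<bar> + 1)" using e by (intro mult_left_mono) auto
    also have "\<dots> = e / 3" by (rule divide_succ_mult_cancel) simp
    finally have 1: "norm (ap (apx i t) u - ap (apx j t) u) \<le> e / 3" .
    have "ap (apx i t) x - ap (apx j t) x =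
        (ap (apx i t) u - ap (apx j t) u) - ap (apx i t) (u - x) + ap (apx j t) (u - x)"
      by (simp add: ap.diff_right)
    also have "norm \<dots> \<le> norm (ap (apx i t) u - ap (apx j t) u) + norm (ap (apx i t) (u - x)) + norm (ap (apx j t) (u - x))"
      by (intro order_trans[OF norm_triangle_ineq] add_right_mono norm_triangle_ineq4)
    finally show ?thesis using 1 u(2) by simp
  qed
  then show "\<exists>M. \<forall>m\<ge>M. \<forall>n\<ge>M. norm (ap (apx m t) x - ap (apx n t) x) < e" by blast
qed

definition grp :: "real \<Rightarrow> 'a op" where
  "grp t = mk_op (\<lambda>x. lim (\<lambda>n. ap (apx n t) x))"

lemma grp_lim: "(\<lambda>n. ap (apx n t) x) \<longlonglongrightarrow> ap (grp t) x"
proof -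
  let ?f = "\<lambda>x. lim (\<lambda>n. ap (apx n t) x)"
  have l: "(\<lambda>n. ap (apx n t) x) \<longlonglongrightarrow> ?f x" for x
    using apx_Cauchy Cauchy_convergent convergent_LIMSEQ_iff by blast
  have "ap (grp t) = ?f"
    unfolding grp_def
  proof (rule ap_mk_op[where K = 1])
    fix x y :: 'a and c
    show "?f (x + y) = ?f x + ?f y"
      by (rule limI) (simp only: ap.add_right, intro tendsto_add l)
    show "?f (c *\<^sub>C x) = c *\<^sub>C ?f x"
      by (rule limI) (simp only: ap_scaleC, intro bounded_linear.tendsto[OF bounded_linear_scaleC] l)
    show "norm (?f x) \<le> 1 * norm x"
      by (rule LIMSEQ_le_const2[OF tendsto_norm[OF l]]) simp
  qed
  then show ?thesis using l by simp
qed

lemma norm_grp [simp]: "norm (ap (grp t) x) = norm x"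
  using tendsto_norm[OF grp_lim[of t x]] by (simp add: LIMSEQ_const_iff)

lemma grp_add: "grp (s + t) = grp s * grp t"
proof (rule op_eqI)
  fix x
  have apx_add: "apx n (s + t) = apx n s * apx n t" for n
    unfolding apx_def scaleR_add_left by (rule exp_add_commuting) simp
  have "(\<lambda>n. ap (apx n s) (ap (apx n t) x - ap (grp t) x)) \<longlonglongrightarrow> 0"
    by (rule tendsto_norm_zero_cancel) (simp add: LIM_zero[OF grp_lim] tendsto_norm_zero)
  from tendsto_add[OF this grp_lim[of s "ap (grp t) x"]]
  have "(\<lambda>n. ap (apx n (s + t)) x) \<longlonglongrightarrow> ap (grp s) (ap (grp t) x)"
    by (simp add: apx_add ap.diff_right)
  then show "ap (grp (s + t)) x = ap (grp s * grp t) x"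
    using grp_lim[of "s + t" x] LIMSEQ_unique by simp
qed

lemma grp_0: "grp 0 = 1"
  by (rule op_eqI, rule LIMSEQ_unique[OF grp_lim]) (simp add: apx_def)

lemma grp_lipschitz:
  assumes "(x, w) \<in> A"
  shows "norm (ap (grp t) x - ap (grp s) x) \<le> norm w * \<bar>t - s\<bar>"
proof (rule LIMSEQ_le)
  show "(\<lambda>n. norm (ap (apx n t) x - ap (apx n s) x)) \<longlonglongrightarrow> norm (ap (grp t) x - ap (grp s) x)"
    by (intro tendsto_norm tendsto_diff grp_lim)
  have "(\<lambda>n. norm (ap (yosida n) x) * \<bar>t - s\<bar>) \<longlonglongrightarrow> norm (\<i> *\<^sub>C w) * \<bar>t - s\<bar>"
    by (intro tendsto_mult tendsto_norm tendsto_const yosida_tendsto assms)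
  then show "(\<lambda>n. norm (ap (yosida n) x) * \<bar>t - s\<bar>) \<longlonglongrightarrow> norm w * \<bar>t - s\<bar>" by (simp add: norm_scaleC)
  show "\<exists>N. \<forall>n\<ge>N. norm (ap (apx n t) x - ap (apx n s) x) \<le> norm (ap (yosida n) x) * \<bar>t - s\<bar>"
    using norm_exp_skew_diff[OF skew_yosida] by (auto simp: apx_def)
qed

lemma grp_continuous: "continuous_on UNIV (\<lambda>t. ap (grp t) x)"
  unfolding continuous_on_iff
proof (intro ballI allI impI)
  fix s :: real and e :: real assume e: "e > 0"
  obtain u w where u: "(u, w) \<in> A" "norm (u - x) < e / 3" using domain_approx[of "e / 3"] e by auto
  define d where "d = e / 3 / (norm w + 1)"
  have dpos: "d > 0" using e by (simp add: d_def add_nonneg_pos)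
  have "dist (ap (grp t) x) (ap (grp s) x) < e" if "dist t s < d" for t
  proof -
    have "norm (ap (grp t) u - ap (grp s) u) \<le> norm w * d"
      using that by (intro order_trans[OF grp_lipschitz[OF u(1)]] mult_left_mono) (auto simp: dist_real_def)
    also have "\<dots> \<le> (norm w + 1) * d" using dpos by (intro mult_right_mono) auto
    also have "\<dots> = e / 3"
      unfolding d_def by (subst mult.commute, rule divide_succ_mult_cancel) simp
    finally have 1: "norm (ap (grp t) u - ap (grp s) u) \<le> e / 3" .
    have "ap (grp t) x - ap (grp s) x =
        (ap (grp t) u - ap (grp s) u) - ap (grp t) (u - x) + ap (grp s) (u - x)"
      by (simp add: ap.diff_right)
    also have "norm \<dots> \<le> norm (ap (grp t) u - ap (grp s) u) + norm (ap (grp t) (u - x)) + norm (ap (grp s) (u - x))"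
      by (intro order_trans[OF norm_triangle_ineq] add_right_mono norm_triangle_ineq4)
    finally show ?thesis using 1 u(2) by (simp add: dist_norm)
  qed
  then show "\<exists>d>0. \<forall>t\<in>UNIV. dist t s < d \<longrightarrow> dist (ap (grp t) x) (ap (grp s) x) < e" using dpos by blast
qed

lemma unitary_group_grp: "unitary_group (\<lambda>t. op_blinfun (grp t))"
proof -
  have ap: "blinfun_apply (op_blinfun (grp t)) x = ap (grp t) x" for t x by (simp add: ap.rep_eq)
  have "surj (ap (grp t))" for t
  proof (rule surjI)
    show "ap (grp t) (ap (grp (- t)) x) = x" for x
      using grp_add[of t "- t"] by (metis ap_mult ap_one add.right_inverse grp_0)
  qed
  moreover have "cinner (ap (grp t) x) (ap (grp t) y) = cinner x y" for t x y
    by (rule norm_preserving_cinner) (simp_all add: ap.add_right ap_scaleC)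
  ultimately show ?thesis
    unfolding unitary_group_def ap
    by (auto simp: op_blinfun grp_0 grp_add one_op.rep_eq times_op.rep_eq grp_continuous ap[abs_def])
qed

text \<open>The vector \<open>i w\<close> need not lie in the domain; \<open>u\<close> is a substitute for it from the domain, along
  which the group moves with bounded speed.\<close>

lemma grp_difference_quotient:
  assumes xw: "(x, w) \<in> A" and uq: "(u, q) \<in> A"
  shows "norm (ap (grp t) x - x - t *\<^sub>R (\<i> *\<^sub>C w)) \<le> \<bar>t\<bar> * (\<bar>t\<bar> * norm q + 2 * norm (\<i> *\<^sub>C w - u))"
proof (rule LIMSEQ_le)
  let ?v = "\<i> *\<^sub>C w"
  show "(\<lambda>n. norm (ap (apx n t) x - x - t *\<^sub>R ap (yosida n) x)) \<longlonglongrightarrow>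
      norm (ap (grp t) x - x - t *\<^sub>R ?v)"
    by (intro tendsto_intros grp_lim yosida_tendsto xw)
  let ?B = "\<lambda>n. \<bar>t\<bar> * (\<bar>t\<bar> * norm (ap (yosida n) u) + 2 * norm (ap (yosida n) x - u))"
  have "?B \<longlonglongrightarrow> \<bar>t\<bar> * (\<bar>t\<bar> * norm (\<i> *\<^sub>C q) + 2 * norm (?v - u))"
    by (intro tendsto_intros yosida_tendsto xw uq)
  then show "?B \<longlonglongrightarrow> \<bar>t\<bar> * (\<bar>t\<bar> * norm q + 2 * norm (?v - u))" by (simp add: norm_scaleC)
  have "norm (ap (apx n t) x - x - t *\<^sub>R ap (yosida n) x) \<le> ?B n" for n
  proof -
    let ?Y = "yosida n"
    have bound: "norm (ap (exp (s *\<^sub>R ?Y)) (ap ?Y x) - ap ?Y x) \<le>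
        \<bar>t\<bar> * norm (ap ?Y u) + 2 * norm (ap ?Y x - u)" if "\<bar>s\<bar> \<le> \<bar>t\<bar>" for s
    proof -
      have "ap (exp (s *\<^sub>R ?Y)) (ap ?Y x) - ap ?Y x =
          (ap (exp (s *\<^sub>R ?Y)) u - u) + ap (exp (s *\<^sub>R ?Y)) (ap ?Y x - u) - (ap ?Y x - u)"
        by (simp add: ap.diff_right)
      also have "norm \<dots> \<le> norm (ap (exp (s *\<^sub>R ?Y)) u - u) + norm (ap (exp (s *\<^sub>R ?Y)) (ap ?Y x - u)) + norm (ap ?Y x - u)"
        by (intro order_trans[OF norm_triangle_ineq4] add_right_mono norm_triangle_ineq)
      also have "norm (ap (exp (s *\<^sub>R ?Y)) u - u) \<le> norm (ap ?Y u) * \<bar>t\<bar>"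
        by (rule order_trans[OF norm_exp_skew_minus_one[OF skew_yosida]]) (use that in \<open>simp add: mult_left_mono\<close>)
      also have "norm (ap (exp (s *\<^sub>R ?Y)) (ap ?Y x - u)) = norm (ap ?Y x - u)"
        by (rule norm_exp_skew[OF skew_yosida])
      finally show ?thesis by (simp add: mult.commute)
    qed
    have "norm (ap (exp (t *\<^sub>R ?Y)) x - ap (exp (0 *\<^sub>R ?Y)) x - (t - 0) *\<^sub>R ap (exp (0 *\<^sub>R ?Y)) (ap ?Y x))
        \<le> norm (t - 0) * (\<bar>t\<bar> * norm (ap ?Y u) + 2 * norm (ap ?Y x - u))"
    proof (rule vector_differentiable_bound_linearization[where S = "{s. \<bar>s\<bar> \<le> \<bar>t\<bar>}"])
      show "closed_segment 0 t \<subseteq> {s. \<bar>s\<bar> \<le> \<bar>t\<bar>}" by (auto simp: closed_segment_eq_real_ivl split: if_splits)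
      show "norm (ap (exp (s *\<^sub>R ?Y)) (ap ?Y x) - ap (exp (0 *\<^sub>R ?Y)) (ap ?Y x))
          \<le> \<bar>t\<bar> * norm (ap ?Y u) + 2 * norm (ap ?Y x - u)" if "s \<in> {s. \<bar>s\<bar> \<le> \<bar>t\<bar>}" for s
        using bound[of s] that by simp
    qed (auto intro: exp_op_derivative has_vector_derivative_at_within)
    then show ?thesis by (simp add: apx_def)
  qed
  then show "\<exists>N. \<forall>n\<ge>N. norm (ap (apx n t) x - x - t *\<^sub>R ap (yosida n) x) \<le> ?B n" by blast
qed

lemma grp_derivative:
  assumes xw: "(x, w) \<in> A"
  shows "((\<lambda>t. ap (grp t) x) has_vector_derivative \<i> *\<^sub>C w) (at 0)"
  unfolding has_vector_derivative_def has_derivative_at_alt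
proof (intro conjI allI impI)
  show "bounded_linear (\<lambda>h. h *\<^sub>R \<i> *\<^sub>C w)" by (rule bounded_linear_scaleR_left)
  fix e :: real assume e: "e > 0"
  obtain u q where uq: "(u, q) \<in> A" "norm (u - \<i> *\<^sub>C w) < e / 4" using domain_approx[of "e / 4"] e by auto
  define d where "d = e / 2 / (norm q + 1)"
  have dpos: "d > 0" using e by (simp add: d_def add_nonneg_pos)
  have "norm (ap (grp t) x - ap (grp 0) x - (t - 0) *\<^sub>R \<i> *\<^sub>C w) \<le> e * norm (t - 0)" if "norm (t - 0) < d" for t
  proof -
    have "\<bar>t\<bar> * norm q \<le> d * norm q" using that by (intro mult_right_mono) auto
    also have "\<dots> \<le> d * (norm q + 1)" using dpos by (intro mult_left_mono) auto
    also have "\<dots> = e / 2" unfolding d_def by (rule divide_succ_mult_cancel) simp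
    finally have "\<bar>t\<bar> * norm q + 2 * norm (\<i> *\<^sub>C w - u) \<le> e"
      using uq(2) by (simp add: norm_minus_commute)
    then have "\<bar>t\<bar> * (\<bar>t\<bar> * norm q + 2 * norm (\<i> *\<^sub>C w - u)) \<le> \<bar>t\<bar> * e" by (rule mult_left_mono) simp
    then show ?thesis using grp_difference_quotient[OF xw uq(1), of t] by (simp add: grp_0 mult.commute)
  qed
  then show "\<exists>d>0. \<forall>t. norm (t - 0) < d \<longrightarrow>
      norm (ap (grp t) x - ap (grp 0) x - (t - 0) *\<^sub>R \<i> *\<^sub>C w) \<le> e * norm (t - 0)" using dpos by blast
qed

end

lemma generator_symmetric:
  assumes U: "unitary_group U" and "(x, y) \<in> generator U" "(x', y') \<in> generator U"
  shows "cinner x y' = cinner y x'"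
proof -
  have d: "((\<lambda>t. blinfun_apply (U t) x) has_derivative (\<lambda>h. h *\<^sub>R \<i> *\<^sub>C y)) (at 0)"
    "((\<lambda>t. blinfun_apply (U t) x') has_derivative (\<lambda>h. h *\<^sub>R \<i> *\<^sub>C y')) (at 0)"
    using assms by (auto simp: generator_def has_vector_derivative_def)
  have U0: "blinfun_apply (U 0) z = z" for z using U by (simp add: unitary_group_def)
  have "((\<lambda>t. cinner (blinfun_apply (U t) x) (blinfun_apply (U t) x')) has_derivative
      (\<lambda>h. cinner x (h *\<^sub>R \<i> *\<^sub>C y') + cinner (h *\<^sub>R \<i> *\<^sub>C y) x')) (at 0)"
    using cinner.FDERIV[OF d] by (simp add: U0)
  moreover have "(\<lambda>t. cinner (blinfun_apply (U t) x) (blinfun_apply (U t) x')) = (\<lambda>t. cinner x x')"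
    using U by (simp add: unitary_group_def)
  ultimately have "((\<lambda>t::real. cinner x x') has_derivative
      (\<lambda>h. cinner x (h *\<^sub>R \<i> *\<^sub>C y') + cinner (h *\<^sub>R \<i> *\<^sub>C y) x')) (at 0)" by simp
  from has_derivative_unique[OF this has_derivative_const]
  have "cinner x (1 *\<^sub>R \<i> *\<^sub>C y') + cinner (1 *\<^sub>R \<i> *\<^sub>C y) x' = 0" by metis
  then show ?thesis by (simp add: cinner_scaleC_left cinner_scaleC_right)
qed

lemma generator_invariant:
  assumes U: "unitary_group U" and xy: "(x, y) \<in> generator U"
  shows "((\<lambda>t. blinfun_apply (U t) x) has_vector_derivative \<i> *\<^sub>C blinfun_apply (U t) y) (at t)"
    and "(blinfun_apply (U t) x, blinfun_apply (U t) y) \<in> generator U"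
proof -
  have d: "((\<lambda>t. blinfun_apply (U t) x) has_vector_derivative \<i> *\<^sub>C y) (at 0)"
    using xy by (simp add: generator_def)
  have lin: "blinfun_apply (U t) (\<i> *\<^sub>C y) = \<i> *\<^sub>C blinfun_apply (U t) y"
    using U by (auto simp: unitary_group_def bounded_ops_def)
  from bounded_linear.has_vector_derivative[OF blinfun.bounded_linear_right d, of "U t"]
  have d2: "((\<lambda>s. blinfun_apply (U t) (blinfun_apply (U s) x)) has_vector_derivative
      \<i> *\<^sub>C blinfun_apply (U t) y) (at 0)" by (simp add: lin)
  have c: "blinfun_apply (U t) (blinfun_apply (U s) x) = blinfun_apply (U (t + s)) x" for s
    using U by (simp add: unitary_group_def)
  have "((\<lambda>s. s - t) has_vector_derivative 1) (at t)"
    by (auto intro!: derivative_eq_intros)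
  from vector_diff_chain_at[OF this, of "\<lambda>s. blinfun_apply (U (t + s)) x"] d2[unfolded c]
  show "((\<lambda>t. blinfun_apply (U t) x) has_vector_derivative \<i> *\<^sub>C blinfun_apply (U t) y) (at t)"
    by (simp add: o_def)
  have "blinfun_apply (U t) (blinfun_apply (U s) x) = blinfun_apply (U s) (blinfun_apply (U t) x)" for s
    using U by (metis c add.commute blinfun_apply_blinfun_compose unitary_group_def)
  then show "(blinfun_apply (U t) x, blinfun_apply (U t) y) \<in> generator U"
    using d2 by (simp add: generator_def)
qed

lemma unitary_group_isometry:
  assumes "unitary_group U" shows "norm (blinfun_apply (U t) x) = norm x"
  using assms by (simp add: unitary_group_def norm_eq_sqrt_inner inner_eq_Re_cinner)

text \<open>On the common domain \<open>U (- t) (W t x)\<close> has derivative zero, because \<open>W t x\<close> stays in the domain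
  and both groups have the same first-order behaviour there.\<close>

lemma unitary_group_unique:
  assumes U: "unitary_group U" and W: "unitary_group W" and eq: "generator U = generator W"
    and dense: "closure (Domain (generator W)) = UNIV"
  shows "U = W"
proof -
  have UmU: "blinfun_apply (U t) (blinfun_apply (U (- t)) x) = x" for t x
    using U by (metis add.right_inverse blinfun_apply_blinfun_compose id_blinfun.rep_eq id_apply unitary_group_def)
  have dom: "blinfun_apply (U t) x = blinfun_apply (W t) x" if xy: "(x, y) \<in> generator W" for t x y
  proof -
    let ?h = "\<lambda>t. blinfun_apply (U (- t)) (blinfun_apply (W t) x)"
    have "(?h has_vector_derivative 0) (at t)" for t
    proof -
      let ?z = "blinfun_apply (W t) x" and ?q = "blinfun_apply (W t) y"
      have zW: "(?z, ?q) \<in> generator W" using generator_invariant(2)[OF W xy] .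
      then have "((\<lambda>s. blinfun_apply (W s) ?z) has_vector_derivative \<i> *\<^sub>C ?q) (at 0)"
        "((\<lambda>s. blinfun_apply (U s) ?z) has_vector_derivative \<i> *\<^sub>C ?q) (at 0)"
        using eq by (auto simp: generator_def)
      from has_vector_derivative_diff[OF this]
      have d: "((\<lambda>s. blinfun_apply (W s) ?z - blinfun_apply (U s) ?z) has_vector_derivative 0) (at 0)"
        by simp
      have nrm: "norm (?h (t + s) - ?h t) = norm (blinfun_apply (W s) ?z - blinfun_apply (U s) ?z)" for s
      proof -
        have "?h t = blinfun_apply (U (- (t + s))) (blinfun_apply (U s) ?z)"
        proof -
          have "U (- (t + s) + s) = U (- (t + s)) o\<^sub>L U s" using U unfolding unitary_group_def by blast
          then show ?thesis by simp
        qed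
        moreover have "?h (t + s) = blinfun_apply (U (- (t + s))) (blinfun_apply (W s) ?z)"
        proof -
          have "W (s + t) = W s o\<^sub>L W t" using W unfolding unitary_group_def by blast
          then show ?thesis by (simp add: add.commute)
        qed
        ultimately have "?h (t + s) - ?h t =
            blinfun_apply (U (- (t + s))) (blinfun_apply (W s) ?z - blinfun_apply (U s) ?z)"
          by (simp add: blinfun.diff_right)
        then show ?thesis by (simp add: unitary_group_isometry[OF U])
      qed
      have W0: "blinfun_apply (W 0) z = z" "blinfun_apply (U 0) z = z" for z
        using U W by (simp_all add: unitary_group_def)
      show ?thesis
        using d unfolding has_vector_derivative_def has_derivative_at_alt
      proof (elim conjE, intro conjI allI impI)
        fix e :: real
        assume "\<forall>e>0. \<exists>d>0. \<forall>s. norm (s - 0) < d \<longrightarrow>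
            norm (blinfun_apply (W s) ?z - blinfun_apply (U s) ?z - (blinfun_apply (W 0) ?z - blinfun_apply (U 0) ?z)
              - (s - 0) *\<^sub>R 0) \<le> e * norm (s - 0)" "e > 0"
        then obtain d where d: "d > 0" "\<And>s. \<bar>s\<bar> < d \<Longrightarrow>
            norm (blinfun_apply (W s) ?z - blinfun_apply (U s) ?z) \<le> e * \<bar>s\<bar>" by (auto simp: W0)
        have "norm (?h s - ?h t - (s - t) *\<^sub>R 0) \<le> e * norm (s - t)" if "norm (s - t) < d" for s
          using nrm[of "s - t"] d(2)[of "s - t"] that by simp
        then show "\<exists>d>0. \<forall>s. norm (s - t) < d \<longrightarrow> norm (?h s - ?h t - (s - t) *\<^sub>R 0) \<le> e * norm (s - t)"
          using d(1) by blast
      qed simp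
    qed
    from has_vector_derivative_lipschitz[OF this, of 0 t 0] have "?h t = ?h 0" by simp
    then have "?h t = x" using U W by (simp add: unitary_group_def)
    then show ?thesis using UmU by metis
  qed
  show ?thesis
  proof (intro ext blinfun_eqI)
    fix t x
    have "closed {x. blinfun_apply (U t) x = blinfun_apply (W t) x}"
      by (intro closed_Collect_eq continuous_intros)
    moreover have "Domain (generator W) \<subseteq> {x. blinfun_apply (U t) x = blinfun_apply (W t) x}"
      using dom by auto
    ultimately have "closure (Domain (generator W)) \<subseteq> {x. blinfun_apply (U t) x = blinfun_apply (W t) x}"
      by (rule closure_minimal[rotated])
    then show "blinfun_apply (U t) x = blinfun_apply (W t) x" using dense by auto
  qed
qed

text \<open>The limit group has a generator that extends \<open>A\<close> and is symmetric, and a selfadjoint operator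
  has no proper symmetric extension.\<close>

theorem stone:
  fixes A :: "('a::{complex_hilbert,perfect_space} \<times> 'a) set"
  assumes A: "selfadjoint A"
  shows "unitary_group (exp_i A)" "generator (exp_i A) = A"
proof -
  interpret selfadjoint_operator A by unfold_locales (rule A)
  let ?U = "\<lambda>t. op_blinfun (grp t)"
  have sub: "A \<subseteq> generator ?U"
    using grp_derivative by (auto simp: generator_def ap.rep_eq)
  have "generator ?U \<subseteq> A"
  proof clarify
    fix x y assume "(x, y) \<in> generator ?U"
    then show "(x, y) \<in> A"
      unfolding mem_iff using generator_symmetric[OF unitary_group_grp] sub by blast
  qed
  with sub have gen: "generator ?U = A" by blast
  have "exp_i A = ?U"
    unfolding exp_i_def
  proof (rule the_equality)
    show "unitary_group ?U \<and> generator ?U = A" using unitary_group_grp gen by blast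
    show "W = ?U" if "unitary_group W \<and> generator W = A" for W
      by (rule unitary_group_unique) (use that gen unitary_group_grp dense_domain in auto)
  qed
  then show "unitary_group (exp_i A)" "generator (exp_i A) = A" using unitary_group_grp gen by simp_all
qed

section \<open>Fourier series\<close>

lemma circle_integrable_continuous:
  fixes f :: "real \<Rightarrow> complex"
  assumes "continuous_on {0..2 * pi} f"
  shows "integrable circle_measure f"
  unfolding circle_measure_def
  by (subst integrable_restrict_space) (use borel_integrable_compact[OF _ assms] in auto)

lemma circle_measurable_continuous:
  fixes f :: "real \<Rightarrow> complex"
  assumes "continuous_on {0..2 * pi} f"
  shows "f \<in> borel_measurable circle_measure"
  using circle_integrable_continuous[OF assms] by (rule borel_measurable_integrable)

lemma sq_integrable_continuous:
  fixes f :: "real \<Rightarrow> complex"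
  assumes f: "continuous_on {0..2 * pi} f"
  shows "sq_integrable circle_measure f"
proof -
  have "integrable circle_measure (\<lambda>x. f x * cnj (f x))"
    by (rule circle_integrable_continuous) (intro continuous_intros f)
  then have "integrable circle_measure (\<lambda>x. complex_of_real ((cmod (f x))\<^sup>2))"
    by (simp only: complex_norm_square)
  from integrable_Re[OF this] have "integrable circle_measure (\<lambda>x. (cmod (f x))\<^sup>2)" by simp
  then show ?thesis using circle_measurable_continuous[OF f] by (simp add: sq_integrable_def)
qed

lemma circle_integral_FTC:
  fixes G :: "real \<Rightarrow> complex"
  assumes "\<And>x. (G has_vector_derivative g x) (at x)" and "continuous_on {0..2 * pi} g"
  shows "(LINT x|circle_measure. g x) = G (2 * pi) - G 0"
proof -
  have "(LINT x|circle_measure. g x) = (LINT x|lborel. indicator {0..2 * pi} x *\<^sub>R g x)"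
    unfolding circle_measure_def by (rule integral_restrict_space) simp
  also have "\<dots> = G (2 * pi) - G 0"
    by (rule integral_FTC_Icc) (use assms in \<open>auto intro: has_vector_derivative_at_within\<close>)
  finally show ?thesis .
qed

definition mode :: "int \<Rightarrow> real \<Rightarrow> complex" where
  "mode n \<alpha> = exp (- \<i> * of_int n * complex_of_real \<alpha>) / sqrt (2 * pi)"

lemma mode_derivative: "(mode n has_vector_derivative (- \<i> * of_int n) * mode n \<alpha>) (at \<alpha>)"
proof -
  have "((\<lambda>z. exp (- \<i> * of_int n * z) / sqrt (2 * pi)) has_field_derivative
      (- \<i> * of_int n) * mode n \<alpha>) (at (complex_of_real \<alpha>))"
    unfolding mode_def by (auto intro!: derivative_eq_intros)
  from has_vector_derivative_real_field[OF this] show ?thesis by (simp add: mode_def[abs_def] o_def)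
qed

lemma continuous_on_mode [continuous_intros]: "continuous_on S (mode n)"
  unfolding mode_def[abs_def] by (intro continuous_intros) auto

lemma cnj_mode: "cnj (mode n \<alpha>) = mode (- n) \<alpha>"
  by (simp add: mode_def exp_cnj)

lemma mode_mult: "mode m \<alpha> * mode n \<alpha> = mode (m + n) \<alpha> / sqrt (2 * pi)"
  by (simp add: mode_def exp_add[symmetric] algebra_simps)

lemma mode_periodic: "mode n (\<alpha> + 2 * pi) = mode n \<alpha>"
proof -
  have "exp (- \<i> * of_int n * complex_of_real (\<alpha> + 2 * pi)) =
      exp (- \<i> * of_int n * complex_of_real \<alpha> + 2 * of_int (- n) * of_real pi * \<i>)"
    by (simp add: algebra_simps)
  also have "\<dots> = exp (- \<i> * of_int n * complex_of_real \<alpha>) * exp (2 * of_int (- n) * of_real pi * \<i>)"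
    by (rule exp_add)
  also have "exp (2 * of_int (- n) * of_real pi * \<i>) = 1"
    using exp_integer_2pi[of "of_int (- n)"] by (simp del: of_int_minus)
  finally show ?thesis by (simp add: mode_def)
qed

lemma sq_integrable_mode: "sq_integrable circle_measure (mode n)"
  by (intro sq_integrable_continuous continuous_intros)

lemma mode_integral: "(LINT \<alpha>|circle_measure. mode n \<alpha>) = (if n = 0 then sqrt (2 * pi) else 0)"
proof (cases "n = 0")
  case True
  have "(LINT \<alpha>|circle_measure. mode 0 \<alpha>) = mode 0 (2 * pi) * of_real (2 * pi) - mode 0 0 * of_real 0"
  proof (rule circle_integral_FTC)
    show "((\<lambda>\<alpha>. mode 0 \<alpha> * complex_of_real \<alpha>) has_vector_derivative mode 0 \<alpha>) (at \<alpha>)" for \<alpha>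
      by (auto simp: mode_def[abs_def] intro!: derivative_eq_intros)
  qed (intro continuous_intros)
  also have "\<dots> = sqrt (2 * pi)"
    by (simp add: mode_def real_div_sqrt flip: of_real_divide of_real_mult)
  finally show ?thesis using True by simp
next
  case False
  have "(LINT \<alpha>|circle_measure. (- \<i> * of_int n) * mode n \<alpha>) = mode n (2 * pi) - mode n 0"
    by (intro circle_integral_FTC mode_derivative continuous_intros)
  also have "\<dots> = 0" using mode_periodic[of n 0] by simp
  finally show ?thesis using False by simp
qed

definition basis_vec :: "int \<Rightarrow> L2_circle" where
  "basis_vec n = L2_class (mode n)"

lemma basis_vec_orthonormal: "cinner (basis_vec m) (basis_vec n) = (if m = n then 1 else 0)"
proof -
  have "cinner (basis_vec m) (basis_vec n) = (LINT \<alpha>|circle_measure. cnj (mode m \<alpha>) * mode n \<alpha>)"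
    by (simp add: basis_vec_def cinner_L2_circle_def L2_class_cinner sq_integrable_mode)
  also have "\<dots> = (LINT \<alpha>|circle_measure. mode (n - m) \<alpha>) / sqrt (2 * pi)"
    by (simp add: cnj_mode mode_mult)
  finally show ?thesis by (simp add: mode_integral)
qed

lemma fourier_infsum: "fourier x = (\<Sum>\<^sub>\<infinity>n. ell2_apply x n *\<^sub>C basis_vec n)"
  by (simp add: fourier_def basis_vec_def mode_def[abs_def])

lemma norm_sum_basis_vec:
  assumes "finite I"
  shows "(norm (\<Sum>n\<in>I. c n *\<^sub>C basis_vec n))\<^sup>2 = (\<Sum>n\<in>I. (cmod (c n))\<^sup>2)"
proof -
  have n1: "norm (basis_vec n) = 1" for n
    by (simp add: norm_eq_sqrt_inner inner_eq_Re_cinner basis_vec_orthonormal)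
  have "(norm (\<Sum>n\<in>I. c n *\<^sub>C basis_vec n))\<^sup>2 = (\<Sum>n\<in>I. (norm (c n *\<^sub>C basis_vec n))\<^sup>2)"
    by (rule norm_sum_Pythagorean[OF assms])
      (auto simp: pairwise_def real_inner_class.orthogonal_def inner_eq_Re_cinner
        cinner_scaleC_left cinner_scaleC_right basis_vec_orthonormal)
  then show ?thesis by (simp add: norm_scaleC n1)
qed

text \<open>The net of finite partial sums is Cauchy: by orthonormality the norm of a block is the
  \<open>l\<^sup>2\<close> norm of its coefficients.\<close>

lemma fourier_has_sum: "((\<lambda>n. ell2_apply x n *\<^sub>C basis_vec n) has_sum fourier x) UNIV"
proof -
  let ?f = "\<lambda>n. ell2_apply x n *\<^sub>C basis_vec n" and ?g = "\<lambda>n. (cmod (ell2_apply x n))\<^sup>2"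
  have "\<exists>P. eventually P (finite_subsets_at_top UNIV) \<and> (\<forall>F G. P F \<and> P G \<longrightarrow> dist (sum ?f F) (sum ?f G) < e)"
    if e: "e > 0" for e
  proof -
    have "(?g has_sum infsum ?g UNIV) UNIV" using ell2_summable by (rule has_sum_infsum)
    then have "\<forall>\<^sub>F F in finite_subsets_at_top UNIV. dist (sum ?g F) (infsum ?g UNIV) < (e / 4)\<^sup>2"
      unfolding has_sum_def tendsto_iff using e by simp
    then obtain F0 where F0: "finite F0" "\<And>F. finite F \<Longrightarrow> F0 \<subseteq> F \<Longrightarrow> dist (sum ?g F) (infsum ?g UNIV) < (e / 4)\<^sup>2"
      unfolding eventually_finite_subsets_at_top by auto
    have tail: "dist (sum ?f F) (sum ?f F0) < e / 2" if F: "finite F" "F0 \<subseteq> F" for F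
    proof -
      have "(norm (sum ?f (F - F0)))\<^sup>2 = sum ?g F - sum ?g F0"
        using F by (subst norm_sum_basis_vec) (auto simp: sum_diff)
      also have "\<dots> < (e / 4)\<^sup>2 + (e / 4)\<^sup>2"
        using F0(2)[OF F] F0(2)[OF F0(1)] unfolding dist_real_def by auto
      also have "\<dots> < (e / 2)\<^sup>2" using e by (simp add: power2_eq_square)
      finally have "norm (sum ?f (F - F0)) < e / 2"
        by (rule power2_less_imp_less) (use e in simp)
      then show ?thesis using F F0(1) by (simp add: dist_norm sum_diff)
    qed
    show ?thesis
    proof (intro exI[of _ "\<lambda>F. finite F \<and> F0 \<subseteq> F"] conjI allI impI)
      show "\<forall>\<^sub>F F in finite_subsets_at_top UNIV. finite F \<and> F0 \<subseteq> F"
        unfolding eventually_finite_subsets_at_top using F0(1) by blast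
      show "dist (sum ?f F) (sum ?f G) < e" if "(finite F \<and> F0 \<subseteq> F) \<and> finite G \<and> F0 \<subseteq> G" for F G
        using that tail[of F] tail[of G] dist_triangle2[of "sum ?f F" "sum ?f G" "sum ?f F0"] by simp
    qed
  qed
  then have "cauchy_filter (filtermap (sum ?f) (finite_subsets_at_top UNIV))"
    by (simp add: cauchy_filter_metric_filtermap)
  moreover have "complete (UNIV :: L2_circle set)"
    by (meson Cauchy_convergent UNIV_I complete_def convergent_def)
  ultimately obtain L where "(sum ?f \<longlongrightarrow> L) (finite_subsets_at_top UNIV)"
    using complete_uniform[where S=UNIV] by (force simp add: filterlim_def)
  then have "?f summable_on UNIV" unfolding summable_on_def has_sum_def by blast
  then show ?thesis unfolding fourier_infsum by (rule has_sum_infsum)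
qed

lemma cinner_basis_fourier: "cinner (basis_vec n) (fourier x) = ell2_apply x n"
proof -
  have "((\<lambda>k. cinner (basis_vec n) (ell2_apply x k *\<^sub>C basis_vec k)) has_sum cinner (basis_vec n) (fourier x)) UNIV"
    using has_sum_bounded_linear[OF cinner.bounded_linear_right fourier_has_sum] by (simp add: o_def)
  then have "cinner (basis_vec n) (fourier x) = (\<Sum>\<^sub>\<infinity>k. cinner (basis_vec n) (ell2_apply x k *\<^sub>C basis_vec k))"
    by (rule infsumI[symmetric])
  also have "\<dots> = (\<Sum>\<^sub>\<infinity>k\<in>{n}. cinner (basis_vec n) (ell2_apply x k *\<^sub>C basis_vec k))"
    by (rule infsum_cong_neutral) (auto simp: cinner_scaleC_right basis_vec_orthonormal)
  finally show ?thesis by (simp add: cinner_scaleC_right basis_vec_orthonormal)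
qed

lemma fourier_add: "fourier (x + y) = fourier x + fourier y"
  using has_sum_add[OF fourier_has_sum[of x] fourier_has_sum[of y]] fourier_has_sum[of "x + y"]
  by (simp add: scaleC_add_left has_sum_unique)

lemma fourier_scaleC: "fourier (c *\<^sub>C x) = c *\<^sub>C fourier x"
  using has_sum_bounded_linear[OF bounded_linear_scaleC fourier_has_sum[of x], of c] fourier_has_sum[of "c *\<^sub>C x"]
  by (simp add: o_def scaleC_scaleC has_sum_unique)

lemma fourier_delta: "fourier (delta n) = basis_vec n"
proof -
  have "fourier (delta n) = (\<Sum>\<^sub>\<infinity>k\<in>{n}. ell2_apply (delta n) k *\<^sub>C basis_vec k)"
    unfolding fourier_infsum by (rule infsum_cong_neutral) auto
  then show ?thesis by (simp add: scaleC_one)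
qed

lemma cinner_fourier: "cinner (fourier x) (fourier y) = cinner x y"
proof -
  have "((\<lambda>n. cinner (ell2_apply x n *\<^sub>C basis_vec n) (fourier y)) has_sum cinner (fourier x) (fourier y)) UNIV"
    using has_sum_bounded_linear[OF cinner.bounded_linear_left fourier_has_sum] by (simp add: o_def)
  then have "cinner (fourier x) (fourier y) = (\<Sum>\<^sub>\<infinity>n. cinner (ell2_apply x n *\<^sub>C basis_vec n) (fourier y))"
    by (rule infsumI[symmetric])
  also have "\<dots> = (\<Sum>\<^sub>\<infinity>n. cnj (ell2_apply x n) * ell2_apply y n)"
    by (simp add: cinner_scaleC_left cinner_basis_fourier)
  finally show ?thesis by (simp add: cinner_ell2_def)
qed

lemma norm_fourier: "norm (fourier x) = norm x"
  by (simp add: norm_eq_sqrt_inner inner_eq_Re_cinner cinner_fourier)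

lemma fourier_diff: "fourier (x - y) = fourier x - fourier y"
  using fourier_add[of "x - y" y] by simp

lemma fourier_inject: "fourier x = fourier y \<longleftrightarrow> x = y"
proof
  assume "fourier x = fourier y"
  then have "norm (x - y) = 0" by (simp add: norm_fourier[symmetric] fourier_diff)
  then show "x = y" by simp
qed simp

inductive trig :: "(real \<Rightarrow> complex) \<Rightarrow> bool" where
  mode: "trig (\<lambda>\<alpha>. c * mode n \<alpha>)"
| add: "trig p \<Longrightarrow> trig q \<Longrightarrow> trig (\<lambda>\<alpha>. p \<alpha> + q \<alpha>)"

lemma trig_mult: "trig p \<Longrightarrow> trig q \<Longrightarrow> trig (\<lambda>\<alpha>. p \<alpha> * q \<alpha>)"
proof (induction p rule: trig.induct)
  case (mode c n)
  from mode.prems show ?case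
  proof (induction q rule: trig.induct)
    case (mode d m)
    have "(\<lambda>\<alpha>. c * mode n \<alpha> * (d * mode m \<alpha>)) = (\<lambda>\<alpha>. (c * d / sqrt (2 * pi)) * mode (n + m) \<alpha>)"
      using mode_mult[of n _ m] by (simp add: fun_eq_iff field_simps)
    then show ?case by (simp only: trig.mode)
  next
    case (add p q)
    then show ?case using trig.add by (simp only: distrib_left)
  qed
next
  case (add p q)
  then show ?case using trig.add by (simp only: distrib_right)
qed

lemma trig_exp: "trig (\<lambda>\<alpha>. c * exp (\<i> * of_int n * complex_of_real \<alpha>))"
proof -
  have "(\<lambda>\<alpha>. c * exp (\<i> * of_int n * complex_of_real \<alpha>)) = (\<lambda>\<alpha>. (c * sqrt (2 * pi)) * mode (- n) \<alpha>)"
    by (simp add: mode_def fun_eq_iff)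
  then show ?thesis by (simp only: trig.mode)
qed

lemma trig_const: "trig (\<lambda>\<alpha>. c)"
  using trig_exp[of c 0] by simp

text \<open>Polynomials in the real and imaginary part of a point \<open>cis \<alpha>\<close> of the unit circle are
  trigonometric polynomials in \<open>\<alpha>\<close>.\<close>

lemma trig_real_polynomial:
  fixes p :: "complex \<Rightarrow> real"
  assumes "real_polynomial_function p"
  shows "trig (\<lambda>\<alpha>. complex_of_real (p (cis \<alpha>)))"
  using assms
proof (induction p rule: real_polynomial_function.induct)
  case (linear f)
  have e: "cis \<alpha> = exp (\<i> * of_int 1 * complex_of_real \<alpha>)"
    "cis (- \<alpha>) = exp (\<i> * of_int (- 1) * complex_of_real \<alpha>)" for \<alpha>
    by (simp_all add: cis_conv_exp)
  have "complex_of_real (f (cis \<alpha>)) =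
      (f 1 / 2 + f \<i> / (2 * \<i>)) * exp (\<i> * of_int 1 * complex_of_real \<alpha>)
      + (f 1 / 2 - f \<i> / (2 * \<i>)) * exp (\<i> * of_int (- 1) * complex_of_real \<alpha>)" for \<alpha>
  proof -
    have "cis \<alpha> = cos \<alpha> *\<^sub>R 1 + sin \<alpha> *\<^sub>R \<i>" by (simp add: complex_eq_iff)
    then have "f (cis \<alpha>) = cos \<alpha> * f 1 + sin \<alpha> * f \<i>"
      using bounded_linear.linear[OF linear] by (simp add: linear_add linear_scale)
    then show ?thesis unfolding e[symmetric] by (simp add: complex_eq_iff)
  qed
  then show ?case by (simp only: trig.add trig_exp)
next
  case (const c)
  show ?case by (rule trig_const)
next
  case (add f g)
  then show ?case using trig.add by simp
next
  case (mult f g)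
  then show ?case using trig_mult by simp
qed

text \<open>A continuous function with equal values at the end points is a loop, hence a continuous function
  on the unit circle, where the theorem of Stone and Weierstrass applies.\<close>

lemma trig_dense:
  fixes h :: "real \<Rightarrow> complex"
  assumes h: "continuous_on {0..2 * pi} h" "h 0 = h (2 * pi)" and e: "e > 0"
  obtains q where "trig q" "\<And>\<alpha>. \<alpha> \<in> {0..2 * pi} \<Longrightarrow> cmod (h \<alpha> - q \<alpha>) < e"
proof -
  define \<gamma> where "\<gamma> x = h (2 * pi * x)" for x
  have "path \<gamma>"
    unfolding path_def \<gamma>_def
    by (rule continuous_on_compose2[OF h(1)]) (auto intro!: continuous_intros)
  then have "homotopic_loops UNIV \<gamma> \<gamma>"
    using h(2) by (simp add: homotopic_loops_refl pathfinish_def pathstart_def \<gamma>_def)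
  then have cont: "continuous_on (sphere 0 1) (\<gamma> \<circ> (\<lambda>z. Arg2pi z / (2 * pi)))"
    using homotopic_loops_imp_homotopic_circlemaps homotopic_with_imp_continuous by blast
  obtain g where g: "polynomial_function g"
    "\<And>z. z \<in> sphere 0 1 \<Longrightarrow> cmod ((\<gamma> \<circ> (\<lambda>z. Arg2pi z / (2 * pi))) z - g z) < e"
    using Stone_Weierstrass_polynomial_function[OF compact_sphere cont e] by blast
  show ?thesis
  proof (rule that[of "\<lambda>\<alpha>. g (cis \<alpha>)"])
    have "real_polynomial_function (Re \<circ> g)" "real_polynomial_function (Im \<circ> g)"
      using g(1) bounded_linear_Re bounded_linear_Im unfolding polynomial_function_def by blast+
    from trig.add[OF trig_real_polynomial[OF this(1)]
        trig_mult[OF trig_const[of \<i>] trig_real_polynomial[OF this(2)]]]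
    show "trig (\<lambda>\<alpha>. g (cis \<alpha>))" by (simp add: complex_eq[symmetric])
    fix \<alpha> assume \<alpha>: "\<alpha> \<in> {0..2 * pi}"
    have "\<gamma> (Arg2pi (cis \<alpha>) / (2 * pi)) = h \<alpha>"
    proof (cases "\<alpha> = 2 * pi")
      case True
      then have "cis \<alpha> = of_real 1" by (simp add: complex_eq_iff)
      then have "Arg2pi (cis \<alpha>) = 0" using Arg2pi_of_real[of 1] by simp
      then show ?thesis using True h(2) by (simp add: \<gamma>_def)
    next
      case False
      then have "Arg2pi (cis \<alpha>) = \<alpha>"
        unfolding cis_conv_exp using \<alpha> by (subst Arg2pi_exp) auto
      then show ?thesis by (simp add: \<gamma>_def)
    qed
    then show "cmod (h \<alpha> - g (cis \<alpha>)) < e" using g(2)[of "cis \<alpha>"] by simp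
  qed
qed

lemma sq_integrable_imp_integrable:
  assumes "sq_integrable circle_measure f" shows "integrable circle_measure f"
  using integrable_cnj_mult[OF sq_integrable_continuous[of "\<lambda>_. 1"] assms] by simp

lemma space_circle: "space circle_measure = {0..2 * pi}"
  by (simp add: circle_measure_def space_restrict_space)

text \<open>A function orthogonal to all modes is orthogonal to the continuous periodic functions, by the
  Weierstrass theorem, and then, by dominated convergence, to its own phase.\<close>

lemma trig_complete:
  assumes f: "sq_integrable circle_measure f"
    and orth: "\<And>n. (LINT \<alpha>|circle_measure. cnj (f \<alpha>) * mode n \<alpha>) = 0"
  shows "AE \<alpha> in circle_measure. f \<alpha> = 0"
proof -
  have fi: "integrable circle_measure f" by (rule sq_integrable_imp_integrable[OF f])
  have [measurable]: "f \<in> borel_measurable circle_measure" using f by (simp add: sq_integrable_def)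
  have "integrable circle_measure (\<lambda>\<alpha>. cnj (f \<alpha>) * q \<alpha>) \<and> (LINT \<alpha>|circle_measure. cnj (f \<alpha>) * q \<alpha>) = 0
      \<and> sq_integrable circle_measure q" if "trig q" for q
    using that
  proof induction
    case (mode c n)
    have "sq_integrable circle_measure (\<lambda>\<alpha>. c * mode n \<alpha>)"
      by (rule sq_integrable_cmult[OF sq_integrable_mode])
    moreover have "(LINT \<alpha>|circle_measure. cnj (f \<alpha>) * (c * mode n \<alpha>)) = 0"
      using orth[of n] by (simp add: mult.left_commute)
    ultimately show ?case using integrable_cnj_mult[OF f] by blast
  next
    case (add p q)
    then show ?case by (simp add: distrib_left sq_integrable_add)
  qed
  then have orth_trig: "trig q \<Longrightarrow> (LINT \<alpha>|circle_measure. cnj (f \<alpha>) * q \<alpha>) = 0"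
    "trig q \<Longrightarrow> integrable circle_measure (\<lambda>\<alpha>. cnj (f \<alpha>) * q \<alpha>)" for q by blast+
  have orth_cont: "(LINT \<alpha>|circle_measure. cnj (f \<alpha>) * h \<alpha>) = 0"
    if h: "continuous_on {0..2 * pi} h" "h 0 = h (2 * pi)" for h
  proof -
    let ?I = "LINT \<alpha>|circle_measure. cmod (f \<alpha>)"
    have hi: "integrable circle_measure (\<lambda>\<alpha>. cnj (f \<alpha>) * h \<alpha>)"
      by (rule integrable_cnj_mult[OF f sq_integrable_continuous[OF h(1)]])
    have bound: "cmod (LINT \<alpha>|circle_measure. cnj (f \<alpha>) * h \<alpha>) \<le> e * ?I" if e: "e > 0" for e
    proof -
      obtain q where q: "trig q" "\<And>\<alpha>. \<alpha> \<in> {0..2 * pi} \<Longrightarrow> cmod (h \<alpha> - q \<alpha>) < e"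
        using trig_dense[OF h e] by blast
      have "(LINT \<alpha>|circle_measure. cnj (f \<alpha>) * h \<alpha>) =
          (LINT \<alpha>|circle_measure. cnj (f \<alpha>) * h \<alpha>) - (LINT \<alpha>|circle_measure. cnj (f \<alpha>) * q \<alpha>)"
        by (simp add: orth_trig q)
      also have "\<dots> = (LINT \<alpha>|circle_measure. cnj (f \<alpha>) * h \<alpha> - cnj (f \<alpha>) * q \<alpha>)"
        by (rule Bochner_Integration.integral_diff[symmetric, OF hi orth_trig(2)[OF q(1)]])
      also have "cmod \<dots> \<le> (LINT \<alpha>|circle_measure. cmod (cnj (f \<alpha>) * h \<alpha> - cnj (f \<alpha>) * q \<alpha>))"
        by (rule integral_norm_bound)
      also have "\<dots> \<le> (LINT \<alpha>|circle_measure. e * cmod (f \<alpha>))"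
      proof (rule integral_mono)
        show "integrable circle_measure (\<lambda>\<alpha>. cmod (cnj (f \<alpha>) * h \<alpha> - cnj (f \<alpha>) * q \<alpha>))"
          by (intro integrable_norm Bochner_Integration.integrable_diff hi orth_trig(2)[OF q(1)])
        show "integrable circle_measure (\<lambda>\<alpha>. e * cmod (f \<alpha>))" using fi by simp
        fix \<alpha> assume "\<alpha> \<in> space circle_measure"
        then have "cmod (h \<alpha> - q \<alpha>) \<le> e" using q(2) by (auto simp: space_circle less_imp_le)
        then have "cmod (f \<alpha>) * cmod (h \<alpha> - q \<alpha>) \<le> cmod (f \<alpha>) * e" by (rule mult_left_mono) simp
        then show "cmod (cnj (f \<alpha>) * h \<alpha> - cnj (f \<alpha>) * q \<alpha>) \<le> e * cmod (f \<alpha>)"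
          by (simp only: right_diff_distrib[symmetric] norm_mult complex_mod_cnj mult.commute[of e])
      qed
      finally show ?thesis by simp
    qed
    have I0: "0 \<le> ?I" by simp
    have "cmod (LINT \<alpha>|circle_measure. cnj (f \<alpha>) * h \<alpha>) \<le> 0"
    proof (rule field_le_epsilon)
      fix e :: real assume e: "e > 0"
      have "e / (?I + 1) * ?I \<le> e / (?I + 1) * (?I + 1)"
        using e I0 by (intro mult_left_mono) (auto simp: add_nonneg_pos)
      also have "\<dots> = e" by (rule divide_succ_mult_cancel[OF I0])
      finally show "cmod (LINT \<alpha>|circle_measure. cnj (f \<alpha>) * h \<alpha>) \<le> 0 + e"
        using bound[of "e / (?I + 1)"] e I0 by (simp add: add_nonneg_pos)
    qed
    then show ?thesis by simp
  qed
  define s where "s \<alpha> = (if \<alpha> \<in> {0..2 * pi} then sgn (f \<alpha>) else 0)" for \<alpha>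
  have "(\<lambda>\<alpha>. indicator {0..2 * pi} \<alpha> *\<^sub>R sgn (f \<alpha>)) \<in> borel_measurable lborel"
  proof -
    have "(\<lambda>\<alpha>. sgn (f \<alpha>)) \<in> borel_measurable circle_measure" by measurable
    then show ?thesis
      unfolding circle_measure_def by (subst (asm) borel_measurable_restrict_space_iff) auto
  qed
  moreover have "(\<lambda>\<alpha>. indicator {0..2 * pi} \<alpha> *\<^sub>R sgn (f \<alpha>)) = s" by (auto simp: s_def fun_eq_iff)
  ultimately have "s \<in> borel_measurable lborel" by simp
  then have "s \<in> borel_measurable lebesgue" by (rule measurable_completion)
  then have "s measurable_on UNIV" by (rule lebesgue_measurable_imp_measurable_on) simp
  then obtain N g where N: "negligible N" and g: "\<And>n. continuous_on UNIV (g n)"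
    "\<And>x. x \<notin> N \<Longrightarrow> (\<lambda>n. g n x) \<longlonglongrightarrow> s x"
    unfolding measurable_on_def by auto
  define cutoff where "cutoff n x = min 1 (real n * x) * min 1 (real n * (2 * pi - x))" for n x
  define h where "h n x = complex_of_real (cutoff n x) * (g n x / of_real (max 1 (cmod (g n x))))" for n x
  have cutoff01: "0 \<le> cutoff n x \<and> cutoff n x \<le> 1" if "x \<in> {0..2 * pi}" for n x
    using that unfolding cutoff_def by (auto intro!: mult_nonneg_nonneg mult_le_one)
  have contg: "continuous_on S (g n)" for S n using g(1) continuous_on_subset by blast
  have conth: "continuous_on S (h n)" for S n
    unfolding h_def cutoff_def
    by (intro continuous_intros contg) auto
  have hb: "cmod (h n x) \<le> 1" if "x \<in> {0..2 * pi}" for n x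
  proof -
    have "cmod (h n x) = \<bar>cutoff n x\<bar> * (cmod (g n x) / max 1 (cmod (g n x)))"
      by (simp add: h_def norm_mult norm_divide)
    also have "\<dots> \<le> 1 * 1"
      using cutoff01[OF that, of n] by (intro mult_mono) (auto simp: divide_le_eq max_def)
    finally show ?thesis by simp
  qed
  have hlim: "(\<lambda>n. h n x) \<longlonglongrightarrow> sgn (f x)" if x: "x \<notin> N" "0 < x" "x < 2 * pi" for x
  proof -
    have "\<forall>\<^sub>F n in sequentially. cutoff n x = 1"
    proof -
      obtain K where K: "max (1 / x) (1 / (2 * pi - x)) < real K" using reals_Archimedean2 by blast
      show ?thesis
        using eventually_ge_at_top[of K]
      proof eventually_elim
        fix n assume "K \<le> n"
        then have "1 / x < real n" "1 / (2 * pi - x) < real n" using K by auto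
        then have "1 \<le> real n * x" "1 \<le> real n * (2 * pi - x)"
          using x by (simp_all add: divide_less_eq)
        then show "cutoff n x = 1" by (simp add: cutoff_def)
      qed
    qed
    then have "(\<lambda>n. complex_of_real (cutoff n x)) \<longlonglongrightarrow> 1"
      by (intro tendsto_eventually) (auto elim: eventually_mono)
    moreover have "(\<lambda>n. g n x / of_real (max 1 (cmod (g n x)))) \<longlonglongrightarrow> s x / of_real (max 1 (cmod (s x)))"
      by (intro tendsto_intros g(2) x(1)) auto
    ultimately have "(\<lambda>n. h n x) \<longlonglongrightarrow> 1 * (s x / of_real (max 1 (cmod (s x))))"
      unfolding h_def by (rule tendsto_mult)
    moreover have "max 1 (cmod (s x)) = 1" by (auto simp: s_def norm_sgn)
    ultimately show ?thesis using x by (simp add: s_def)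
  qed
  have AEN: "AE x in circle_measure. x \<notin> N \<and> 0 < x \<and> x < 2 * pi"
  proof -
    have "N \<union> {0, 2 * pi} \<in> null_sets lebesgue"
      using N negligible_finite[of "{0, 2 * pi}"] by (simp add: negligible_iff_null_sets[symmetric] negligible_Un)
    then have "AE x in lebesgue. x \<notin> N \<union> {0, 2 * pi}" by (rule AE_not_in)
    then have "AE x in lborel. x \<notin> N \<union> {0, 2 * pi}" by (simp add: AE_completion_iff)
    then have "AE x in lborel. x \<in> {0..2 * pi} \<longrightarrow> x \<notin> N \<and> 0 < x \<and> x < 2 * pi"
      by eventually_elim auto
    then show ?thesis unfolding circle_measure_def by (subst AE_restrict_space_iff) auto
  qed
  have "(\<lambda>n. LINT x|circle_measure. cnj (f x) * h n x) \<longlonglongrightarrow> (LINT x|circle_measure. cnj (f x) * sgn (f x))"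
  proof (rule integral_dominated_convergence[where w = "\<lambda>x. cmod (f x)"])
    have [measurable]: "h n \<in> borel_measurable circle_measure" for n
      by (rule circle_measurable_continuous[OF conth])
    show "(\<lambda>x. cnj (f x) * sgn (f x)) \<in> borel_measurable circle_measure" by measurable
    show "(\<lambda>x. cnj (f x) * h n x) \<in> borel_measurable circle_measure" for n by measurable
    show "integrable circle_measure (\<lambda>x. cmod (f x))" using fi by simp
    show "AE x in circle_measure. (\<lambda>n. cnj (f x) * h n x) \<longlonglongrightarrow> cnj (f x) * sgn (f x)"
      using AEN by eventually_elim (intro tendsto_intros hlim, auto)
    show "AE x in circle_measure. norm (cnj (f x) * h n x) \<le> cmod (f x)" for n
      using hb by (intro AE_I2) (auto simp: norm_mult space_circle intro: mult_left_le)
  qed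
  moreover have "(LINT x|circle_measure. cnj (f x) * h n x) = 0" for n
    by (rule orth_cont[OF conth]) (simp add: h_def cutoff_def)
  ultimately have "(LINT x|circle_measure. cnj (f x) * sgn (f x)) = 0" by (simp add: LIMSEQ_const_iff)
  moreover have "cnj z * sgn z = complex_of_real (cmod z)" for z
    using complex_norm_square[of z] by (cases "z = 0") (simp_all add: sgn_eq field_simps power2_eq_square)
  ultimately have "complex_of_real (LINT x|circle_measure. cmod (f x)) = 0" by simp
  then have "(LINT x|circle_measure. cmod (f x)) = 0" by (simp only: of_real_eq_0_iff)
  then have "AE x in circle_measure. cmod (f x) = 0"
    using integral_nonneg_eq_0_iff_AE[of circle_measure "\<lambda>x. cmod (f x)"] fi by simp
  then show ?thesis by simp
qed

text \<open>The range of an isometry is closed, and by completeness of the trigonometric system only zero is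
  orthogonal to it.\<close>

lemma fourier_surj: "surj fourier"
proof (rule ccontr)
  assume neg: "\<not> surj fourier"
  have sub: "subspace (range fourier)"
    unfolding subspace_def
  proof (intro conjI allI ballI)
    show "0 \<in> range fourier" using fourier_diff[of 0 0] by (metis diff_self rangeI)
    show "a + b \<in> range fourier" if "a \<in> range fourier" "b \<in> range fourier" for a b
      using that by (auto simp: fourier_add[symmetric])
    show "r *\<^sub>R a \<in> range fourier" if "a \<in> range fourier" for r a
      using that by (auto simp: scaleR_scaleC fourier_scaleC[symmetric])
  qed
  have "closed (range fourier)"
    unfolding closed_sequential_limits
  proof (intro allI impI, elim conjE)
    fix u l assume u: "\<forall>n. u n \<in> range fourier" and lim: "u \<longlonglongrightarrow> l"
    then have "\<forall>n. \<exists>y. u n = fourier y" by blast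
    from choice[OF this] obtain x where x: "\<And>n. u n = fourier (x n)" by blast
    have "Cauchy u" using lim convergent_Cauchy convergent_def by blast
    then have "Cauchy x"
      unfolding Cauchy_def dist_norm x fourier_diff[symmetric] norm_fourier .
    then obtain y where "x \<longlonglongrightarrow> y" using Cauchy_convergent convergent_def by blast
    then have "(\<lambda>n. norm (x n - y)) \<longlonglongrightarrow> 0" by (simp add: tendsto_norm_zero_iff LIM_zero_iff)
    then have "(\<lambda>n. norm (u n - fourier y)) \<longlonglongrightarrow> 0" by (simp add: x fourier_diff[symmetric] norm_fourier)
    then have "u \<longlonglongrightarrow> fourier y" by (simp add: tendsto_norm_zero_iff LIM_zero_iff)
    then show "l \<in> range fourier" using lim LIMSEQ_unique by blast
  qed
  from closed_subspace_orthogonal[OF sub this neg]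
  obtain z where z: "z \<noteq> 0" "\<And>m. m \<in> range fourier \<Longrightarrow> inner z m = 0" by blast
  obtain f where f: "sq_integrable circle_measure f" "z = L2_class f" using L2_circle_cases by blast
  have "(LINT \<alpha>|circle_measure. cnj (f \<alpha>) * mode n \<alpha>) = 0" for n
  proof -
    have "inner z (basis_vec n) = 0" by (rule z(2)) (metis fourier_delta rangeI)
    moreover have "inner z (\<i> *\<^sub>C basis_vec n) = 0"
      by (rule z(2)) (metis fourier_delta fourier_scaleC rangeI)
    ultimately have "cinner z (basis_vec n) = 0"
      by (simp add: cinner_eq_inner zero_complex.code)
    then show ?thesis
      by (simp add: f basis_vec_def cinner_L2_circle_def L2_class_cinner sq_integrable_mode)
  qed
  from trig_complete[OF f(1) this] have "z = 0"
    unfolding f(2) zero_L2_circle_def using L2_class_eq_iff[OF f(1) sq_integrable_zero] by simp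
  with z(1) show False by simp
qed

section \<open>The conjugate operator as a Jacobi matrix\<close>

text \<open>On the basis, \<open>i A0 = 2 sin \<alpha> d/d\<alpha> + cos \<alpha>\<close> sends \<open>e\<^sub>n\<close> to
  \<open>(n + 1/2) e\<^bsub>n+1\<^esub> - (n - 1/2) e\<^bsub>n-1\<^esub>\<close>. The domain is the largest possible one: all
  sequences that this matrix maps into \<open>l\<^sup>2\<close>.\<close>

definition jacobi :: "(int ell2 \<times> int ell2) set" where
  "jacobi = {(x, y). \<forall>n. \<i> * ell2_apply y n =
    of_real (of_int n - 1 / 2) * ell2_apply x (n - 1) - of_real (of_int n + 1 / 2) * ell2_apply x (n + 1)}"

lemma ell2_mult_summable:
  "(\<lambda>n. cmod (ell2_apply x n * ell2_apply y n)) summable_on UNIV"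
proof (rule Infinite_Sum.abs_summable_on_comparison_test')
  show "(\<lambda>n. (cmod (ell2_apply x n))\<^sup>2 + (cmod (ell2_apply y n))\<^sup>2) summable_on UNIV"
    by (intro summable_on_add ell2_summable)
  fix n
  have "0 \<le> (cmod (ell2_apply x n))\<^sup>2 + (cmod (ell2_apply y n))\<^sup>2" by simp
  moreover have "2 * cmod (ell2_apply x n) * cmod (ell2_apply y n) \<le> (cmod (ell2_apply x n))\<^sup>2 + (cmod (ell2_apply y n))\<^sup>2"
    by (rule sum_squares_bound)
  ultimately show "norm (ell2_apply x n * ell2_apply y n) \<le> (cmod (ell2_apply x n))\<^sup>2 + (cmod (ell2_apply y n))\<^sup>2"
    unfolding norm_mult by linarith
qed

lemma cinner_has_sum: "((\<lambda>n. cnj (ell2_apply x n) * ell2_apply y n) has_sum cinner x y) UNIV"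
proof -
  have "(\<lambda>n. cmod (cnj (ell2_apply x n) * ell2_apply y n)) summable_on UNIV"
    using ell2_mult_summable[of x y] by (simp add: norm_mult)
  then have "(\<lambda>n. cnj (ell2_apply x n) * ell2_apply y n) summable_on UNIV"
    by (rule abs_summable_summable)
  then show ?thesis unfolding cinner_ell2_def by (rule has_sum_infsum)
qed

lemma has_sum_symmetric_intervals:
  assumes "(f has_sum L) (UNIV :: int set)"
  shows "(\<lambda>N. \<Sum>n\<in>{- int N<..int N}. f n) \<longlonglongrightarrow> L"
proof -
  have "filterlim (\<lambda>N. {- int N<..int N}) (finite_subsets_at_top UNIV) sequentially"
    unfolding filterlim_finite_subsets_at_top
  proof (intro allI impI)
    fix X :: "int set" assume X: "finite X \<and> X \<subseteq> UNIV"
    define K where "K = nat (\<Sum>k\<in>X. \<bar>k\<bar>) + 1"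
    have K: "\<bar>k\<bar> < int K" if "k \<in> X" for k
    proof -
      have "\<bar>k\<bar> \<le> (\<Sum>k\<in>X. \<bar>k\<bar>)" by (rule member_le_sum) (use X that in auto)
      then show ?thesis by (simp add: K_def)
    qed
    show "\<forall>\<^sub>F N in sequentially. finite {- int N<..int N} \<and> X \<subseteq> {- int N<..int N} \<and> {- int N<..int N} \<subseteq> UNIV"
      using eventually_ge_at_top[of K] by eventually_elim (use K in force)
  qed
  from filterlim_compose[OF assms[unfolded has_sum_def] this] show ?thesis .
qed

text \<open>Carleman's argument: the boundary terms of the summation by parts have coefficients of order
  \<open>N\<close> in front of a summable sequence, so they cannot stay away from zero.\<close>

lemma linear_times_summable_limit:
  fixes t :: "nat \<Rightarrow> real" and L :: "nat \<Rightarrow> complex"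
  assumes t: "summable t" and L: "L \<longlonglongrightarrow> l" and le: "\<And>N. cmod (L N) \<le> (real N + 1) * t N"
  shows "l = 0"
proof (rule ccontr)
  assume "l \<noteq> 0"
  then have c: "0 < cmod l / 2" "cmod l / 2 < cmod l" by auto
  have "\<forall>\<^sub>F N in sequentially. cmod l / 2 < cmod (L N)"
    using order_tendstoD(1)[OF tendsto_norm[OF L] c(2)] .
  then obtain K where K: "\<And>N. N \<ge> K \<Longrightarrow> cmod l / 2 < cmod (L N)"
    unfolding eventually_sequentially by blast
  have "summable (\<lambda>N. (cmod l / 2) * inverse (of_nat (Suc N)))"
  proof (rule summable_comparison_test'[OF t])
    fix N assume "N \<ge> K"
    then have "cmod l / 2 \<le> (real N + 1) * t N" using K[of N] le[of N] by linarith
    then have "cmod l / 2 / (real N + 1) \<le> t N" by (subst pos_divide_le_eq) (simp, simp only: mult.commute)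
    moreover have eq: "(cmod l / 2) * inverse (of_nat (Suc N)) = cmod l / 2 / (real N + 1)"
      by (simp only: divide_inverse of_nat_Suc add.commute)
    moreover have "0 \<le> cmod l / 2 / (real N + 1)" by simp
    ultimately show "norm ((cmod l / 2) * inverse (of_nat (Suc N))) \<le> t N"
      by (simp only: eq real_norm_def abs_of_nonneg)
  qed
  then have "summable (\<lambda>N. inverse (of_nat (Suc N)) :: real)"
    using c by (subst (asm) summable_cmult_iff) simp
  then have "summable (\<lambda>N. inverse (of_nat N) :: real)" by (subst (asm) summable_Suc_iff)
  then show False using not_summable_harmonic[where 'a = real] by simp
qed

text \<open>The difference of the two sides telescopes to boundary terms at \<open>-N\<close> and \<open>N\<close>.\<close>

lemma jacobi_symmetric:
  assumes xx': "(x, x') \<in> jacobi" and yy': "(y, y') \<in> jacobi"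
  shows "cinner x y' = cinner x' y"
proof -
  let ?X = "ell2_apply x" and ?Y = "ell2_apply y" and ?X' = "ell2_apply x'" and ?Y' = "ell2_apply y'"
  define b where "b n = of_real (of_int n + 1 / 2) * (cnj (?X n) * ?Y (n + 1) + cnj (?X (n + 1)) * ?Y n)" for n :: int
  define d where "d n = cnj (?X n) * ?Y' n - cnj (?X' n) * ?Y n" for n
  have bd: "\<i> * d n = b (n - 1) - b n" for n
  proof -
    have "\<i> * ?Y' n = of_real (of_int n - 1 / 2) * ?Y (n - 1) - of_real (of_int n + 1 / 2) * ?Y (n + 1)"
      using yy' by (simp add: jacobi_def)
    moreover have "\<i> * ?X' n = of_real (of_int n - 1 / 2) * ?X (n - 1) - of_real (of_int n + 1 / 2) * ?X (n + 1)"
      using xx' by (simp add: jacobi_def)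
    then have "cnj (\<i> * ?X' n) = of_real (of_int n - 1 / 2) * cnj (?X (n - 1)) - of_real (of_int n + 1 / 2) * cnj (?X (n + 1))"
      by (simp only: complex_cnj_diff complex_cnj_mult complex_cnj_complex_of_real)
    moreover have "\<i> * d n = cnj (?X n) * (\<i> * ?Y' n) + cnj (\<i> * ?X' n) * ?Y n"
      by (simp add: d_def algebra_simps)
    ultimately have "\<i> * d n =
        cnj (?X n) * (of_real (of_int n - 1 / 2) * ?Y (n - 1) - of_real (of_int n + 1 / 2) * ?Y (n + 1)) +
        (of_real (of_int n - 1 / 2) * cnj (?X (n - 1)) - of_real (of_int n + 1 / 2) * cnj (?X (n + 1))) * ?Y n"
      by (simp only:)
    also have "\<dots> = b (n - 1) - b n" by (simp add: b_def algebra_simps)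
    finally show ?thesis .
  qed
  have tel: "(\<Sum>n\<in>{- int N<..int N}. \<i> * d n) = b (- int N) - b (int N)" for N
  proof (induction N)
    case (Suc N)
    have "{- int (Suc N)<..int (Suc N)} = insert (- int N) (insert (int N + 1) {- int N<..int N})"
      by auto
    then have "(\<Sum>n\<in>{- int (Suc N)<..int (Suc N)}. \<i> * d n) =
        \<i> * d (- int N) + (\<i> * d (int N + 1) + (\<Sum>n\<in>{- int N<..int N}. \<i> * d n))"
      by (simp only:) (subst sum.insert; simp)+
    also have "\<dots> = b (- int (Suc N)) - b (int (Suc N))"
    proof -
      have "- int (Suc N) = - int N - 1" "int (Suc N) = int N + 1" by simp_all
      then show ?thesis by (simp only: Suc bd[of "- int N"] bd[of "int N + 1"]) simp
    qed
    finally show ?case .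
  qed simp
  have "(d has_sum (cinner x y' - cinner x' y)) UNIV"
    using has_sum_add[OF cinner_has_sum[of x y'] has_sum_cmult_right[OF cinner_has_sum[of x' y], of "-1"]]
    by (simp add: d_def[abs_def])
  then have "((\<lambda>n. \<i> * d n) has_sum (\<i> * (cinner x y' - cinner x' y))) UNIV"
    by (rule has_sum_cmult_right)
  from has_sum_symmetric_intervals[OF this]
  have lim: "(\<lambda>N. b (- int N) - b (int N)) \<longlonglongrightarrow> \<i> * (cinner x y' - cinner x' y)" unfolding tel .
  define s where "s n = cmod (?X n * ?Y (n + 1)) + cmod (?X (n + 1) * ?Y n)" for n
  have "s summable_on UNIV"
    using summable_on_add[OF ell2_mult_summable[of x "ap (translation 1) y"] ell2_mult_summable[of "ap (translation 1) x" y]]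
    by (simp add: s_def[abs_def])
  then have sN: "summable (\<lambda>N. s (g N))" if "inj g" for g :: "nat \<Rightarrow> int"
  proof -
    have "s summable_on range g" by (rule summable_on_subset_banach[OF \<open>s summable_on UNIV\<close>]) simp
    then have "(s \<circ> g) summable_on UNIV" using summable_on_reindex[OF that, of s] by simp
    then show ?thesis by (simp add: summable_on_imp_summable o_def)
  qed
  have t: "summable (\<lambda>N. s (- int N) + s (int N))"
    by (intro summable_add sN) (auto simp: inj_on_def)
  have le: "cmod (b (- int N) - b (int N)) \<le> (real N + 1) * (s (- int N) + s (int N))" for N
  proof -
    have bs: "cmod (b n) \<le> (real N + 1) * s n" if "\<bar>of_int n + 1 / 2\<bar> \<le> real N + 1" for n
    proof -
      have "cmod (b n) = \<bar>of_int n + 1 / 2\<bar> * cmod (cnj (?X n) * ?Y (n + 1) + cnj (?X (n + 1)) * ?Y n)"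
        unfolding b_def norm_mult norm_of_real ..
      also have "\<dots> \<le> (real N + 1) * (cmod (cnj (?X n) * ?Y (n + 1)) + cmod (cnj (?X (n + 1)) * ?Y n))"
        by (intro mult_mono that norm_triangle_ineq) auto
      finally show ?thesis by (simp add: s_def norm_mult)
    qed
    have "cmod (b (- int N) - b (int N)) \<le> cmod (b (- int N)) + cmod (b (int N))" by (rule norm_triangle_ineq4)
    also have "\<dots> \<le> (real N + 1) * s (- int N) + (real N + 1) * s (int N)" by (intro add_mono bs) auto
    finally show ?thesis by (simp add: distrib_left)
  qed
  have "\<i> * (cinner x y' - cinner x' y) = 0" by (rule linear_times_summable_limit[OF t lim le])
  then show ?thesis by simp
qed

definition jacobi_delta :: "int \<Rightarrow> int ell2" where
  "jacobi_delta n = (- \<i>) *\<^sub>C (of_real (of_int n + 1 / 2) *\<^sub>C delta (n + 1) - of_real (of_int n - 1 / 2) *\<^sub>C delta (n - 1))"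

lemma jacobi_delta: "(delta n, jacobi_delta n) \<in> jacobi"
  by (auto simp: jacobi_def jacobi_delta_def)

lemma cinner_ell2_delta: "cinner y (delta n) = cnj (ell2_apply y n)"
  by (metis cinner_commute cinner_delta)

text \<open>The adjoint of the matrix on finite sequences is the matrix on its maximal domain.\<close>

lemma jacobi_if_weak:
  assumes "\<And>n. cinner y (jacobi_delta n) = cinner z (delta n)"
  shows "(y, z) \<in> jacobi"
  unfolding jacobi_def
proof (intro CollectI case_prodI allI)
  fix n
  have "cnj (cinner y (jacobi_delta n)) = cnj (cinner z (delta n))" by (simp only: assms)
  then have "ell2_apply z n = \<i> * (of_real (of_int n + 1 / 2) * ell2_apply y (n + 1) - of_real (of_int n - 1 / 2) * ell2_apply y (n - 1))"
    by (simp add: jacobi_delta_def cinner_scaleC_right cinner.diff_right cinner_ell2_delta)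
  then show "\<i> * ell2_apply z n = of_real (of_int n - 1 / 2) * ell2_apply y (n - 1) - of_real (of_int n + 1 / 2) * ell2_apply y (n + 1)"
    by (simp add: mult.assoc[symmetric])
qed

lemma jacobi_add: "(x, y) \<in> jacobi \<Longrightarrow> (x', y') \<in> jacobi \<Longrightarrow> (x + x', y + y') \<in> jacobi"
  by (simp add: jacobi_def distrib_left)

lemma jacobi_scaleC: "(x, y) \<in> jacobi \<Longrightarrow> (c *\<^sub>C x, c *\<^sub>C y) \<in> jacobi"
  by (simp add: jacobi_def mult.left_commute[of _ c] right_diff_distrib[symmetric] del: mult_cancel_left)

lemma jacobi_unique: "(x, y) \<in> jacobi \<Longrightarrow> (x, y') \<in> jacobi \<Longrightarrow> y = y'"
proof (rule ell2_eqI)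
  fix n assume "(x, y) \<in> jacobi" "(x, y') \<in> jacobi"
  then have "\<i> * ell2_apply y n = \<i> * ell2_apply y' n" by (simp add: jacobi_def)
  then show "ell2_apply y n = ell2_apply y' n" by simp
qed

lemma jacobi_zero: "(0, 0) \<in> jacobi"
  by (simp add: jacobi_def)

lemma dense_jacobi: "closure (Domain jacobi) = UNIV"
proof -
  have fin: "sum (\<lambda>i. ell2_apply x i *\<^sub>C delta i) F \<in> Domain jacobi" if "finite F" for F x
    using that
  proof (induction rule: finite_induct)
    case empty
    show ?case using jacobi_zero by auto
  next
    case (insert i F)
    then obtain w where "(\<Sum>i\<in>F. ell2_apply x i *\<^sub>C delta i, w) \<in> jacobi" by auto
    from jacobi_add[OF jacobi_scaleC[OF jacobi_delta[of i], of "ell2_apply x i"] this]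
    show ?case using insert by (simp add: Domain.DomainI)
  qed
  have "x \<in> closure (Domain jacobi)" for x
    unfolding closure_approachable
  proof (intro allI impI)
    fix e :: real assume "e > 0"
    then obtain F where F: "finite F" "norm (x - ap (coord_proj F) x) < e" using coord_proj_tail_small by blast
    have "ap (coord_proj F) x = sum (\<lambda>i. ell2_apply x i *\<^sub>C delta i) F"
    proof (rule ell2_eqI)
      fix j
      have "ell2_apply (sum (\<lambda>i. ell2_apply x i *\<^sub>C delta i) F) j = (\<Sum>i\<in>F. if i = j then ell2_apply x i else 0)"
        unfolding ell2_apply_sum by (intro sum.cong) auto
      then show "ell2_apply (ap (coord_proj F) x) j = ell2_apply (sum (\<lambda>i. ell2_apply x i *\<^sub>C delta i) F) j"
        using F(1) by simp
    qed
    then show "\<exists>y\<in>Domain jacobi. dist y x < e"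
      using F fin[OF F(1), of x] by (intro bexI[of _ "ap (coord_proj F) x"]) (simp_all add: dist_norm norm_minus_commute)
  qed
  then show ?thesis by blast
qed

lemma selfadjoint_jacobi: "selfadjoint jacobi"
  unfolding selfadjoint_def
proof (intro conjI dense_jacobi)
  show "linear_operator jacobi"
    unfolding linear_operator_def single_valued_def
    using jacobi_zero jacobi_add jacobi_scaleC by (blast dest: jacobi_unique)
  show "adjoint_graph jacobi = jacobi"
  proof (intro equalityI subrelI)
    fix y z assume "(y, z) \<in> adjoint_graph jacobi"
    then show "(y, z) \<in> jacobi"
      using jacobi_delta by (intro jacobi_if_weak) (auto simp: adjoint_graph_def)
  next
    fix y z assume "(y, z) \<in> jacobi"
    then show "(y, z) \<in> adjoint_graph jacobi" by (auto simp: adjoint_graph_def jacobi_symmetric)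
  qed
qed

definition jacobi_hat :: "(L2_circle \<times> L2_circle) set" where
  "jacobi_hat = {(fourier x, fourier y) | x y. (x, y) \<in> jacobi}"

lemma jacobi_hat_iff: "(fourier x, fourier y) \<in> jacobi_hat \<longleftrightarrow> (x, y) \<in> jacobi"
  by (auto simp: jacobi_hat_def fourier_inject)

lemma fourier_cases: obtains x where "u = fourier x"
  using fourier_surj by (metis surjD)

lemma selfadjoint_jacobi_hat: "selfadjoint jacobi_hat"
  unfolding selfadjoint_def
proof (intro conjI)
  have f0: "fourier 0 = 0" using fourier_diff[of 0 0] by simp
  show "linear_operator jacobi_hat"
    unfolding linear_operator_def
  proof (intro conjI allI impI)
    show "single_valued jacobi_hat"
      unfolding single_valued_def jacobi_hat_def by (auto simp: fourier_inject dest: jacobi_unique)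
    show "(0, 0) \<in> jacobi_hat" using jacobi_hat_iff[of 0 0] jacobi_zero by (simp add: f0)
    show "(x + x', y + y') \<in> jacobi_hat" if "(x, y) \<in> jacobi_hat" "(x', y') \<in> jacobi_hat" for x y x' y'
    proof -
      from that obtain a b a' b' where "x = fourier a" "y = fourier b" "(a, b) \<in> jacobi"
        "x' = fourier a'" "y' = fourier b'" "(a', b') \<in> jacobi" unfolding jacobi_hat_def by blast
      then show ?thesis by (simp only: fourier_add[symmetric] jacobi_hat_iff jacobi_add)
    qed
    show "(c *\<^sub>C x, c *\<^sub>C y) \<in> jacobi_hat" if "(x, y) \<in> jacobi_hat" for c x y
    proof -
      from that obtain a b where "x = fourier a" "y = fourier b" "(a, b) \<in> jacobi"
        unfolding jacobi_hat_def by blast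
      then show ?thesis by (simp only: fourier_scaleC[symmetric] jacobi_hat_iff jacobi_scaleC)
    qed
  qed
  have "u \<in> closure (Domain jacobi_hat)" for u
    unfolding closure_approachable
  proof (intro allI impI)
    fix e :: real assume e: "e > 0"
    obtain x where x: "u = fourier x" by (rule fourier_cases)
    have "x \<in> closure (Domain jacobi)" by (simp add: dense_jacobi)
    then obtain y w where y: "(y, w) \<in> jacobi" "dist y x < e" unfolding closure_approachable using e by blast
    have "dist (fourier y) u = dist y x" by (simp add: x dist_norm fourier_diff[symmetric] norm_fourier)
    then show "\<exists>v\<in>Domain jacobi_hat. dist v u < e"
      using y jacobi_hat_iff[of y w] by (intro bexI[of _ "fourier y"]) auto
  qed
  then show "closure (Domain jacobi_hat) = UNIV" by blast
  show "adjoint_graph jacobi_hat = jacobi_hat"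
  proof (intro equalityI subrelI)
    fix u v assume a: "(u, v) \<in> adjoint_graph jacobi_hat"
    obtain x y where xy: "u = fourier x" "v = fourier y" by (metis fourier_cases)
    have "cinner x (jacobi_delta n) = cinner y (delta n)" for n
      using a jacobi_delta[of n] jacobi_hat_iff[of "delta n" "jacobi_delta n"]
      by (auto simp: adjoint_graph_def xy cinner_fourier[symmetric])
    then show "(u, v) \<in> jacobi_hat" unfolding xy jacobi_hat_iff by (rule jacobi_if_weak)
  next
    fix u v assume "(u, v) \<in> jacobi_hat"
    then show "(u, v) \<in> adjoint_graph jacobi_hat"
      by (auto simp: adjoint_graph_def jacobi_hat_def cinner_fourier jacobi_symmetric)
  qed
qed

lemma mode_pair_derivatives:
  "(ddx ^^ k) (\<lambda>\<alpha>. c * mode n \<alpha> + d * mode (- n) \<alpha>) =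
    (\<lambda>\<alpha>. c * (- \<i> * of_int n) ^ k * mode n \<alpha> + d * (\<i> * of_int n) ^ k * mode (- n) \<alpha>)"
proof (induction k arbitrary: c d)
  case (Suc k)
  have "ddx (\<lambda>\<alpha>. c * mode n \<alpha> + d * mode (- n) \<alpha>) =
      (\<lambda>\<alpha>. (c * (- \<i> * of_int n)) * mode n \<alpha> + (d * (\<i> * of_int n)) * mode (- n) \<alpha>)"
  proof (rule ext, rule vector_derivative_at)
    fix \<alpha>
    show "((\<lambda>\<alpha>. c * mode n \<alpha> + d * mode (- n) \<alpha>) has_vector_derivative
        (c * (- \<i> * of_int n)) * mode n \<alpha> + (d * (\<i> * of_int n)) * mode (- n) \<alpha>) (at \<alpha>)"
      using has_vector_derivative_add[OF has_vector_derivative_mult_right[OF mode_derivative[of n \<alpha>], of c]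
          has_vector_derivative_mult_right[OF mode_derivative[of "- n" \<alpha>], of d]]
      by (simp add: mult.assoc)
  qed
  then show ?case
    unfolding funpow_Suc_right o_apply by (simp only: Suc) (simp add: mult_ac)
qed simp

lemma mode_pair_smooth: "(\<lambda>\<alpha>. c * mode n \<alpha> + d * mode (- n) \<alpha>) \<in> smooth_circle_functions"
  unfolding smooth_circle_functions_def
proof (intro CollectI conjI allI)
  fix k \<alpha>
  let ?c = "c * (- \<i> * of_int n) ^ k" and ?d = "d * (\<i> * of_int n) ^ k"
  have "((\<lambda>\<alpha>. ?c * mode n \<alpha> + ?d * mode (- n) \<alpha>) has_vector_derivative
      ?c * ((- \<i> * of_int n) * mode n \<alpha>) + ?d * ((- \<i> * of_int (- n)) * mode (- n) \<alpha>)) (at \<alpha>)"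
    by (intro has_vector_derivative_add has_vector_derivative_mult_right mode_derivative)
  then show "(ddx ^^ k) (\<lambda>\<alpha>. c * mode n \<alpha> + d * mode (- n) \<alpha>) differentiable (at \<alpha>)"
    unfolding mode_pair_derivatives by (rule differentiableI_vector)
qed (simp add: mode_periodic)

lemma cinner_mode_class:
  assumes "sq_integrable circle_measure f"
  shows "cinner (basis_vec n) (L2_class f) = (LINT \<alpha>|circle_measure. mode (- n) \<alpha> * f \<alpha>)"
  using assms by (simp add: basis_vec_def cinner_L2_circle_def L2_class_cinner sq_integrable_mode cnj_mode)

text \<open>On Fourier coefficients the core acts as the Jacobi matrix, by integration by parts.\<close>

lemma core_subset_jacobi_hat: "A0_hat_core \<subseteq> jacobi_hat"
proof
  fix p assume "p \<in> A0_hat_core"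
  then obtain f0 :: "real \<Rightarrow> real" where f0: "(\<lambda>\<alpha>. complex_of_real (f0 \<alpha>)) \<in> smooth_circle_functions"
    and p0: "p = (L2_class (\<lambda>\<alpha>. complex_of_real (f0 \<alpha>)), L2_class (\<lambda>\<alpha>. complex_of_real (sin \<alpha>) *
       (- \<i> * ddx (\<lambda>\<alpha>. complex_of_real (f0 \<alpha>)) \<alpha>) + (- \<i>) * ddx (\<lambda>\<beta>. complex_of_real (sin \<beta> * f0 \<beta>)) \<alpha>))"
    unfolding A0_hat_core_def by blast
  define f where "f \<alpha> = complex_of_real (f0 \<alpha>)" for \<alpha>
  have f: "f \<in> smooth_circle_functions" using f0 by (simp add: f_def[abs_def])
  have p: "p = (L2_class f, L2_class (\<lambda>\<alpha>. complex_of_real (sin \<alpha>) * (- \<i> * ddx f \<alpha>)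
      + (- \<i>) * ddx (\<lambda>\<beta>. complex_of_real (sin \<beta>) * f \<beta>) \<alpha>))"
    unfolding p0 by (simp add: f_def[abs_def])
  have diff: "(ddx ^^ k) f differentiable (at \<alpha>)" for k \<alpha>
    using f by (simp add: smooth_circle_functions_def)
  have f': "(f has_vector_derivative ddx f \<alpha>) (at \<alpha>)" for \<alpha>
    using diff[of 0 \<alpha>] by (simp add: vector_derivative_works)
  have contf: "continuous_on S f" for S
    using diff[of 0] by (auto intro!: continuous_at_imp_continuous_on differentiable_imp_continuous_within)
  have contf': "continuous_on S (ddx f)" for S
    using diff[of 1] by (auto intro!: continuous_at_imp_continuous_on differentiable_imp_continuous_within)
  have dsin: "ddx (\<lambda>\<beta>. complex_of_real (sin \<beta>) * f \<beta>) \<alpha> = complex_of_real (cos \<alpha>) * f \<alpha> + complex_of_real (sin \<alpha>) * ddx f \<alpha>" for \<alpha>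
    by (rule vector_derivative_at) (auto intro!: derivative_eq_intros f' simp: mult.commute cos_of_real sin_of_real)
  define g where "g \<alpha> = - \<i> * (2 * complex_of_real (sin \<alpha>) * ddx f \<alpha> + complex_of_real (cos \<alpha>) * f \<alpha>)" for \<alpha>
  have p': "p = (L2_class f, L2_class g)"
    unfolding p dsin by (simp add: g_def[abs_def] cos_of_real sin_of_real algebra_simps)
  have contg: "continuous_on S g" for S
    unfolding g_def by (intro continuous_intros contf contf')
  have sqf: "sq_integrable circle_measure f" and sqg: "sq_integrable circle_measure g"
    by (intro sq_integrable_continuous contf contg)+
  obtain x where x: "L2_class f = fourier x" by (rule fourier_cases)
  obtain y where y: "L2_class g = fourier y" by (rule fourier_cases)
  let ?I = "\<lambda>n. LINT \<alpha>|circle_measure. mode n \<alpha> * f \<alpha>"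
  have xn: "ell2_apply x n = ?I (- n)" for n
    using cinner_basis_fourier[of n x] cinner_mode_class[OF sqf, of n] by (simp add: x)
  have yn: "ell2_apply y n = (LINT \<alpha>|circle_measure. mode (- n) \<alpha> * g \<alpha>)" for n
    using cinner_basis_fourier[of n y] cinner_mode_class[OF sqg, of n] by (simp add: y)
  have int: "integrable circle_measure (\<lambda>\<alpha>. c * (mode n \<alpha> * f \<alpha>))" for c n
    by (intro circle_integrable_continuous continuous_intros contf)
  have "\<i> * ell2_apply y n =
      of_real (of_int n - 1 / 2) * ell2_apply x (n - 1) - of_real (of_int n + 1 / 2) * ell2_apply x (n + 1)" for n
  proof -
    let ?c = "mode (- n)"
    let ?r = "\<lambda>\<alpha>. ?c \<alpha> * (2 * (\<i> * of_int n) * complex_of_real (sin \<alpha>) + complex_of_real (cos \<alpha>)) * f \<alpha>"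
    let ?G = "\<lambda>\<alpha>. 2 * (?c \<alpha> * (complex_of_real (sin \<alpha>) * f \<alpha>))"
    have dG: "(?G has_vector_derivative (\<i> * (?c \<alpha> * g \<alpha>) + ?r \<alpha>)) (at \<alpha>)" for \<alpha>
    proof -
      have "(?c has_vector_derivative (\<i> * of_int n) * ?c \<alpha>) (at \<alpha>)"
        using mode_derivative[of "- n" \<alpha>] by simp
      moreover have "((\<lambda>\<alpha>. complex_of_real (sin \<alpha>)) has_vector_derivative complex_of_real (cos \<alpha>)) (at \<alpha>)"
        by (auto intro!: derivative_eq_intros simp: cos_of_real sin_of_real)
      ultimately have "(?G has_vector_derivative
          2 * (?c \<alpha> * (complex_of_real (sin \<alpha>) * ddx f \<alpha> + complex_of_real (cos \<alpha>) * f \<alpha>) + (\<i> * of_int n) * ?c \<alpha> * (complex_of_real (sin \<alpha>) * f \<alpha>))) (at \<alpha>)"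
        by (intro has_vector_derivative_mult_right has_vector_derivative_mult f')
      then show ?thesis by (rule has_vector_derivative_eq_rhs) (simp add: g_def algebra_simps)
    qed
    have "(LINT \<alpha>|circle_measure. \<i> * (?c \<alpha> * g \<alpha>) + ?r \<alpha>) = ?G (2 * pi) - ?G 0"
      by (intro circle_integral_FTC dG continuous_intros contf contg)
    then have "(LINT \<alpha>|circle_measure. \<i> * (?c \<alpha> * g \<alpha>) + ?r \<alpha>) = 0" by simp
    moreover have "integrable circle_measure (\<lambda>\<alpha>. \<i> * (?c \<alpha> * g \<alpha>))" "integrable circle_measure ?r"
      by (intro circle_integrable_continuous continuous_intros contf contg)+
    ultimately have 1: "\<i> * ell2_apply y n = - (LINT \<alpha>|circle_measure. ?r \<alpha>)"
      by (simp add: yn add_eq_0_iff)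
    have r: "?r \<alpha> = of_real (of_int n + 1 / 2) * (mode (- (n + 1)) \<alpha> * f \<alpha>)
        - of_real (of_int n - 1 / 2) * (mode (- (n - 1)) \<alpha> * f \<alpha>)" for \<alpha>
    proof -
      let ?e = "exp (\<i> * complex_of_real \<alpha>)" and ?e' = "exp (- \<i> * complex_of_real \<alpha>)"
      have m: "mode (- (n + 1)) \<alpha> = ?c \<alpha> * ?e" "mode (- (n - 1)) \<alpha> = ?c \<alpha> * ?e'"
        by (simp_all add: mode_def exp_add[symmetric] algebra_simps)
      have s: "complex_of_real (sin \<alpha>) = (?e - ?e') / (2 * \<i>)" "complex_of_real (cos \<alpha>) = (?e + ?e') / 2"
        by (simp_all add: sin_of_real[symmetric] cos_of_real[symmetric] sin_exp_eq cos_exp_eq)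
      show ?thesis unfolding m s by (simp add: field_simps)
    qed
    have "(LINT \<alpha>|circle_measure. ?r \<alpha>) = of_real (of_int n + 1 / 2) * ?I (- (n + 1)) - of_real (of_int n - 1 / 2) * ?I (- (n - 1))"
      unfolding r by (subst Bochner_Integration.integral_diff[OF int int]) simp
    then show ?thesis unfolding 1 xn by simp
  qed
  then have "(x, y) \<in> jacobi" by (simp add: jacobi_def)
  then show "p \<in> jacobi_hat" unfolding p' x y jacobi_hat_iff .
qed

lemma A0_hat_core_domain:
  fixes f :: "real \<Rightarrow> real"
  assumes "(\<lambda>\<alpha>. complex_of_real (f \<alpha>)) \<in> smooth_circle_functions"
  shows "\<exists>v. (L2_class (\<lambda>\<alpha>. complex_of_real (f \<alpha>)), v) \<in> A0_hat_core"
  unfolding A0_hat_core_def using assms by blast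

text \<open>The core contains real-valued functions only; a selfadjoint extension, being complex-linear,
  contains the combinations \<open>cos n\<alpha> - i sin n\<alpha>\<close> as well, and the Jacobi matrix is determined by its
  action on these.\<close>

lemma A0_hat_eq: "A0_hat = jacobi_hat"
  unfolding A0_hat_def
proof (rule the_equality)
  show "selfadjoint jacobi_hat \<and> A0_hat_core \<subseteq> jacobi_hat"
    using selfadjoint_jacobi_hat core_subset_jacobi_hat by blast
  fix A assume A: "selfadjoint A \<and> A0_hat_core \<subseteq> A"
  have lin: "linear_operator A" "linear_operator jacobi_hat"
    using A selfadjoint_jacobi_hat by (auto simp: selfadjoint_def)
  have core: "(fourier (delta n), fourier (jacobi_delta n)) \<in> A" for n
  proof -
    let ?r = "sqrt (2 * pi)"
    let ?c = "\<lambda>\<alpha>. complex_of_real (cos (of_int n * \<alpha>) / ?r)" and ?s = "\<lambda>\<alpha>. complex_of_real (sin (of_int n * \<alpha>) / ?r)"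
    have m: "mode n \<alpha> = ?c \<alpha> - \<i> * ?s \<alpha>" "mode (- n) \<alpha> = ?c \<alpha> + \<i> * ?s \<alpha>" for \<alpha>
    proof -
      have e: "mode k \<alpha> = cis (- (of_int k * \<alpha>)) / ?r" for k
        by (simp add: mode_def cis_conv_exp mult.assoc)
      show "mode n \<alpha> = ?c \<alpha> - \<i> * ?s \<alpha>" "mode (- n) \<alpha> = ?c \<alpha> + \<i> * ?s \<alpha>"
        unfolding e by (simp_all add: complex_eq_iff)
    qed
    have alg: "(1 / 2) * (C - \<i> * S) + (1 / 2) * (C + \<i> * S) = C"
      "(\<i> / 2) * (C - \<i> * S) + (- \<i> / 2) * (C + \<i> * S) = S" for C S
      by (simp_all add: field_simps)
    have "(\<lambda>\<alpha>. (1 / 2) * mode n \<alpha> + (1 / 2) * mode (- n) \<alpha>) = ?c"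
      "(\<lambda>\<alpha>. (\<i> / 2) * mode n \<alpha> + (- \<i> / 2) * mode (- n) \<alpha>) = ?s"
      by (simp_all only: m alg)
    then have sm: "?c \<in> smooth_circle_functions" "?s \<in> smooth_circle_functions"
      using mode_pair_smooth[of "1 / 2" n "1 / 2"] mode_pair_smooth[of "\<i> / 2" n "- \<i> / 2"] by (simp_all only:)
    obtain v where v: "(L2_class ?c, v) \<in> A0_hat_core"
      using A0_hat_core_domain[OF sm(1)] by blast
    obtain w where w: "(L2_class ?s, w) \<in> A0_hat_core"
      using A0_hat_core_domain[OF sm(2)] by blast
    have sq: "sq_integrable circle_measure ?c" "sq_integrable circle_measure ?s"
      by (intro sq_integrable_continuous continuous_intros; simp)+
    have "L2_class ?c + (- \<i>) *\<^sub>C L2_class ?s = L2_class (\<lambda>\<alpha>. ?c \<alpha> + (- \<i>) * ?s \<alpha>)"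
      by (simp only: L2_class_scaleC[OF sq(2)] L2_class_plus[OF sq(1) sq_integrable_cmult[OF sq(2)]])
    also have "\<dots> = fourier (delta n)"
      by (simp add: fourier_delta basis_vec_def m(1)[abs_def])
    finally have d: "L2_class ?c + (- \<i>) *\<^sub>C L2_class ?s = fourier (delta n)" .
    have comb: "(fourier (delta n), v + (- \<i>) *\<^sub>C w) \<in> B" if B: "linear_operator B" "A0_hat_core \<subseteq> B" for B
    proof -
      have "(L2_class ?c, v) \<in> B" "((- \<i>) *\<^sub>C L2_class ?s, (- \<i>) *\<^sub>C w) \<in> B"
        using B v w by (auto simp: linear_operator_def)
      then have "(L2_class ?c + (- \<i>) *\<^sub>C L2_class ?s, v + (- \<i>) *\<^sub>C w) \<in> B"
        using B(1) unfolding linear_operator_def by blast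
      then show ?thesis by (simp only: d)
    qed
    obtain y where y: "v + (- \<i>) *\<^sub>C w = fourier y" by (rule fourier_cases)
    have "y = jacobi_delta n"
      using comb[OF lin(2) core_subset_jacobi_hat] jacobi_unique jacobi_delta by (simp only: y jacobi_hat_iff)
    then show ?thesis using comb[OF lin(1)] A by (simp only: y)
  qed
  have adj: "adjoint_graph A = A" using A by (simp add: selfadjoint_def)
  have "A \<subseteq> jacobi_hat"
  proof clarify
    fix u v assume "(u, v) \<in> A"
    then have uv: "(u, v) \<in> adjoint_graph A" by (simp add: adj)
    obtain x y where xy: "u = fourier x" "v = fourier y" by (metis fourier_cases)
    have "cinner x (jacobi_delta n) = cinner y (delta n)" for n
      using uv core[of n] A by (auto simp: adjoint_graph_def xy cinner_fourier[symmetric])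
    then show "(u, v) \<in> jacobi_hat" unfolding xy jacobi_hat_iff by (rule jacobi_if_weak)
  qed
  moreover have "jacobi_hat \<subseteq> A"
  proof clarify
    fix u v assume "(u, v) \<in> jacobi_hat"
    then have "(u, v) \<in> adjoint_graph jacobi_hat" using selfadjoint_jacobi_hat by (simp add: selfadjoint_def)
    then have "(u, v) \<in> adjoint_graph A" using \<open>A \<subseteq> jacobi_hat\<close> by (auto simp: adjoint_graph_def)
    then show "(u, v) \<in> A" by (simp add: adj)
  qed
  ultimately show "A = jacobi_hat" by blast
qed

text \<open>The domain of the conjugate operator is hereby described by a condition on coefficients, which
  makes its commutators computable entry by entry.\<close>

lemma A0_eq: "A0 = jacobi"
  by (simp add: A0_def A0_hat_eq jacobi_hat_iff)


section \<open>The orbit of the free operator under the group\<close>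

text \<open>The derivative of \<open>cos \<alpha>\<close> along \<open>2 sin \<alpha> d/d\<alpha>\<close> is \<open>- 2 sin\<^sup>2 \<alpha>\<close>, whence
  \<open>[i A0, cos_op] = - 2 (1 - cos_op\<^sup>2)\<close>, as can be seen on matrix entries.\<close>

lemma jacobi_commutator:
  assumes "(x, y) \<in> jacobi"
  shows "(ap cos_op x, ap cos_op y + (2 * \<i>) *\<^sub>C ap (1 - cos_op * cos_op) x) \<in> jacobi"
  unfolding jacobi_def
proof (intro CollectI case_prodI allI)
  fix n
  let ?X = "ell2_apply x"
  have y: "\<i> * ell2_apply y k = of_real (of_int k - 1 / 2) * ?X (k - 1) - of_real (of_int k + 1 / 2) * ?X (k + 1)" for k
    using assms by (simp add: jacobi_def)
  have "\<i> * ell2_apply (ap cos_op y + (2 * \<i>) *\<^sub>C ap (1 - cos_op * cos_op) x) n =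
     (\<i> * ell2_apply y (n + 1) + \<i> * ell2_apply y (n - 1)) / 2
     - 2 * (?X n - ((?X (n + 1 + 1) + ?X n) / 2 + (?X n + ?X (n - 1 - 1)) / 2) / 2)"
    by (simp add: ap.diff_left field_simps)
  also have "\<dots> = of_real (of_int n - 1 / 2) * ell2_apply (ap cos_op x) (n - 1) -
      of_real (of_int n + 1 / 2) * ell2_apply (ap cos_op x) (n + 1)"
    unfolding y by (simp add: field_simps)
  finally show "\<i> * ell2_apply (ap cos_op y + (2 * \<i>) *\<^sub>C ap (1 - cos_op * cos_op) x) n =
      of_real (of_int n - 1 / 2) * ell2_apply (ap cos_op x) (n - 1) -
      of_real (of_int n + 1 / 2) * ell2_apply (ap cos_op x) (n + 1)" .
qed

text \<open>The group is differentiable only on the domain of its generator, but a moving vector contributes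
  its own derivative through strong continuity alone.\<close>

lemma unitary_product_derivative:
  fixes v :: "real \<Rightarrow> 'a::complex_hilbert"
  assumes U: "unitary_group U" and v: "(v has_vector_derivative v') (at 0)" and w: "(v 0, w) \<in> generator U"
  shows "((\<lambda>t. blinfun_apply (U t) (v t)) has_vector_derivative \<i> *\<^sub>C w + v') (at 0)"
proof -
  let ?U = "\<lambda>t. blinfun_apply (U t)"
  have iso: "norm (?U t x) = norm x" for t x by (rule unitary_group_isometry[OF U])
  have "((\<lambda>t. ?U t (v t - v 0)) has_vector_derivative v') (at 0)"
    unfolding has_vector_derivative_def has_derivative_at_alt
  proof (intro conjI allI impI)
    show "bounded_linear (\<lambda>h. h *\<^sub>R v')" by (rule bounded_linear_scaleR_left)
    fix e :: real assume e: "e > 0"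
    obtain d1 where d1: "d1 > 0" "\<And>t. norm (t - 0) < d1 \<Longrightarrow>
        norm (v t - v 0 - (t - 0) *\<^sub>R v') \<le> e / 2 * norm (t - 0)"
      using v e unfolding has_vector_derivative_def has_derivative_at_alt by (metis half_gt_zero)
    have "continuous_on UNIV (\<lambda>t. ?U t v')" using U by (simp add: unitary_group_def)
    then have "isCont (\<lambda>t. ?U t v') 0" by (simp add: continuous_on_eq_continuous_at)
    then obtain d2 where d2: "d2 > 0" "\<And>t. dist t 0 < d2 \<Longrightarrow> dist (?U t v') (?U 0 v') < e / 2"
      unfolding continuous_at_eps_delta using e by (metis half_gt_zero)
    have U0: "?U 0 x = x" for x using U by (simp add: unitary_group_def)
    have "norm (?U t (v t - v 0) - ?U 0 (v 0 - v 0) - (t - 0) *\<^sub>R v') \<le> e * norm (t - 0)"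
      if t: "norm (t - 0) < min d1 d2" for t
    proof -
      have "?U t (v t - v 0) - ?U 0 (v 0 - v 0) - (t - 0) *\<^sub>R v' =
          ?U t (v t - v 0 - t *\<^sub>R v') + t *\<^sub>R (?U t v' - v')"
        by (simp add: U0 blinfun.diff_right blinfun.scaleR_right scaleR_diff_right)
      also have "norm \<dots> \<le> norm (v t - v 0 - t *\<^sub>R v') + \<bar>t\<bar> * norm (?U t v' - v')"
        by (rule order_trans[OF norm_triangle_ineq]) (simp add: iso)
      also have "\<dots> \<le> e / 2 * \<bar>t\<bar> + \<bar>t\<bar> * (e / 2)"
        using d1(2)[of t] d2(2)[of t] t by (intro add_mono mult_left_mono) (auto simp: U0 dist_norm)
      finally show ?thesis by (simp add: mult.commute)
    qed
    then show "\<exists>d>0. \<forall>t. norm (t - 0) < d \<longrightarrow>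
        norm (?U t (v t - v 0) - ?U 0 (v 0 - v 0) - (t - 0) *\<^sub>R v') \<le> e * norm (t - 0)"
      using d1(1) d2(1) by (intro exI[of _ "min d1 d2"]) auto
  qed
  moreover have "((\<lambda>t. ?U t (v 0)) has_vector_derivative \<i> *\<^sub>C w) (at 0)"
    using w by (simp add: generator_def)
  ultimately have "((\<lambda>t. ?U t (v 0) + ?U t (v t - v 0)) has_vector_derivative \<i> *\<^sub>C w + v') (at 0)"
    by (rule has_vector_derivative_add[rotated])
  then show ?thesis by (simp add: blinfun.diff_right)
qed

text \<open>Gronwall's lemma, forwards in time for \<open>f\<close> and for its reflection.\<close>

lemma gronwall_zero:
  fixes f :: "real \<Rightarrow> real"
  assumes f: "\<And>t. (f has_real_derivative f' t) (at t)" and f0: "f 0 = 0" and pos: "\<And>t. 0 \<le> f t"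
    and bound: "\<And>t. \<bar>f' t\<bar> \<le> K * f t"
  shows "f t = 0"
proof -
  have ge: "f t = 0" if "t \<ge> 0" "\<And>t. (f has_real_derivative f' t) (at t)" "f 0 = 0" "\<And>t. 0 \<le> f t"
      "\<And>t. f' t \<le> K * f t" for t f f'
  proof -
    have "exp (- K * t) * f t \<le> exp (- K * 0) * f 0"
    proof (rule DERIV_nonpos_imp_nonincreasing[OF that(1)])
      fix s assume "0 \<le> s" "s \<le> t"
      have "((\<lambda>s. exp (- K * s) * f s) has_real_derivative exp (- K * s) * (f' s - K * f s)) (at s)"
        by (auto intro!: derivative_eq_intros that(2) simp: algebra_simps)
      moreover have "exp (- K * s) * (f' s - K * f s) \<le> 0"
        using that(5)[of s] by (intro mult_nonneg_nonpos) auto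
      ultimately show "\<exists>y. ((\<lambda>s. exp (- K * s) * f s) has_real_derivative y) (at s) \<and> y \<le> 0" by blast
    qed
    then have "f t \<le> 0" by (simp add: that(3) mult_le_0_iff)
    then show ?thesis using that(4)[of t] by simp
  qed
  show ?thesis
  proof (cases "t \<ge> 0")
    case True
    show ?thesis by (rule ge[OF True f f0 pos]) (use bound abs_le_D1 in blast)
  next
    case False
    have "((\<lambda>s. f (- s)) has_real_derivative - f' (- s)) (at s)" for s
      using DERIV_mirror[of f "f' (- s)" s] f[of "- s"] by simp
    from ge[of "- t", OF _ this] have "f (- (- t)) = 0"
      using False f0 pos bound[THEN abs_le_D2] by auto
    then show ?thesis by simp
  qed
qed

definition evolution :: "real \<Rightarrow> int ell2 op" where
  "evolution t = Op (exp_i A0 t)"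

lemma unitary_group_A0: "unitary_group (exp_i A0)" and generator_A0: "generator (exp_i A0) = jacobi"
  using stone[OF selfadjoint_jacobi] by (simp_all add: A0_eq)

lemma op_blinfun_evolution: "op_blinfun (evolution t) = exp_i A0 t"
  using unitary_group_A0 by (simp add: evolution_def Op_inverse unitary_group_def)

lemma ap_evolution: "ap (evolution t) x = blinfun_apply (exp_i A0 t) x"
  by (simp add: ap.rep_eq op_blinfun_evolution)

lemma evolution_add: "evolution (s + t) = evolution s * evolution t"
  using unitary_group_A0 by (intro op_eqI) (simp add: ap_evolution unitary_group_def)

lemma evolution_0: "evolution 0 = 1"
  using unitary_group_A0 by (intro op_eqI) (simp add: ap_evolution unitary_group_def)

lemma evolution_inverse: "evolution t * evolution (- t) = 1" "evolution (- t) * evolution t = 1"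
  using evolution_add[of t "- t"] evolution_add[of "- t" t] by (simp_all add: evolution_0)

lemma norm_evolution: "norm (ap (evolution t) x) = norm x"
  unfolding ap_evolution by (rule unitary_group_isometry[OF unitary_group_A0])

lemma evolution_jacobi: "(x, y) \<in> jacobi \<Longrightarrow> (ap (evolution t) x, ap (evolution t) y) \<in> jacobi"
  using generator_invariant(2)[OF unitary_group_A0, of x y t] by (simp add: generator_A0 ap_evolution)

text \<open>Heisenberg equation of motion: the orbit \<open>X\<close> of \<open>cos_op\<close> solves \<open>X' = - 2 (1 - X\<^sup>2)\<close>.\<close>

lemma orbit_derivative:
  assumes zw: "(z, w) \<in> jacobi"
  shows "((\<lambda>t. ap (evolution t * cos_op * evolution (- t)) z) has_vector_derivative
    (- 2) *\<^sub>R (z - ap (evolution t * cos_op * evolution (- t)) (ap (evolution t * cos_op * evolution (- t)) z))) (at t)"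
proof -
  define a where "a = ap (evolution (- t)) z"
  define b where "b = ap (evolution (- t)) w"
  have ab: "(a, b) \<in> jacobi" unfolding a_def b_def by (rule evolution_jacobi[OF zw])
  define v where "v s = ap cos_op (ap (evolution (- s)) a)" for s
  have v0: "v 0 = ap cos_op a" by (simp add: v_def evolution_0)
  have "((\<lambda>s. ap (evolution s) a) has_vector_derivative \<i> *\<^sub>C b) (at 0)"
    using ab unfolding generator_A0[symmetric] by (simp add: generator_def ap_evolution)
  then have "((\<lambda>s. ap (evolution (- s)) a) has_vector_derivative - (\<i> *\<^sub>C b)) (at 0)"
    using vector_diff_chain_at[of uminus "-1" 0 "\<lambda>s. ap (evolution s) a" "\<i> *\<^sub>C b"]
      has_vector_derivative_minus[OF has_vector_derivative_id[of "at (0::real)"]]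
    by (simp add: o_def)
  from bounded_linear.has_vector_derivative[OF ap.bounded_linear_right this, of cos_op]
  have dv: "(v has_vector_derivative ap cos_op (- (\<i> *\<^sub>C b))) (at 0)" by (simp add: v_def[abs_def])
  have gen: "(v 0, ap cos_op b + (2 * \<i>) *\<^sub>C ap (1 - cos_op * cos_op) a) \<in> generator (exp_i A0)"
    unfolding v0 generator_A0 by (rule jacobi_commutator[OF ab])
  have "\<i> *\<^sub>C (ap cos_op b + (2 * \<i>) *\<^sub>C ap (1 - cos_op * cos_op) a) + ap cos_op (- (\<i> *\<^sub>C b)) =
      (- 2) *\<^sub>R ap (1 - cos_op * cos_op) a"
  proof -
    have "\<i> * (2 * \<i>) = complex_of_real (- 2)" by (simp add: complex_eq_iff)
    then show ?thesis
      by (simp only: scaleC_add_right scaleC_scaleC ap.minus_right ap_scaleC scaleR_scaleC[of "- 2"]) simp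
  qed
  with unitary_product_derivative[OF unitary_group_A0 dv gen]
  have "((\<lambda>s. ap (evolution s) (v s)) has_vector_derivative (- 2) *\<^sub>R ap (1 - cos_op * cos_op) a) (at 0)"
    by (simp add: ap_evolution)
  from bounded_linear.has_vector_derivative[OF ap.bounded_linear_right this, of "evolution t"]
  have d: "((\<lambda>s. ap (evolution t) (ap (evolution s) (v s))) has_vector_derivative
      (- 2) *\<^sub>R ap (evolution t) (ap (1 - cos_op * cos_op) a)) (at 0)"
    by (simp only: ap.scaleR_right)
  have "ap (evolution t) (ap (evolution s) (v s)) = ap (evolution (t + s) * cos_op * evolution (- (t + s))) z" for s
  proof -
    have "- (t + s) = - s + - t" by simp
    then have "evolution (- (t + s)) = evolution (- s) * evolution (- t)" by (simp only: evolution_add)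
    then show ?thesis by (simp add: v_def a_def evolution_add)
  qed
  then have d': "((\<lambda>s. ap (evolution (t + s) * cos_op * evolution (- (t + s))) z) has_vector_derivative
      (- 2) *\<^sub>R ap (evolution t) (ap (1 - cos_op * cos_op) a)) (at (t - t))"
    using d by simp
  have "((\<lambda>s. s - t) has_vector_derivative 1) (at t)"
    by (auto intro!: derivative_eq_intros)
  from vector_diff_chain_at[OF this d']
  have "((\<lambda>s. ap (evolution s * cos_op * evolution (- s)) z) has_vector_derivative
      (- 2) *\<^sub>R ap (evolution t) (ap (1 - cos_op * cos_op) a)) (at t)"
    by (simp add: o_def)
  moreover have "ap (evolution t) (ap (1 - cos_op * cos_op) a) =
      z - ap (evolution t * cos_op * evolution (- t)) (ap (evolution t * cos_op * evolution (- t)) z)"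
  proof -
    have c: "ap (evolution (- t)) (ap (evolution t) x) = x" "ap (evolution t) (ap (evolution (- t)) x) = x" for x
      by (simp_all add: ap_mult[symmetric] evolution_inverse del: ap_mult)
    show ?thesis by (simp add: ap.diff_left ap.diff_right a_def c)
  qed
  ultimately show ?thesis by simp
qed

text \<open>The Riccati equation is solved by the Moebius transform of \<open>cos_op\<close> with parameter
  \<open>tanh 2t\<close>; the difference \<open>E\<close> of the two sides of the cleared equation satisfies the linear
  equation \<open>E' = 2 X E\<close>.\<close>

lemma orbit_cos_op:
  "evolution t * cos_op * evolution (- t) * (cosh (2 * t) *\<^sub>R 1 - sinh (2 * t) *\<^sub>R cos_op) =
    cosh (2 * t) *\<^sub>R cos_op - sinh (2 * t) *\<^sub>R 1"
proof -
  define X where "X t = evolution t * cos_op * evolution (- t)" for t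
  define E where "E t = X t * (cosh (2 * t) *\<^sub>R 1 - sinh (2 * t) *\<^sub>R cos_op)
    - (cosh (2 * t) *\<^sub>R cos_op - sinh (2 * t) *\<^sub>R 1)" for t
  have nX: "norm (ap (X t) x) \<le> norm x" for t x
  proof -
    have "norm (ap (X t) x) = norm (ap cos_op (ap (evolution (- t)) x))" by (simp add: X_def norm_evolution)
    also have "\<dots> \<le> norm cos_op * norm (ap (evolution (- t)) x)" by (rule norm_ap)
    also have "\<dots> \<le> 1 * norm (ap (evolution (- t)) x)" by (intro mult_right_mono norm_cos_op) simp
    finally show ?thesis by (simp add: norm_evolution)
  qed
  have zero: "ap (E t) x = 0" if xy: "(x, y) \<in> jacobi" for x y t
  proof -
    let ?x' = "ap cos_op x"
    have dX: "((\<lambda>t. ap (X t) z) has_vector_derivative (- 2) *\<^sub>R (z - ap (X t) (ap (X t) z))) (at t)"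
      if "z \<in> {x, ?x'}" for z t
      using that orbit_derivative[OF xy, of t] orbit_derivative[OF jacobi_commutator[OF xy], of t]
      unfolding X_def by auto
    have Eeq: "ap (E t) x = cosh (2 * t) *\<^sub>R ap (X t) x - sinh (2 * t) *\<^sub>R ap (X t) ?x'
        - (cosh (2 * t) *\<^sub>R ?x' - sinh (2 * t) *\<^sub>R x)" for t
      by (simp add: E_def ap.diff_left ap.diff_right ap.scaleR_left ap.scaleR_right)
    have dE: "((\<lambda>t. ap (E t) x) has_vector_derivative 2 *\<^sub>R ap (X t) (ap (E t) x)) (at t)" for t
    proof -
      have dc: "((\<lambda>t. cosh (2 * t)) has_real_derivative 2 * sinh (2 * t)) (at t)"
        "((\<lambda>t. sinh (2 * t)) has_real_derivative 2 * cosh (2 * t)) (at t)"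
        by (auto intro!: derivative_eq_intros)
      have "((\<lambda>t. ap (E t) x) has_vector_derivative
          (cosh (2 * t) *\<^sub>R ((- 2) *\<^sub>R (x - ap (X t) (ap (X t) x))) + (2 * sinh (2 * t)) *\<^sub>R ap (X t) x)
          - (sinh (2 * t) *\<^sub>R ((- 2) *\<^sub>R (?x' - ap (X t) (ap (X t) ?x'))) + (2 * cosh (2 * t)) *\<^sub>R ap (X t) ?x')
          - ((cosh (2 * t) *\<^sub>R 0 + (2 * sinh (2 * t)) *\<^sub>R ?x') - (sinh (2 * t) *\<^sub>R 0 + (2 * cosh (2 * t)) *\<^sub>R x))) (at t)"
        unfolding Eeq
        by (intro has_vector_derivative_diff has_vector_derivative_scaleR dc dX has_vector_derivative_const) auto
      then show ?thesis
        by (rule has_vector_derivative_eq_rhs)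
          (simp add: Eeq ap.diff_right ap.add_right ap.scaleR_right scaleR_diff_right algebra_simps)
    qed
    have "inner (ap (E t) x) (ap (E t) x) = 0"
    proof (rule gronwall_zero[where f = "\<lambda>t. inner (ap (E t) x) (ap (E t) x)" and f' = "\<lambda>t. 4 * inner (ap (E t) x) (ap (X t) (ap (E t) x))" and K = 4])
      fix t
      have "((\<lambda>t. ap (E t) x) has_derivative (\<lambda>h. h *\<^sub>R (2 *\<^sub>R ap (X t) (ap (E t) x)))) (at t)"
        using dE[of t] by (simp add: has_vector_derivative_def)
      from has_derivative_inner[OF this this]
      show "((\<lambda>t. inner (ap (E t) x) (ap (E t) x)) has_real_derivative
          4 * inner (ap (E t) x) (ap (X t) (ap (E t) x))) (at t)"
        unfolding has_field_derivative_def
        by (rule has_derivative_eq_rhs)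
          (simp add: fun_eq_iff inner_commute[of "ap (X t) (ap (E t) x)" "ap (E t) x"])
      have "\<bar>inner (ap (E t) x) (ap (X t) (ap (E t) x))\<bar> \<le> norm (ap (E t) x) * norm (ap (X t) (ap (E t) x))"
        by (rule Cauchy_Schwarz_ineq2)
      also have "\<dots> \<le> norm (ap (E t) x) * norm (ap (E t) x)" by (intro mult_left_mono nX) simp
      finally show "\<bar>4 * inner (ap (E t) x) (ap (X t) (ap (E t) x))\<bar> \<le> 4 * inner (ap (E t) x) (ap (E t) x)"
        by (simp add: abs_mult power2_norm_eq_inner[symmetric] power2_eq_square)
      show "inner (ap (E 0) x) (ap (E 0) x) = 0" by (simp add: Eeq X_def evolution_0)
    qed simp
    then show ?thesis by simp
  qed
  have "E t = 0"
  proof (rule op_eqI)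
    fix x
    have "closed {x. ap (E t) x = 0}"
      by (intro closed_Collect_eq continuous_on_const linear_continuous_on ap.bounded_linear_right)
    then have "closure (Domain jacobi) \<subseteq> {x. ap (E t) x = 0}"
      by (rule closure_minimal[rotated]) (use zero in auto)
    then show "ap (E t) x = ap 0 x" by (auto simp: dense_jacobi ap.zero_left)
  qed
  then show ?thesis by (simp add: E_def X_def)
qed


section \<open>Analytic deformation of the perturbed operator\<close>

text \<open>The orbit of the free operator as a function of \<open>\<tau> = tanh 2t\<close>, continued from the real interval
  to the complex unit disc.\<close>

definition deformed_free :: "complex \<Rightarrow> int ell2 op" where
  "deformed_free \<tau> = sc 2 - sc 2 * ((cos_op - sc \<tau>) * op_inv (1 - sc \<tau> * cos_op))"

lemma regular_one_minus_cos_op: "cmod \<tau> < 1 \<Longrightarrow> regular (1 - sc \<tau> * cos_op)"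
proof (rule regular_one_minus)
  assume "cmod \<tau> < 1"
  moreover have "norm (sc \<tau> * cos_op) \<le> cmod \<tau> * 1"
    unfolding norm_sc_mult by (intro mult_left_mono norm_cos_op) simp
  ultimately show "norm (sc \<tau> * cos_op) < 1" by simp
qed

lemma evolution_free_op:
  fixes t :: real
  shows "evolution t * Op free_op * evolution (- t) = deformed_free (complex_of_real (tanh (2 * t)))"
proof -
  let ?X = "evolution t * cos_op * evolution (- t)" and ?\<tau> = "complex_of_real (tanh (2 * t))"
  have c: "cosh (2 * t) \<noteq> 0" using cosh_real_pos[of "2 * t"] by simp
  have "cmod ?\<tau> < 1" using tanh_real_lt_1[of "2 * t"] tanh_real_gt_neg1[of "2 * t"]
    by (simp add: abs_less_iff)
  then have reg: "regular (1 - sc ?\<tau> * cos_op)" by (rule regular_one_minus_cos_op)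
  have s: "sinh (2 * t) = cosh (2 * t) * tanh (2 * t)" using c by (simp add: tanh_def)
  have e1: "cosh (2 * t) *\<^sub>R 1 - sinh (2 * t) *\<^sub>R cos_op = cosh (2 * t) *\<^sub>R (1 - sc ?\<tau> * cos_op)"
    "cosh (2 * t) *\<^sub>R cos_op - sinh (2 * t) *\<^sub>R 1 = cosh (2 * t) *\<^sub>R (cos_op - sc ?\<tau>)"
    by (simp_all add: s sc_of_real scaleR_diff_right)
  have "cosh (2 * t) *\<^sub>R (?X * (1 - sc ?\<tau> * cos_op)) = cosh (2 * t) *\<^sub>R (cos_op - sc ?\<tau>)"
    using orbit_cos_op[of t] unfolding e1 by simp
  then have "?X * (1 - sc ?\<tau> * cos_op) = cos_op - sc ?\<tau>" using c by simp
  then have "?X * ((1 - sc ?\<tau> * cos_op) * op_inv (1 - sc ?\<tau> * cos_op)) =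
      (cos_op - sc ?\<tau>) * op_inv (1 - sc ?\<tau> * cos_op)"
    by (simp only: mult.assoc[symmetric])
  then have X: "?X = (cos_op - sc ?\<tau>) * op_inv (1 - sc ?\<tau> * cos_op)" by (simp only: op_inv[OF reg] mult_1_right)
  have "evolution t * Op free_op * evolution (- t) = sc 2 * (evolution t * evolution (- t)) - sc 2 * ?X"
    by (simp add: free_op_eq left_diff_distrib right_diff_distrib mult.assoc sc_left_commute sc_commute)
  then show ?thesis by (simp only: evolution_inverse mult_1_right X deformed_free_def)
qed

text \<open>With the spectral parameter written as \<open>\<lambda> = 2 - 2 \<mu>\<close>, the deformed free operator minus
  \<open>\<lambda>\<close> is, up to invertible factors, this pencil.\<close>

definition pencil :: "complex \<Rightarrow> complex \<Rightarrow> int ell2 op" where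
  "pencil \<mu> \<tau> = sc (\<mu> + \<tau>) - sc (1 + \<mu> * \<tau>) * cos_op"

lemma deformed_free_pencil:
  assumes "cmod \<tau> < 1"
  shows "deformed_free \<tau> - sc (2 - 2 * \<mu>) = sc 2 * (pencil \<mu> \<tau> * op_inv (1 - sc \<tau> * cos_op))"
proof -
  let ?D = "1 - sc \<tau> * cos_op"
  have D: "?D * op_inv ?D = 1" using op_inv[OF regular_one_minus_cos_op[OF assms]] by simp
  have "deformed_free \<tau> - sc (2 - 2 * \<mu>) = sc 2 * (sc \<mu> - (cos_op - sc \<tau>) * op_inv ?D)"
    by (simp add: deformed_free_def sc_diff sc_mult right_diff_distrib)
  also have "sc \<mu> = sc \<mu> * ?D * op_inv ?D" by (simp add: mult.assoc D)
  also have "sc \<mu> * ?D * op_inv ?D - (cos_op - sc \<tau>) * op_inv ?D = (sc \<mu> * ?D - (cos_op - sc \<tau>)) * op_inv ?D"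
    by (simp only: left_diff_distrib)
  also have "sc \<mu> * ?D - (cos_op - sc \<tau>) = pencil \<mu> \<tau>"
    by (simp add: pencil_def sc_add sc_mult algebra_simps)
  finally show ?thesis .
qed

text \<open>The pencil is a multiple of \<open>m - cos_op\<close> with \<open>m = (\<mu> + \<tau>) / (1 + \<mu> \<tau>)\<close>, and the sign of the
  imaginary part of \<open>m\<close> is the sign of this expression. For \<open>\<mu>\<close> and \<open>\<tau>\<close> in the open unit disc
  with nonnegative imaginary parts it is positive as soon as one of them is not real.\<close>

lemma im_pencil_parameter:
  "Im ((\<mu> + \<tau>) * cnj (1 + \<mu> * \<tau>)) = Im \<mu> * (1 - (cmod \<tau>)\<^sup>2) + Im \<tau> * (1 - (cmod \<mu>)\<^sup>2)"
  unfolding cmod_power2 by (simp add: power2_eq_square algebra_simps)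

lemma regular_pencil:
  assumes "Im ((\<mu> + \<tau>) * cnj (1 + \<mu> * \<tau>)) \<noteq> 0"
  shows "regular (pencil \<mu> \<tau>)"
proof -
  have n0: "1 + \<mu> * \<tau> \<noteq> 0"
  proof
    assume "1 + \<mu> * \<tau> = 0"
    then show False using assms by (simp only: complex_cnj_zero mult_zero_right zero_complex.sel)
  qed
  define m where "m = (\<mu> + \<tau>) / (1 + \<mu> * \<tau>)"
  have "m = (\<mu> + \<tau>) * cnj (1 + \<mu> * \<tau>) / of_real ((cmod (1 + \<mu> * \<tau>))\<^sup>2)"
    unfolding m_def by (rule complex_div_cnj)
  then have "Im m = Im ((\<mu> + \<tau>) * cnj (1 + \<mu> * \<tau>)) / (cmod (1 + \<mu> * \<tau>))\<^sup>2"
    by (simp only: Im_divide_of_real)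
  then have "Im m \<noteq> 0" using assms n0 by simp
  then have "m \<notin> complex_of_real ` {-1..1}" by auto
  then have "regular (sc (- (1 + \<mu> * \<tau>)) * (cos_op - sc m))"
    using n0 by (intro regular_mult regular_sc regular_cos_op_minus) (simp add: add_eq_0_iff neg_eq_iff_add_eq_0)
  moreover have "sc (- (1 + \<mu> * \<tau>)) * (cos_op - sc m) = pencil \<mu> \<tau>"
  proof -
    have "sc (1 + \<mu> * \<tau>) * sc m = sc (\<mu> + \<tau>)"
      by (simp only: sc_mult[symmetric] m_def times_divide_eq_right nonzero_mult_div_cancel_left[OF n0])
    then show ?thesis by (simp only: pencil_def sc_uminus right_diff_distrib mult_minus_left) simp
  qed
  ultimately show ?thesis by simp
qed

text \<open>\<open>W \<tau>\<close> times the resolvent of the deformed free operator at \<open>2 - 2 \<mu>\<close>.\<close>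

definition birman_schwinger :: "(complex \<Rightarrow> int ell2 op) \<Rightarrow> complex \<Rightarrow> complex \<Rightarrow> int ell2 op" where
  "birman_schwinger W \<mu> \<tau> = W \<tau> * ((1 - sc \<tau> * cos_op) * op_inv (pencil \<mu> \<tau>) * sc (1 / 2))"

lemma regular_deformed_iff:
  assumes \<tau>: "cmod \<tau> < 1" and reg: "regular (pencil \<mu> \<tau>)"
  shows "regular (deformed_free \<tau> + W \<tau> - sc (2 - 2 * \<mu>)) \<longleftrightarrow> regular (1 + birman_schwinger W \<mu> \<tau>)"
proof -
  let ?D = "1 - sc \<tau> * cos_op" and ?L = "pencil \<mu> \<tau>"
  let ?T = "sc 2 * (?L * op_inv ?D)" and ?R = "?D * op_inv ?L * sc (1 / 2)"
  have D: "regular ?D" by (rule regular_one_minus_cos_op[OF \<tau>])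
  have T: "regular ?T" by (intro regular_mult regular_sc reg regular_op_inv D) simp
  have "?R * ?T = ?D * (op_inv ?L * (sc (1 / 2) * sc 2 * (?L * op_inv ?D)))"
    by (simp only: mult.assoc)
  also have "sc (1 / 2) * sc 2 = 1" by (simp add: sc_mult[symmetric])
  also have "?D * (op_inv ?L * (1 * (?L * op_inv ?D))) = ?D * ((op_inv ?L * ?L) * op_inv ?D)"
    by (simp only: mult.assoc mult_1_left)
  also have "\<dots> = 1" by (simp only: op_inv[OF reg] op_inv[OF D] mult_1_left)
  finally have RT: "?R * ?T = 1" .
  have "(1 + birman_schwinger W \<mu> \<tau>) * ?T = ?T + W \<tau> * (?R * ?T)"
    by (simp only: birman_schwinger_def distrib_right mult_1_left mult.assoc)
  also have "\<dots> = deformed_free \<tau> + W \<tau> - sc (2 - 2 * \<mu>)"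
    unfolding RT mult_1_right by (simp add: deformed_free_pencil[OF \<tau>, of \<mu>, symmetric])
  finally show ?thesis using regular_mult_right_iff[OF T] by metis
qed

lemma op_hol_pencil: "op_hol_at (\<lambda>\<mu>. pencil \<mu> \<tau>) \<mu>" "op_hol_at (\<lambda>\<tau>. pencil \<mu> \<tau>) \<tau>"
  unfolding pencil_def
  by (intro op_hol_at_diff op_hol_at_mult op_hol_at_const op_hol_at_sc field_differentiable_add
      field_differentiable_mult field_differentiable_const field_differentiable_ident)+

lemma op_hol_birman_schwinger:
  assumes "regular (pencil \<mu> \<tau>)"
  shows "op_hol_at (\<lambda>\<mu>. birman_schwinger W \<mu> \<tau>) \<mu>"
    and "op_hol_at W \<tau> \<Longrightarrow> op_hol_at (\<lambda>\<tau>. birman_schwinger W \<mu> \<tau>) \<tau>"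
  unfolding birman_schwinger_def
  by (intro op_hol_at_diff op_hol_at_mult op_hol_at_const op_hol_at_sc op_hol_at_op_inv op_hol_pencil assms;
      simp)+

lemma op_hol_deformed_free:
  assumes "cmod \<tau> < 1"
  shows "op_hol_at deformed_free \<tau>"
  unfolding deformed_free_def[abs_def]
  by (intro op_hol_at_diff op_hol_at_mult op_hol_at_const op_hol_at_sc op_hol_at_op_inv
      regular_one_minus_cos_op assms; simp)

lemma approximable_birman_schwinger: "approximable (W \<tau>) \<Longrightarrow> approximable (birman_schwinger W \<mu> \<tau>)"
  unfolding birman_schwinger_def by (rule approximable_mult)

lemma compact_image_mult:
  assumes T: "compact (closure (ap T ` cball 0 1))" and S: "\<And>x. norm (ap S x) \<le> norm x"
  shows "compact (closure (ap (B * T * S) ` cball 0 1))"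
proof -
  let ?C = "ap B ` closure (ap T ` cball 0 1)"
  have C: "compact ?C"
    by (intro compact_continuous_image T linear_continuous_on ap.bounded_linear_right)
  have "ap (B * T * S) ` cball 0 1 \<subseteq> ?C"
  proof clarify
    fix x :: 'a assume "x \<in> cball 0 1"
    then have "ap S x \<in> cball 0 1" using S[of x] by simp
    then have "ap T (ap S x) \<in> closure (ap T ` cball 0 1)" by (intro subsetD[OF closure_subset] imageI)
    then show "ap (B * T * S) x \<in> ?C" by simp
  qed
  then have "closure (ap (B * T * S) ` cball 0 1) \<subseteq> ?C"
    by (rule closure_minimal) (rule compact_imp_closed[OF C])
  then show ?thesis using compact_Int_closed[OF C closed_closure] by (metis inf.absorb_iff2)
qed

lemma op_hol_at_Op:
  assumes S: "open S" "z \<in> S" and F: "\<And>w. w \<in> S \<Longrightarrow> F w \<in> bounded_ops" and D: "D \<in> bounded_ops"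
    and der: "(F has_derivative (\<lambda>h. scalar_op h o\<^sub>L D)) (at z within S)"
  shows "op_hol_at (\<lambda>w. Op (F w)) z"
proof -
  obtain r where r: "r > 0" "ball z r \<subseteq> S" using S open_contains_ball by blast
  have nrm: "norm (Op (F y) - Op (F z) - sc (y - z) * Op D) = norm (F y - F z - (scalar_op (y - z) o\<^sub>L D))"
    if "y \<in> S" for y
    using that F S D
    by (simp add: norm_op.rep_eq minus_op.rep_eq times_op.rep_eq sc.rep_eq Op_inverse)
  have "((\<lambda>w. Op (F w)) has_derivative (\<lambda>h. sc h * Op D)) (at z)"
    unfolding has_derivative_at_alt
  proof (intro conjI allI impI)
    show "bounded_linear (\<lambda>h. sc h * Op D)"
      by (rule bounded_linear_compose[OF bounded_linear_mult_left bounded_linear_sc])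
    fix e :: real assume e: "e > 0"
    have "(F has_derivative (\<lambda>h. scalar_op h o\<^sub>L D)) (at z)" using der by (simp only: at_within_open[OF S(2,1)])
    then obtain d where d: "d > 0" "\<And>y. norm (y - z) < d \<Longrightarrow>
        norm (F y - F z - (scalar_op (y - z) o\<^sub>L D)) \<le> e * norm (y - z)"
      using e unfolding has_derivative_at_alt by blast
    have "norm (Op (F y) - Op (F z) - sc (y - z) * Op D) \<le> e * norm (y - z)" if "norm (y - z) < min d r" for y
    proof -
      have "y \<in> ball z r" using that by (simp add: dist_norm norm_minus_commute)
      then have "y \<in> S" using r(2) by blast
      from nrm[OF this] d(2)[of y] that show ?thesis by simp
    qed
    then show "\<exists>d>0. \<forall>y. norm (y - z) < d \<longrightarrow>
        norm (Op (F y) - Op (F z) - sc (y - z) * Op D) \<le> e * norm (y - z)"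
      using d(1) r(1) by (intro exI[of _ "min d r"]) auto
  qed
  then show ?thesis unfolding op_hol_at_def by blast
qed

text \<open>The inverse of \<open>t \<mapsto> tanh 2t\<close>.\<close>

definition group_time :: "complex \<Rightarrow> complex" where
  "group_time \<tau> = Ln ((1 + \<tau>) / (1 - \<tau>)) / 4"

lemma group_time_differentiable:
  assumes "cmod \<tau> < 1"
  shows "group_time field_differentiable (at \<tau>)"
proof -
  have ln: "(1 + z) / (1 - z) \<notin> \<real>\<^sub>\<le>\<^sub>0" if "cmod z < 1" for z
  proof -
    have "(cmod z)\<^sup>2 < 1" using that by (simp add: power_less_one_iff abs_square_less_1)
    then have "0 < Re ((1 + z) * cnj (1 - z))"
      unfolding cmod_power2 by (simp add: power2_eq_square algebra_simps)
    then have "0 < Re ((1 + z) / (1 - z))" by (simp only: Re_complex_div_gt_0)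
    then show ?thesis by (auto simp: complex_nonpos_Reals_iff)
  qed
  have "group_time holomorphic_on ball 0 1"
    unfolding group_time_def[abs_def] by (intro holomorphic_intros) (use ln in auto)
  then show ?thesis using assms by (intro holomorphic_on_imp_differentiable_at) auto
qed

lemma group_time_real:
  assumes "\<bar>s\<bar> < 1"
  obtains t where "group_time (complex_of_real s) = complex_of_real t" "tanh (2 * t) = s"
proof -
  define y where "y = (1 + s) / (1 - s)"
  have y: "y > 0" using assms by (simp add: y_def)
  show ?thesis
  proof (rule that[of "ln y / 4"])
    have "(1 + complex_of_real s) / (1 - complex_of_real s) = complex_of_real y" by (simp add: y_def)
    then show "group_time (complex_of_real s) = complex_of_real (ln y / 4)"
      using y by (simp add: group_time_def Ln_of_real)
    have "2 * (ln y / 4) = ln (sqrt y)" using y by (simp add: ln_sqrt)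
    then have "tanh (2 * (ln y / 4)) = (y - 1) / (y + 1)"
      using y tanh_ln_real[of "sqrt y"] by simp
    also have "\<dots> = s" using assms by (simp add: y_def field_simps)
    finally show "tanh (2 * (ln y / 4)) = s" .
  qed
qed

section \<open>Limit points of the discrete spectrum\<close>

text \<open>\<open>W\<close> is the orbit of the perturbation \<open>V\<close>, as a function of the same parameter \<open>\<tau>\<close>
  that the deformed free operator has. It is kept abstract, since only these properties enter the
  spectral argument.\<close>

locale deformation =
  fixes V :: "int ell2 op" and W :: "complex \<Rightarrow> int ell2 op" and \<epsilon> :: real
  assumes compact_V: "compact (closure (ap V ` cball 0 1))"
    and eps: "0 < \<epsilon>" "\<epsilon> < 1"
    and W_hol: "cmod \<tau> < \<epsilon> \<Longrightarrow> op_hol_at W \<tau>"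
    and W_app: "cmod \<tau> < \<epsilon> \<Longrightarrow> approximable (W \<tau>)"
    and W_real: "\<bar>s\<bar> < \<epsilon> \<Longrightarrow> \<exists>t. W (complex_of_real s) = evolution t * V * evolution (- t) \<and>
      deformed_free (complex_of_real s) = evolution t * Op free_op * evolution (- t)"

text \<open>Conjugation by the group preserves compactness, and the compact operators form a closed
  subspace, so all values of the holomorphic extension are compact.\<close>

lemma deformation_exists:
  assumes V: "compact_op V" "V \<in> analytic_class A0"
  obtains W \<epsilon> where "deformation (Op V) W \<epsilon>"
proof -
  obtain R F where R: "R > 0" and Vb: "V \<in> bounded_ops" and F: "op_holomorphic_on F (ball 0 R)"
    and Freal: "\<And>t::real. \<bar>t\<bar> < R \<Longrightarrow> F (complex_of_real t) = exp_i A0 t o\<^sub>L V o\<^sub>L exp_i A0 (- t)"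
    using V(2) unfolding analytic_class_def analytic_class_R_def by blast
  define Fo where "Fo z = Op (F z)" for z
  have Fb: "F z \<in> bounded_ops" if "cmod z < R" for z using F that by (auto simp: op_holomorphic_on_def)
  have hol: "op_hol_at Fo z" if "cmod z < R" for z
  proof -
    have "z \<in> ball 0 R" using that by simp
    then obtain D where "D \<in> bounded_ops" "(F has_derivative (\<lambda>h. scalar_op h o\<^sub>L D)) (at z within ball 0 R)"
      using F unfolding op_holomorphic_on_def by blast
    then show ?thesis
      unfolding Fo_def[abs_def] using that Fb by (intro op_hol_at_Op[of "ball 0 R"]) auto
  qed
  have apV: "ap (Op V) = blinfun_apply V" by (rule ext) (simp add: ap.rep_eq Op_inverse Vb)
  have cV: "compact (closure (ap (Op V) ` cball 0 1))"
    using V(1) unfolding apV by (simp add: compact_op_def)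
  have Fo_real: "Fo (complex_of_real t) = evolution t * Op V * evolution (- t)" if "\<bar>t\<bar> < R" for t
  proof (rule op_eqI)
    fix x
    have "F (complex_of_real t) \<in> bounded_ops" using that by (intro Fb) simp
    then show "ap (Fo (complex_of_real t)) x = ap (evolution t * Op V * evolution (- t)) x"
      by (simp add: Fo_def ap.rep_eq Op_inverse Freal[OF that] ap_evolution apV)
        (simp add: ap.rep_eq[symmetric] ap_evolution apV)
  qed
  have app: "Fo z \<in> {T. approximable T}" if "cmod z < R" for z
  proof (rule op_hol_in_closed_subspace[OF hol])
    show "closed {T. approximable T}" by (rule closed_approximable)
    fix t :: real assume "\<bar>t\<bar> < R"
    then show "Fo (complex_of_real t) \<in> {T. approximable T}"
      unfolding Fo_real[OF \<open>\<bar>t\<bar> < R\<close>]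
      by (intro CollectI approximable_if_compact compact_image_mult cV) (simp add: norm_evolution)
  qed (use that in \<open>auto simp: approximable_0 approximable_add approximable_sc\<close>)
  have "isCont group_time 0"
    by (rule field_differentiable_imp_continuous_at[OF group_time_differentiable]) simp
  then obtain d where d: "d > 0" "\<And>\<tau>. cmod \<tau> < d \<Longrightarrow> cmod (group_time \<tau>) < R"
    unfolding continuous_at_eps_delta using R by (auto simp: group_time_def)
  define \<epsilon> where "\<epsilon> = min d (1 / 2)"
  have ed: "\<epsilon> \<le> d" "\<epsilon> \<le> 1 / 2" "0 < \<epsilon>" using d(1) by (auto simp: \<epsilon>_def)
  have "deformation (Op V) (\<lambda>\<tau>. Fo (group_time \<tau>)) \<epsilon>"
  proof
    show "compact (closure (ap (Op V) ` cball 0 1))" by (rule cV)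
    show "0 < \<epsilon>" "\<epsilon> < 1" using ed by auto
    show "op_hol_at (\<lambda>\<tau>. Fo (group_time \<tau>)) \<tau>" if "cmod \<tau> < \<epsilon>" for \<tau>
      by (rule op_hol_at_compose[OF group_time_differentiable hol]) (use that ed d(2)[of \<tau>] in auto)
    show "approximable (Fo (group_time \<tau>))" if "cmod \<tau> < \<epsilon>" for \<tau>
      using app[of "group_time \<tau>"] that ed d(2)[of \<tau>] by auto
    show "\<exists>t. Fo (group_time (complex_of_real s)) = evolution t * Op V * evolution (- t) \<and>
        deformed_free (complex_of_real s) = evolution t * Op free_op * evolution (- t)" if s: "\<bar>s\<bar> < \<epsilon>" for s
    proof -
      have "\<bar>s\<bar> < 1" using s ed by simp
      then obtain t where t: "group_time (complex_of_real s) = complex_of_real t" "tanh (2 * t) = s"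
        by (rule group_time_real)
      have "cmod (group_time (complex_of_real s)) < R" using s ed by (intro d(2)) simp
      then have "\<bar>t\<bar> < R" by (simp add: t(1))
      then show ?thesis using Fo_real[of t] evolution_free_op[of t] by (auto simp: t)
    qed
  qed
  then show ?thesis by (rule that)
qed

context deformation
begin

definition singular_set :: "complex set" where
  "singular_set = {\<mu>. \<not> regular (Op free_op + V - sc (2 - 2 * \<mu>))}"

text \<open>A real parameter means a unitary conjugation, which preserves the spectrum.\<close>

lemma regular_at_real:
  assumes "\<bar>s\<bar> < \<epsilon>"
  shows "regular (deformed_free (complex_of_real s) + W (complex_of_real s) - sc z) \<longleftrightarrow>
    regular (Op free_op + V - sc z)"
proof -
  obtain t where t: "W (complex_of_real s) = evolution t * V * evolution (- t)"
    "deformed_free (complex_of_real s) = evolution t * Op free_op * evolution (- t)"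
    using W_real[OF assms] by blast
  have "evolution t * sc z * evolution (- t) = sc z"
    by (simp only: sc_commute mult.assoc evolution_inverse mult_1_right)
  then have "deformed_free (complex_of_real s) + W (complex_of_real s) - sc z =
      evolution t * ((Op free_op + V - sc z) * evolution (- t))"
    by (simp add: t distrib_left distrib_right left_diff_distrib right_diff_distrib mult.assoc)
  moreover have "regular (evolution t)" "regular (evolution (- t))"
    using evolution_inverse by (auto intro: regularI)
  ultimately show ?thesis by (simp add: regular_mult_left_iff regular_mult_right_iff)
qed

text \<open>Eigenvalues of the perturbed operator do not move under the deformation: in the parameter
  \<open>\<tau>\<close> they persist on the real axis, hence by the Fredholm alternative throughout.\<close>

lemma singular_persists:
  assumes \<sigma>: "\<sigma> = 1 \<or> \<sigma> = - 1" and \<mu>: "cmod \<mu> < 1" "0 < \<sigma> * Im \<mu>" "\<mu> \<in> singular_set"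
    and \<tau>: "cmod \<tau> < \<epsilon>" "0 \<le> \<sigma> * Im \<tau>"
  shows "\<not> regular (1 + birman_schwinger W \<mu> \<tau>)"
proof
  assume reg: "regular (1 + birman_schwinger W \<mu> \<tau>)"
  have \<sigma>2: "\<sigma> * \<sigma> = 1" using \<sigma> by auto
  define \<delta> where "\<delta> = \<sigma> * Im \<mu> * (1 - \<epsilon>\<^sup>2)"
  have e2: "\<epsilon>\<^sup>2 < 1" using eps by (simp add: power_less_one_iff abs_square_less_1)
  have \<delta>: "0 < \<delta>" unfolding \<delta>_def using \<mu>(2) e2 by simp
  define \<Omega> where "\<Omega> = ball 0 \<epsilon> \<inter> {\<tau>. inner (Complex 0 \<sigma>) \<tau> > - \<delta>}"
  have mem: "\<tau> \<in> \<Omega> \<longleftrightarrow> cmod \<tau> < \<epsilon> \<and> - \<delta> < \<sigma> * Im \<tau>" for \<tau>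
    by (simp add: \<Omega>_def inner_complex_def)
  have pen: "regular (pencil \<mu> \<tau>)" if "\<tau> \<in> \<Omega>" for \<tau>
  proof (rule regular_pencil)
    have \<tau>: "cmod \<tau> < \<epsilon>" "- \<delta> < \<sigma> * Im \<tau>" using that by (auto simp: mem)
    have m: "0 < 1 - (cmod \<mu>)\<^sup>2" "1 - (cmod \<mu>)\<^sup>2 \<le> 1"
      using \<mu>(1) by (simp_all add: power_less_one_iff abs_square_less_1)
    have "(cmod \<tau>)\<^sup>2 \<le> \<epsilon>\<^sup>2" using \<tau>(1) by (intro power_mono) auto
    then have "\<delta> \<le> \<sigma> * Im \<mu> * (1 - (cmod \<tau>)\<^sup>2)"
      unfolding \<delta>_def using \<mu>(2) by (intro mult_left_mono) auto
    moreover have "- \<delta> < \<sigma> * Im \<tau> * (1 - (cmod \<mu>)\<^sup>2)"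
    proof (cases "0 \<le> \<sigma> * Im \<tau>")
      case True
      then have "0 \<le> \<sigma> * Im \<tau> * (1 - (cmod \<mu>)\<^sup>2)" by (rule mult_nonneg_nonneg[OF _ less_imp_le[OF m(1)]])
      then show ?thesis using \<delta> by simp
    next
      case False
      then have "\<sigma> * Im \<tau> * 1 \<le> \<sigma> * Im \<tau> * (1 - (cmod \<mu>)\<^sup>2)"
        using m by (intro mult_left_mono_neg) auto
      then show ?thesis using \<tau>(2) by simp
    qed
    ultimately have "0 < \<sigma> * (Im \<mu> * (1 - (cmod \<tau>)\<^sup>2) + Im \<tau> * (1 - (cmod \<mu>)\<^sup>2))"
      by (simp add: distrib_left mult.assoc)
    then show "Im ((\<mu> + \<tau>) * cnj (1 + \<mu> * \<tau>)) \<noteq> 0" unfolding im_pencil_parameter by auto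
  qed
  have "\<not> 0 islimpt {z \<in> \<Omega>. \<not> regular (1 + birman_schwinger W \<mu> z)}"
  proof (rule analytic_fredholm)
    show "open \<Omega>" unfolding \<Omega>_def by (intro open_Int open_ball open_halfspace_gt)
    show "connected \<Omega>" unfolding \<Omega>_def by (intro convex_connected convex_Int convex_ball convex_halfspace_gt)
    show "op_hol_at (birman_schwinger W \<mu>) z" if "z \<in> \<Omega>" for z
      using op_hol_birman_schwinger(2)[OF pen[OF that] W_hol] that by (simp add: mem)
    show "approximable (birman_schwinger W \<mu> z)" if "z \<in> \<Omega>" for z
      using that by (intro approximable_birman_schwinger W_app) (simp add: mem)
    show "\<tau> \<in> \<Omega>" using \<tau> \<delta> by (simp add: mem)
    show "0 \<in> \<Omega>" using eps \<delta> by (simp add: mem)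
  qed (rule reg)
  moreover have "0 islimpt {z \<in> \<Omega>. \<not> regular (1 + birman_schwinger W \<mu> z)}"
    unfolding islimpt_approachable
  proof (intro allI impI)
    fix e :: real assume e: "e > 0"
    define s where "s = min e \<epsilon> / 2"
    have s: "0 < s" "s < e" "s < \<epsilon>" using e eps by (auto simp: s_def)
    then have S: "complex_of_real s \<in> \<Omega>" using \<delta> by (simp add: mem)
    have "\<not> regular (deformed_free (complex_of_real s) + W (complex_of_real s) - sc (2 - 2 * \<mu>))"
      using regular_at_real[of s] s \<mu>(3) by (simp add: singular_set_def)
    then have "\<not> regular (1 + birman_schwinger W \<mu> (complex_of_real s))"
      using regular_deformed_iff[OF _ pen[OF S], of W] s eps by simp
    then show "\<exists>x'\<in>{z \<in> \<Omega>. \<not> regular (1 + birman_schwinger W \<mu> z)}. x' \<noteq> 0 \<and> dist x' 0 < e"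
      using S s by (intro bexI[of _ "complex_of_real s"]) auto
  qed
  ultimately show False by contradiction
qed

text \<open>For the fixed deformation parameter \<open>i q\<close> the pencil is invertible for \<open>\<mu>\<close> in a disc that
  contains the interval \<open>(-1, 1)\<close> and reaches up to \<open>i / q\<close>. For small \<open>q\<close> the points near the top
  correspond to spectral parameters beyond the norm of the deformed operator.\<close>

lemma not_limit_inside:
  assumes \<sigma>: "\<sigma> = 1 \<or> \<sigma> = - 1" and x: "\<bar>x\<bar> < 1"
  shows "\<not> complex_of_real x islimpt (singular_set \<inter> {\<mu>. 0 < \<sigma> * Im \<mu>})"
proof
  assume lim: "complex_of_real x islimpt (singular_set \<inter> {\<mu>. 0 < \<sigma> * Im \<mu>})"
  have \<sigma>2: "\<sigma> * \<sigma> = 1" "\<bar>\<sigma>\<bar> = 1" using \<sigma> by auto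
  define N where "N \<tau> = deformed_free \<tau> + W \<tau>" for \<tau>
  have "isCont N 0"
    unfolding N_def[abs_def]
    by (intro op_hol_at_isCont op_hol_at_add op_hol_deformed_free W_hol) (use eps in auto)
  then have "\<exists>d>0. \<forall>\<tau>. dist \<tau> 0 < d \<longrightarrow> dist (N \<tau>) (N 0) < 1"
    unfolding continuous_at_eps_delta by (elim allE[of _ 1]) simp
  then obtain d where d: "d > 0" "\<And>\<tau>. dist \<tau> 0 < d \<Longrightarrow> dist (N \<tau>) (N 0) < 1" by auto
  \<comment> \<open>the spectral parameter 2 - 2 w for w = \<plusminus> i s has modulus above the norm of all N \<tau> with \<tau> near 0\<close>
  define s where "s = norm (N 0) + 1"
  have s: "s > 0" "s \<ge> 1" by (auto simp: s_def add_nonneg_pos)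
  \<comment> \<open>the last bound places i s below the top i / q of the disc\<close>
  define q where "q = min (min (d / 2) (\<epsilon> / 2)) (1 / (s + 1))"
  have q: "0 < q" "q < d" "q < \<epsilon>" "q < 1" "q \<le> 1 / (s + 1)"
    using d(1) eps s by (auto simp: q_def)
  have q2: "q\<^sup>2 < 1" using q by (simp add: power_less_one_iff abs_square_less_1)
  define \<tau> where "\<tau> = Complex 0 (\<sigma> * q)"
  have c\<tau>: "cmod \<tau> = q" using q \<sigma>2 by (simp add: \<tau>_def cmod_def power_mult_distrib power2_eq_square[of \<sigma>])
  have i\<tau>: "\<sigma> * Im \<tau> = q" using \<sigma>2 by (simp add: \<tau>_def mult.assoc[symmetric])
  define a where "a = (1 - q\<^sup>2) / (2 * q)"
  have a: "2 * a * q = 1 - q\<^sup>2" using q by (simp add: a_def)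
  \<comment> \<open>the set of all \<mu> at which the sign expression of the pencil is positive, seen to be a disc by completing the square\<close>
  define D where "D = ball (Complex 0 (\<sigma> * a)) (sqrt (1 + a\<^sup>2))"
  have memD: "\<mu> \<in> D \<longleftrightarrow> (cmod \<mu>)\<^sup>2 - 2 * a * (\<sigma> * Im \<mu>) < 1" for \<mu>
  proof -
    have "\<mu> \<in> D \<longleftrightarrow> (cmod (\<mu> - Complex 0 (\<sigma> * a)))\<^sup>2 < 1 + a\<^sup>2"
    proof -
      have "\<mu> \<in> D \<longleftrightarrow> sqrt ((cmod (\<mu> - Complex 0 (\<sigma> * a)))\<^sup>2) < sqrt (1 + a\<^sup>2)"
        by (simp add: D_def dist_norm norm_minus_commute)
      then show ?thesis by (simp only: real_sqrt_less_iff)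
    qed
    also have "(cmod (\<mu> - Complex 0 (\<sigma> * a)))\<^sup>2 = (cmod \<mu>)\<^sup>2 - 2 * a * (\<sigma> * Im \<mu>) + (\<sigma> * \<sigma>) * a\<^sup>2"
      unfolding cmod_power2 by (simp add: power2_eq_square algebra_simps)
    finally show ?thesis by (simp add: \<sigma>2)
  qed
  have pen: "regular (pencil \<mu> \<tau>)" if "\<mu> \<in> D" for \<mu>
  proof (rule regular_pencil)
    have "q * ((cmod \<mu>)\<^sup>2 - 2 * a * (\<sigma> * Im \<mu>)) < q * 1"
      using that q by (intro mult_strict_left_mono) (auto simp: memD)
    moreover have "q * ((cmod \<mu>)\<^sup>2 - 2 * a * (\<sigma> * Im \<mu>)) = q * (cmod \<mu>)\<^sup>2 - (2 * a * q) * (\<sigma> * Im \<mu>)"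
      by (simp add: algebra_simps)
    ultimately have "q * (cmod \<mu>)\<^sup>2 - (1 - q\<^sup>2) * (\<sigma> * Im \<mu>) < q" unfolding a by simp
    then have "0 < (1 - q\<^sup>2) * (\<sigma> * Im \<mu>) + (\<sigma> * Im \<tau>) * (1 - (cmod \<mu>)\<^sup>2)"
      unfolding i\<tau> right_diff_distrib[of q] by linarith
    also have "\<dots> = \<sigma> * (Im \<mu> * (1 - (cmod \<tau>)\<^sup>2) + Im \<tau> * (1 - (cmod \<mu>)\<^sup>2))"
      unfolding c\<tau> by (simp add: algebra_simps)
    finally show "Im ((\<mu> + \<tau>) * cnj (1 + \<mu> * \<tau>)) \<noteq> 0" unfolding im_pencil_parameter by auto
  qed
  have x2: "x\<^sup>2 < 1" using x by (simp add: abs_square_less_1)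
  have xD: "complex_of_real x \<in> D" using x2 by (simp add: memD)
  define w where "w = Complex 0 (\<sigma> * s)"
  have wD: "w \<in> D"
  proof -
    have "(q * s) + q \<le> 1" using q(5) s by (simp add: field_simps)
    then have "q * s < 1" using q(1) by linarith
    then have "(q * s - 1) * (s + q) < 0" using s q by (intro mult_neg_pos) auto
    then have "q * s\<^sup>2 - (1 - q\<^sup>2) * s < q" by (simp add: power2_eq_square algebra_simps)
    moreover have "q * (s\<^sup>2 - 2 * a * s) = q * s\<^sup>2 - (2 * a * q) * s" by (simp add: algebra_simps)
    ultimately have "q * (s\<^sup>2 - 2 * a * s) < q * 1" unfolding a by simp
    then have "s\<^sup>2 - 2 * a * s < 1" using q(1) by (simp only: mult_less_cancel_left_pos)
    then show ?thesis
      using \<sigma>2 s by (simp add: memD w_def cmod_def power_mult_distrib power2_eq_square[of \<sigma>] mult.assoc[symmetric])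
  qed
  have "regular (1 + birman_schwinger W w \<tau>)"
  proof -
    have "norm (N \<tau>) < s"
    proof -
      have "dist (N \<tau>) (N 0) < 1" using d(2)[of \<tau>] q c\<tau> by (simp add: dist_norm)
      then show ?thesis using norm_triangle_ineq2[of "N \<tau>" "N 0"] by (simp add: s_def dist_norm)
    qed
    define l where "l = 2 - 2 * w"
    have ls: "s \<le> cmod l"
      using abs_Im_le_cmod[of l] \<sigma>2 s by (simp add: l_def w_def abs_mult)
    then have l0: "l \<noteq> 0" using s by auto
    have "norm (sc (1 / l) * N \<tau>) < 1"
      unfolding norm_sc_mult using \<open>norm (N \<tau>) < s\<close> ls s by (simp add: norm_divide divide_less_eq)
    then have "regular (sc (- l) * (1 - sc (1 / l) * N \<tau>))"
      using l0 by (intro regular_mult regular_sc regular_one_minus) auto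
    moreover have "sc (- l) * (1 - sc (1 / l) * N \<tau>) = deformed_free \<tau> + W \<tau> - sc (2 - 2 * w)"
    proof -
      have "- l * (1 / l) = - 1" using l0 by simp
      then show ?thesis
        by (simp only: right_diff_distrib mult_1_right mult.assoc[symmetric] sc_mult[symmetric])
          (simp only: sc_uminus sc_1 l_def, simp add: N_def)
    qed
    ultimately show ?thesis
      using regular_deformed_iff[OF _ pen[OF wD], of W] c\<tau> q by simp
  qed
  then have "\<not> complex_of_real x islimpt {\<mu> \<in> D. \<not> regular (1 + birman_schwinger W \<mu> \<tau>)}"
  proof (intro analytic_fredholm[OF _ _ _ _ wD _ xD])
    show "open D" "connected D" unfolding D_def by (auto intro: convex_connected)
    show "op_hol_at (\<lambda>\<mu>. birman_schwinger W \<mu> \<tau>) z" if "z \<in> D" for z by (rule op_hol_birman_schwinger(1)[OF pen[OF that]])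
    show "approximable (birman_schwinger W z \<tau>)" for z by (intro approximable_birman_schwinger W_app) (simp add: c\<tau> q)
  qed
  moreover have "complex_of_real x islimpt {\<mu> \<in> D. \<not> regular (1 + birman_schwinger W \<mu> \<tau>)}"
  proof (rule islimpt_subset)
    have U: "open (D \<inter> ball 0 1)" "complex_of_real x \<in> D \<inter> ball 0 1" using xD x by (auto simp: D_def)
    show "complex_of_real x islimpt ((singular_set \<inter> {\<mu>. 0 < \<sigma> * Im \<mu>}) \<inter> (D \<inter> ball 0 1))"
      by (rule islimpt_Int_eventually[OF lim eventually_at_in_open'[OF U]])
    show "(singular_set \<inter> {\<mu>. 0 < \<sigma> * Im \<mu>}) \<inter> (D \<inter> ball 0 1) \<subseteq> {\<mu> \<in> D. \<not> regular (1 + birman_schwinger W \<mu> \<tau>)}"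
      using singular_persists[OF \<sigma>, of _ \<tau>] c\<tau> i\<tau> q by auto
  qed
  ultimately show False by contradiction
qed

text \<open>Off the spectrum of the free operator the undeformed Birman-Schwinger operator
  \<open>V (H\<^sub>0 - \<lambda>)\<inverse>\<close> suffices.\<close>

lemma not_limit_outside:
  assumes \<mu>0: "\<mu>0 \<notin> complex_of_real ` {-1..1}"
  shows "\<not> \<mu>0 islimpt singular_set"
proof -
  let ?I = "complex_of_real ` {-1..1}"
  define K where "K \<mu> = V * op_inv (Op free_op - sc (2 - 2 * \<mu>))" for \<mu>
  have eq: "Op free_op - sc (2 - 2 * \<mu>) = sc (- 2) * (cos_op - sc \<mu>)" for \<mu>
    by (simp add: free_op_eq right_diff_distrib sc_mult[symmetric] sc_diff sc_uminus)
  have reg: "regular (Op free_op - sc (2 - 2 * \<mu>))" if "\<mu> \<notin> ?I" for \<mu>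
    unfolding eq by (intro regular_mult regular_sc regular_cos_op_minus that) simp
  have iff: "regular (Op free_op + V - sc (2 - 2 * \<mu>)) \<longleftrightarrow> regular (1 + K \<mu>)" if "\<mu> \<notin> ?I" for \<mu>
  proof -
    have "(1 + K \<mu>) * (Op free_op - sc (2 - 2 * \<mu>)) = Op free_op + V - sc (2 - 2 * \<mu>)"
      by (simp only: K_def distrib_right mult_1_left mult.assoc op_inv[OF reg[OF that]] mult_1_right) simp
    then show ?thesis using regular_mult_right_iff[OF reg[OF that]] by metis
  qed
  have cI: "closed ?I" "bounded ?I" "convex ?I"
    by (auto intro!: compact_imp_closed compact_imp_bounded compact_continuous_image continuous_intros
        convex_linear_image bounded_linear.linear[OF bounded_linear_of_real])
  define s where "s = norm (Op free_op + V) + 2"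
  have s: "s \<ge> 2" by (simp add: s_def)
  define w where "w = Complex 0 s"
  have w: "w \<notin> ?I" using s by (auto simp: w_def complex_eq_iff)
  have "regular (Op free_op + V - sc (2 - 2 * w))"
  proof -
    define l where "l = 2 - 2 * w"
    have ls: "s \<le> cmod l" using abs_Im_le_cmod[of l] s by (simp add: l_def w_def)
    then have l0: "l \<noteq> 0" using s by auto
    have "norm (Op free_op + V) < cmod l" using ls by (simp add: s_def)
    then have "norm (sc (1 / l) * (Op free_op + V)) < 1"
      unfolding norm_sc_mult using l0 by (simp add: norm_divide divide_less_eq)
    then have "regular (sc (- l) * (1 - sc (1 / l) * (Op free_op + V)))"
      using l0 by (intro regular_mult regular_sc regular_one_minus) auto
    moreover have "sc (- l) * (1 - sc (1 / l) * (Op free_op + V)) = Op free_op + V - sc (2 - 2 * w)"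
    proof -
      have "- l * (1 / l) = - 1" using l0 by simp
      then show ?thesis
        by (simp only: right_diff_distrib mult_1_right mult.assoc[symmetric] sc_mult[symmetric])
          (simp only: sc_uminus sc_1 l_def, simp)
    qed
    ultimately show ?thesis by simp
  qed
  then have rw: "regular (1 + K w)" using iff[OF w] by simp
  have "\<not> \<mu>0 islimpt {z \<in> - ?I. \<not> regular (1 + K z)}"
  proof (rule analytic_fredholm[where w = w])
    show "open (- ?I)" using cI by (simp add: open_Compl)
    show "connected (- ?I)" by (rule connected_complement_bounded_convex) (use cI in auto)
    show "op_hol_at K z" if "z \<in> - ?I" for z
      unfolding K_def[abs_def] using reg[of z] that
      by (intro op_hol_at_mult op_hol_at_op_inv op_hol_at_diff op_hol_at_const op_hol_at_sc)
        (auto intro!: derivative_intros)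
    show "approximable (K z)" for z
      unfolding K_def by (intro approximable_mult approximable_if_compact compact_V)
  qed (use w rw \<mu>0 in auto)
  moreover have "\<mu>0 islimpt {z \<in> - ?I. \<not> regular (1 + K z)}" if "\<mu>0 islimpt singular_set"
  proof (rule islimpt_subset)
    show "\<mu>0 islimpt (singular_set \<inter> - ?I)"
      using that cI(1) \<mu>0 by (intro islimpt_Int_eventually eventually_at_in_open') auto
    show "singular_set \<inter> - ?I \<subseteq> {z \<in> - ?I. \<not> regular (1 + K z)}" using iff by (auto simp: singular_set_def)
  qed
  ultimately show ?thesis by blast
qed

text \<open>Hence no point of the interval is isolated in the spectrum, and isolated real eigenvalues near an
  inner point of it are excluded.\<close>

lemma interval_subset_singular_set:
  assumes "x \<in> {-1..1}"
  shows "complex_of_real x \<in> singular_set"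
proof -
  have "compact (closure (ap (sc (- 1 / 2) * V * 1) ` cball 0 1))"
    by (rule compact_image_mult[OF compact_V]) simp
  then have "\<not> regular (cos_op - sc (complex_of_real x) + sc (- 1 / 2) * V * 1)"
    using assms by (intro not_regular_cos_op_compact) auto
  moreover have "sc (- 2) * (cos_op - sc (complex_of_real x) + sc (- 1 / 2) * V * 1) =
      Op free_op + V - sc (2 - 2 * complex_of_real x)"
    by (simp only: free_op_eq distrib_left right_diff_distrib mult.assoc[symmetric] sc_mult[symmetric] mult_1_right)
      (simp add: sc_uminus sc_diff sc_mult)
  moreover have "regular (sc (- 2) :: int ell2 op)" by (rule regular_sc) simp
  ultimately show ?thesis
    unfolding singular_set_def using regular_mult_left_iff by (metis mem_Collect_eq)
qed

end

theorem theorem2p2: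
  fixes V :: "int ell2 \<Rightarrow>\<^sub>L int ell2"
  assumes "compact_op V" and "V \<in> analytic_class A0"
  shows "{z. z islimpt discrete_spectrum (free_op + V)} \<subseteq> {0, 4}"
proof (rule subsetI, rule ccontr)
  fix z
  assume "z \<in> {z. z islimpt discrete_spectrum (free_op + V)}" and z: "z \<notin> {0, 4}"
  then have lim: "z islimpt discrete_spectrum (free_op + V)" by simp
  obtain W \<epsilon> where "deformation (Op V) W \<epsilon>" using deformation_exists[OF assms] by blast
  then interpret deformation "Op V" W \<epsilon> .
  have Vb: "V \<in> bounded_ops" using assms(1) by (simp add: compact_op_def)
  define f where "f l = 1 - l / 2" for l :: complex
  have f: "2 - 2 * f l = l" for l by (simp add: f_def)
  have spec: "l \<in> spectrum (free_op + V) \<longleftrightarrow> f l \<in> singular_set" for l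
  proof -
    have "free_op + V = op_blinfun (Op free_op + Op V)"
      by (simp add: plus_op.rep_eq Op_inverse free_op_bounded Vb)
    then show ?thesis by (simp add: spectrum_op_blinfun singular_set_def f)
  qed
  let ?S = "discrete_spectrum (free_op + V)"
  have "f z islimpt f ` ?S"
    using lim
  proof (rule islimpt_isCont_image)
    show "isCont f z" unfolding f_def by (intro continuous_intros) auto
    show "\<forall>\<^sub>F y in at z. f y \<noteq> f z" by (simp add: f_def eventually_at_filter)
  qed
  moreover have sub: "f ` ?S \<subseteq> singular_set" by (auto simp: discrete_spectrum_def isolated_in_def spec)
  ultimately have "f z islimpt singular_set" using islimpt_subset by blast
  then obtain x where x: "f z = complex_of_real x" "-1 \<le> x" "x \<le> 1" using not_limit_outside by fastforce
  have zx: "z = complex_of_real (2 - 2 * x)" using f[of z] x(1) by simp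
  have "x \<noteq> 1" "x \<noteq> - 1" using z zx by auto
  then have x1: "\<bar>x\<bar> < 1" using x by auto
  have nonreal: "Im (f l) \<noteq> 0" if l: "l \<in> ?S" "cmod (f l) < 1" for l
  proof
    assume "Im (f l) = 0"
    then obtain y where y: "f l = complex_of_real y" by (metis complex_is_Real_iff Reals_cases)
    have y1: "\<bar>y\<bar> < 1" using l(2) by (simp add: y)
    obtain T where T: "open T" "T \<inter> spectrum (free_op + V) = {l}"
      using l(1) by (auto simp: discrete_spectrum_def isolated_in_def)
    then obtain r where r: "r > 0" "ball l r \<subseteq> T" using open_contains_ball by blast
    \<comment> \<open>a neighbouring point of the interval, still within the isolating disc\<close>
    define h where "h = min (r / 4) ((1 - \<bar>y\<bar>) / 2)"
    have h12: "0 < h" "2 * h < r" using r(1) y1 by (auto simp: h_def)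
    have "h \<le> (1 - \<bar>y\<bar>) / 2" unfolding h_def by (rule min.cobounded2)
    then have "\<bar>y + h\<bar> \<le> 1" using abs_triangle_ineq[of y h] h12 y1 by simp
    note h = h12 this
    define k where "k = l - 2 * complex_of_real h"
    have "f k = complex_of_real (y + h)" using y by (simp add: f_def k_def field_simps)
    then have "k \<in> spectrum (free_op + V)"
      unfolding spec using interval_subset_singular_set[of "y + h"] h(3) by (simp add: abs_le_iff)
    moreover have "k \<in> ball l r" using h by (simp add: k_def dist_norm norm_mult)
    ultimately have "k = l" using T(2) r(2) by blast
    then show False using h(1) by (simp add: k_def)
  qed
  have "f z islimpt (f ` ?S \<inter> ball 0 1)"
    using \<open>f z islimpt f ` ?S\<close> x1 by (intro islimpt_Int_eventually eventually_at_in_open') (auto simp: x(1))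
  moreover have "f ` ?S \<inter> ball 0 1 \<subseteq> (singular_set \<inter> {\<mu>. 0 < 1 * Im \<mu>}) \<union> (singular_set \<inter> {\<mu>. 0 < (- 1) * Im \<mu>})"
    using sub nonreal by (force simp: not_less)
  ultimately have "f z islimpt (singular_set \<inter> {\<mu>. 0 < 1 * Im \<mu>}) \<union> (singular_set \<inter> {\<mu>. 0 < (- 1) * Im \<mu>})"
    using islimpt_subset by blast
  then show False
    using not_limit_inside[of 1 x] not_limit_inside[of "- 1" x] x1 x(1) by (simp add: islimpt_Un)
qed

end
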